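(* Let $\mathfrak d$ be a finite-dimensional Lie algebra over $\mathbf k$, $H=U(\mathfrak d)$, $L$ a Lie $H$-pseudoalgebra, $V$ an $L$-module, $I\subset L$ an ideal, and $\varphi\in\mathrm{Hom}_H(I,H)$ such that $$V_\varphi:=\{v\in V\mid a*v=(\varphi(a)\otimes1)\otimes_Hv\ \ \forall a\in I\}$$ is nonzero. If $V$ is finite (finitely generated) as an $H$-module, then $$L*V_\varphi\subset(H\otimes\mathbf k)\otimes_H(\mathfrak dV_\varphi+V_\varphi).$$ In other words, for every $\beta\in\mathcal A(L)$ there exist $\partial_\beta\in\mathfrak d$ and $A_\beta\in\mathrm{End}\,V_\varphi$ such that $\beta v=(\partial_\beta+A_\beta)v$ for any $v\in V_\varphi$. In particular, $HV_\varphi$ is an $L$-submodule of $V$.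
   Context: $\mathbf k$ is an algebraically closed field of characteristic $0$; vector spaces and unadorned $\otimes$ are over $\mathbf k$. $H=U(\mathfrak d)$ has coproduct $\Delta(a)=a\otimes1+1\otimes a$, antipode $S$; $H^{\otimes n}$ is a right $H$-module via the iterated coproduct. A Lie $H$-pseudoalgebra is a left $H$-module $L$ with a linear map $L\otimes L\to(H\otimes H)\otimes_HL$, $a\otimes b\mapsto[a*b]$, such that $[fa*gb]=((f\otimes g)\otimes_H1)[a*b]$; $[b*a]=-(\sigma\otimes_H\mathrm{id})[a*b]$ ($\sigma$ the flip); and $[a*[b*c]]-((\sigma\otimes\mathrm{id})\otimes_H\mathrm{id})[b*[a*c]]=[[a*b]*c]$ in $H^{\otimes3}\otimes_HL$. Here, if $[a*b]=\sum_i g_i\otimes_He_i$ and $[e_i*c]=\sum_j(f_{ij}\otimes g_{ij})\otimes_He_{ij}$, then $[[a*b]*c]=\sum(g_i\otimes1)(\Delta(f_{ij})\otimes g_{ij})\otimes_He_{ij}$; if $[b*c]=\sum_i h_i\otimes_Hd_i$ and $[a*d_i]=\sum_j(h_{ij}\otimes l_{ij})\otimes_Hd_{ij}$, then $[a*[b*c]]=\sum(1\otimes h_i)(h_{ij}\otimes\Delta(l_{ij}))\otimes_Hd_{ij}$. An ideal is an $H$-submodule $I$ with $[L*I]\subset(H\otimes H)\otimes_HI$. An $L$-module is a left $H$-module $V$ with a linear map $L\otimes V\to(H\otimes H)\otimes_HV$, $a\otimes v\mapsto a*v$, such that $fa*gv=((f\otimes g)\otimes_H1)(a*v)$ and $a*(b*v)-((\sigma\otimes\mathrm{id})\otimes_H\mathrm{id})(b*(a*v))=[a*b]*v$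 in $H^{\otimes3}\otimes_HV$. Here, if $[a*b]=\sum_i g_i\otimes_He_i$ and $e_i*v=\sum_j(f_{ij}\otimes g_{ij})\otimes_Hv_{ij}$, then $[a*b]*v=\sum(g_i\otimes1)(\Delta(f_{ij})\otimes g_{ij})\otimes_Hv_{ij}$; if $b*v=\sum_i h_i\otimes_Hw_i$ and $a*w_i=\sum_j(h_{ij}\otimes l_{ij})\otimes_Hw_{ij}$, then $a*(b*v)=\sum(1\otimes h_i)(h_{ij}\otimes\Delta(l_{ij}))\otimes_Hw_{ij}$. A submodule is an $H$-submodule $U$ with $L*U\subset(H\otimes H)\otimes_HU$. Annihilation algebra: $X=H^*$ is a commutative algebra (product dual to $\Delta$) and an $H$-bimodule by $\langle hx,f\rangle=\langle x,S(h)f\rangle$, $\langle xh,f\rangle=\langle x,fS(h)\rangle$. $\mathcal A(L)=X\otimes_HL$ is a Lie algebra with $[x\otimes_Ha,y\otimes_Hb]=\sum_i(xf_i)(yg_i)\otimes_He_i$ if $[a*b]=\sum_i(f_i\otimes g_i)\otimes_He_i$. It acts on any $L$-module $V$ by $(x\otimes_Ha)\cdot v=\sum_i\langle x,S(h_i)\rangle v_i$ if $a*v=\sum_i(h_i\otimes1)\otimes_Hv_i$ (every element of $(H\otimes H)\otimes_HV$ can be written in this form). For a subspace $U\subset V$, $(H\otimes\mathbf k)\otimes_HU$ denotes the span of the elements $(h\otimes1)\otimes_Hu$, $h\in H$, $u\in U$. *)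

theory Defs
  imports
    "HOL-Computational_Algebra.Computational_Algebra"
    "HOL-Library.Poly_Mapping"
    "HOL-Library.Set_Algebras"
begin

section \<open>Lie algebras and universal enveloping algebras\<close>

locale lie_algebra = vector_space sD
  for sD :: "'k::field \<Rightarrow> 'd::ab_group_add \<Rightarrow> 'd" +
  fixes brD :: "'d \<Rightarrow> 'd \<Rightarrow> 'd"
  assumes linear_left: "Vector_Spaces.linear sD sD (\<lambda>x. brD x y)"
    and linear_right: "Vector_Spaces.linear sD sD (brD x)"
    and alternating: "brD x x = 0"
    and jacobi: "brD x (brD y z) + brD y (brD z x) + brD z (brD x y) = 0"

locale unital_algebra = vector_space sH
  for sH :: "'k::field \<Rightarrow> 'h::ring_1 \<Rightarrow> 'h" +
  assumes scale_mult_left: "sH c (x * y) = sH c x * y"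
    and scale_mult_right: "sH c (x * y) = x * sH c y"

text \<open>
  The free associative algebra on the set \<open>'d\<close> is the space of finitely supported functions on
  words. The relators below, which already contain all multiples \<open>t\<cdot>u\<dots>v\<close>, generate as an additive
  group the two-sided ideal by which it has to be divided to obtain the enveloping algebra: the
  first two families give the tensor algebra of the vector space, the third one imposes
  \<open>xy - yx = [x,y]\<close>.
\<close>

definition env_relators ::
    "('k::field \<Rightarrow> 'd::ab_group_add \<Rightarrow> 'd) \<Rightarrow> ('d \<Rightarrow> 'd \<Rightarrow> 'd) \<Rightarrow> ('d list \<Rightarrow>\<^sub>0 'k) set" where
  "env_relators sD brD =
     {Poly_Mapping.single (u @ [x + y] @ v) t - Poly_Mapping.single (u @ [x] @ v) t
        - Poly_Mapping.single (u @ [y] @ v) t | u x y v t. True} \<union>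
     {Poly_Mapping.single (u @ [sD c x] @ v) t - Poly_Mapping.single (u @ [x] @ v) (t * c)
        | u c x v t. True} \<union>
     {Poly_Mapping.single (u @ [x, y] @ v) t - Poly_Mapping.single (u @ [y, x] @ v) t
        - Poly_Mapping.single (u @ [brD x y] @ v) t | u x y v t. True}"

definition env_eval ::
    "('k::field \<Rightarrow> 'h::ring_1 \<Rightarrow> 'h) \<Rightarrow> ('d \<Rightarrow> 'h) \<Rightarrow> ('d list \<Rightarrow>\<^sub>0 'k) \<Rightarrow> 'h" where
  "env_eval sH \<iota> z = (\<Sum>w\<in>Poly_Mapping.keys z. sH (Poly_Mapping.lookup z w) (prod_list (map \<iota> w)))"

text \<open>
  \<open>'h\<close> together with \<open>\<iota>\<close> is the universal enveloping algebra: the map from the free algebra induced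
  by \<open>\<iota>\<close> is onto and its kernel is the ideal of relations.
\<close>

locale enveloping_algebra = lie_algebra sD brD + H: unital_algebra sH
  for sD :: "'k::field \<Rightarrow> 'd::ab_group_add \<Rightarrow> 'd" and brD :: "'d \<Rightarrow> 'd \<Rightarrow> 'd"
    and sH :: "'k \<Rightarrow> 'h::ring_1 \<Rightarrow> 'h" +
  fixes \<iota> :: "'d \<Rightarrow> 'h"
  assumes eval_surj: "surj (env_eval sH \<iota>)"
    and eval_kernel: "env_eval sH \<iota> z = 0 \<longleftrightarrow> z \<in> group_closure (env_relators sD brD)"


section \<open>Left \<open>H\<close>-modules\<close>

text \<open>The library's module locale requires commutative scalars.\<close>

locale left_module =
  fixes act :: "'h::ring_1 \<Rightarrow> 'm::ab_group_add \<Rightarrow> 'm"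
  assumes act_add_left: "act (g + h) m = act g m + act h m"
    and act_add_right: "act h (m + n) = act h m + act h n"
    and act_mult: "act (g * h) m = act g (act h m)"
    and act_one: "act 1 m = m"

definition h_submodule :: "('h::ring_1 \<Rightarrow> 'm::ab_group_add \<Rightarrow> 'm) \<Rightarrow> 'm set \<Rightarrow> bool" where
  "h_submodule act U \<longleftrightarrow>
     0 \<in> U \<and> (\<forall>u\<in>U. \<forall>v\<in>U. u + v \<in> U) \<and> (\<forall>h. \<forall>u\<in>U. act h u \<in> U)"

definition h_span :: "('h::ring_1 \<Rightarrow> 'm::ab_group_add \<Rightarrow> 'm) \<Rightarrow> 'm set \<Rightarrow> 'm set" where
  "h_span act U = group_closure {act h u | h u. u \<in> U}"

definition finite_h_module :: "('h::ring_1 \<Rightarrow> 'm::ab_group_add \<Rightarrow> 'm) \<Rightarrow> bool" where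
  "finite_h_module act \<longleftrightarrow> (\<exists>S. finite S \<and> h_span act S = UNIV)"

text \<open>\<open>Hom\<^sub>H(I, H)\<close>; only the restriction of \<open>\<phi>\<close> to \<open>I\<close> matters.\<close>

definition h_hom_to_H ::
    "('h::ring_1 \<Rightarrow> 'm::ab_group_add \<Rightarrow> 'm) \<Rightarrow> 'm set \<Rightarrow> ('m \<Rightarrow> 'h) \<Rightarrow> bool" where
  "h_hom_to_H act I \<phi> \<longleftrightarrow>
     (\<forall>a\<in>I. \<forall>b\<in>I. \<phi> (a + b) = \<phi> a + \<phi> b) \<and> (\<forall>h. \<forall>a\<in>I. \<phi> (act h a) = h * \<phi> a)"

text \<open>The vector space structure underlying an \<open>H\<close>-module.\<close>

definition k_scale ::
    "('k::field \<Rightarrow> 'h::ring_1 \<Rightarrow> 'h) \<Rightarrow> ('h \<Rightarrow> 'm::ab_group_add \<Rightarrow> 'm) \<Rightarrow> 'k \<Rightarrow> 'm \<Rightarrow> 'm" where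
  "k_scale sH act c m = act (sH c 1) m"

definition endomorphism_on ::
    "('k::field \<Rightarrow> 'm::ab_group_add \<Rightarrow> 'm) \<Rightarrow> 'm set \<Rightarrow> ('m \<Rightarrow> 'm) \<Rightarrow> bool" where
  "endomorphism_on s U A \<longleftrightarrow>
     (\<forall>u\<in>U. A u \<in> U) \<and> (\<forall>u\<in>U. \<forall>v\<in>U. A (u + v) = A u + A v) \<and> (\<forall>c. \<forall>u\<in>U. A (s c u) = s c (A u))"


section \<open>Tensor products\<close>

text \<open>
  Every tensor product is a free abelian group modulo the subgroup \<open>N\<close> generated by relators, and
  its elements are the cosets \<open>z +o N\<close>. The sum of two cosets is their sum \<open>A + B\<close> as sets. Note
  that \<open>A - B\<close> and \<open>- A\<close> denote set-theoretic operations, so these are never applied to cosets.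
\<close>

type_synonym 'a fsum = "'a \<Rightarrow>\<^sub>0 int"

definition coset_rep :: "'a set \<Rightarrow> 'a" where
  "coset_rep A = (SOME z. z \<in> A)"

definition cosets :: "'a::ab_group_add set \<Rightarrow> 'a set set" where
  "cosets N = range (\<lambda>z. z +o N)"

text \<open>
  The map to the quotient by \<open>N\<close> that is induced by a homomorphism \<open>F\<close>; it is used only where it
  does not depend on the representative.
\<close>

definition induced :: "'b::ab_group_add set \<Rightarrow> ('a \<Rightarrow> 'b) \<Rightarrow> 'a set \<Rightarrow> 'b set" where
  "induced N F A = F (coset_rep A) +o N"

context
  fixes sH :: "'k::field \<Rightarrow> 'h::ring_1 \<Rightarrow> 'h"
begin

subsection \<open>The algebra \<open>H \<otimes> H\<close>, the coproduct and the antipode\<close>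

definition HH_null :: "('h \<times> 'h) fsum set" where
  "HH_null = group_closure
     ({frag_of (f + f', g) - frag_of (f, g) - frag_of (f', g) | f f' g. True} \<union>
      {frag_of (f, g + g') - frag_of (f, g) - frag_of (f, g') | f g g'. True} \<union>
      {frag_of (sH c f, g) - frag_of (f, sH c g) | c f g. True})"

definition HH_tensor :: "'h \<Rightarrow> 'h \<Rightarrow> ('h \<times> 'h) fsum set" where
  "HH_tensor f g = frag_of (f, g) +o HH_null"

definition HH_scale :: "'k \<Rightarrow> ('h \<times> 'h) fsum set \<Rightarrow> ('h \<times> 'h) fsum set" where
  "HH_scale c = induced HH_null (frag_extend (\<lambda>(f, g). frag_of (sH c f, g)))"

definition HH_mult :: "('h \<times> 'h) fsum set \<Rightarrow> ('h \<times> 'h) fsum set \<Rightarrow> ('h \<times> 'h) fsum set" where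
  "HH_mult A B =
     frag_extend (\<lambda>(f, g). frag_extend (\<lambda>(f', g'). frag_of (f * f', g * g')) (coset_rep B))
       (coset_rep A) +o HH_null"

definition is_coproduct :: "('d \<Rightarrow> 'h) \<Rightarrow> ('h \<Rightarrow> ('h \<times> 'h) fsum set) \<Rightarrow> bool" where
  "is_coproduct \<iota> D \<longleftrightarrow>
     (\<forall>h. D h \<in> cosets HH_null) \<and>
     (\<forall>g h. D (g + h) = D g + D h) \<and>
     (\<forall>c h. D (sH c h) = HH_scale c (D h)) \<and>
     D 1 = HH_tensor 1 1 \<and>
     (\<forall>g h. D (g * h) = HH_mult (D g) (D h)) \<and>
     (\<forall>a. D (\<iota> a) = HH_tensor (\<iota> a) 1 + HH_tensor 1 (\<iota> a))"

definition coproduct :: "('d \<Rightarrow> 'h) \<Rightarrow> 'h \<Rightarrow> ('h \<times> 'h) fsum set" where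
  "coproduct \<iota> = (THE D. is_coproduct \<iota> D)"

definition is_antipode :: "('d \<Rightarrow> 'h) \<Rightarrow> ('h \<Rightarrow> 'h) \<Rightarrow> bool" where
  "is_antipode \<iota> S \<longleftrightarrow>
     (\<forall>g h. S (g + h) = S g + S h) \<and>
     (\<forall>c h. S (sH c h) = sH c (S h)) \<and>
     S 1 = 1 \<and>
     (\<forall>g h. S (g * h) = S h * S g) \<and>
     (\<forall>a. S (\<iota> a) = - \<iota> a)"

definition antipode :: "('d \<Rightarrow> 'h) \<Rightarrow> 'h \<Rightarrow> 'h" where
  "antipode \<iota> = (THE S. is_antipode \<iota> S)"

end

context
  fixes sH :: "'k::field \<Rightarrow> 'h::ring_1 \<Rightarrow> 'h" and \<iota> :: "'d \<Rightarrow> 'h"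
begin

subsection \<open>The tensor products \<open>(H \<otimes> H) \<otimes>\<^sub>H M\<close> and \<open>(H \<otimes> H \<otimes> H) \<otimes>\<^sub>H M\<close>\<close>

text \<open>
  Both are presented in one step, by the generators \<open>(f \<otimes> g) \<otimes>\<^sub>H m\<close>, respectively
  \<open>(f \<otimes> g \<otimes> k) \<otimes>\<^sub>H m\<close>. The last family of relators is the balancing over \<open>H\<close>, where \<open>H\<close> acts on
  the right through the coproduct, respectively through \<open>(\<Delta> \<otimes> id) \<Delta>\<close>.
\<close>

definition pt2_null :: "('h \<Rightarrow> 'm::ab_group_add \<Rightarrow> 'm) \<Rightarrow> ('h \<times> 'h \<times> 'm) fsum set" where
  "pt2_null act = group_closure
     ({frag_of (f + f', g, m) - frag_of (f, g, m) - frag_of (f', g, m) | f f' g m. True} \<union>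
      {frag_of (f, g + g', m) - frag_of (f, g, m) - frag_of (f, g', m) | f g g' m. True} \<union>
      {frag_of (f, g, m + m') - frag_of (f, g, m) - frag_of (f, g, m') | f g m m'. True} \<union>
      {frag_of (sH c f, g, m) - frag_of (f, sH c g, m) | c f g m. True} \<union>
      {frag_extend (\<lambda>(h\<^sub>1, h\<^sub>2). frag_of (f * h\<^sub>1, g * h\<^sub>2, m)) (coset_rep (coproduct sH \<iota> h))
         - frag_of (f, g, act h m) | f g h m. True})"

definition pt3_null :: "('h \<Rightarrow> 'm::ab_group_add \<Rightarrow> 'm) \<Rightarrow> ('h \<times> 'h \<times> 'h \<times> 'm) fsum set" where
  "pt3_null act = group_closure
     ({frag_of (f + f', g, k, m) - frag_of (f, g, k, m) - frag_of (f', g, k, m)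
         | f f' g k m. True} \<union>
      {frag_of (f, g + g', k, m) - frag_of (f, g, k, m) - frag_of (f, g', k, m)
         | f g g' k m. True} \<union>
      {frag_of (f, g, k + k', m) - frag_of (f, g, k, m) - frag_of (f, g, k', m)
         | f g k k' m. True} \<union>
      {frag_of (f, g, k, m + m') - frag_of (f, g, k, m) - frag_of (f, g, k, m')
         | f g k m m'. True} \<union>
      {frag_of (sH c f, g, k, m) - frag_of (f, sH c g, k, m) | c f g k m. True} \<union>
      {frag_of (f, sH c g, k, m) - frag_of (f, g, sH c k, m) | c f g k m. True} \<union>
      {frag_extend (\<lambda>(p, h\<^sub>3).
           frag_extend (\<lambda>(h\<^sub>1, h\<^sub>2). frag_of (f * h\<^sub>1, g * h\<^sub>2, k * h\<^sub>3, m))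
             (coset_rep (coproduct sH \<iota> p)))
         (coset_rep (coproduct sH \<iota> h))
         - frag_of (f, g, k, act h m) | f g k h m. True})"

definition pt2_tensor ::
    "('h \<Rightarrow> 'm::ab_group_add \<Rightarrow> 'm) \<Rightarrow> 'h \<Rightarrow> 'h \<Rightarrow> 'm \<Rightarrow> ('h \<times> 'h \<times> 'm) fsum set" where
  "pt2_tensor act f g m = frag_of (f, g, m) +o pt2_null act"

text \<open>The action of \<open>(f \<otimes> g) \<otimes>\<^sub>H 1\<close>.\<close>

definition pt2_lmult :: "('h \<Rightarrow> 'm::ab_group_add \<Rightarrow> 'm) \<Rightarrow> 'h \<Rightarrow> 'h \<Rightarrow>
    ('h \<times> 'h \<times> 'm) fsum set \<Rightarrow> ('h \<times> 'h \<times> 'm) fsum set" where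
  "pt2_lmult act f g =
     induced (pt2_null act) (frag_extend (\<lambda>(p, q, m). frag_of (f * p, g * q, m)))"

text \<open>\<open>-(\<sigma> \<otimes>\<^sub>H id)\<close>\<close>

definition pt2_neg_flip :: "('h \<Rightarrow> 'm::ab_group_add \<Rightarrow> 'm) \<Rightarrow>
    ('h \<times> 'h \<times> 'm) fsum set \<Rightarrow> ('h \<times> 'h \<times> 'm) fsum set" where
  "pt2_neg_flip act =
     induced (pt2_null act) (frag_extend (\<lambda>(p, q, m). - frag_of (q, p, m)))"

text \<open>\<open>(\<sigma> \<otimes> id) \<otimes>\<^sub>H id\<close>\<close>

definition pt3_flip :: "('h \<Rightarrow> 'm::ab_group_add \<Rightarrow> 'm) \<Rightarrow>
    ('h \<times> 'h \<times> 'h \<times> 'm) fsum set \<Rightarrow> ('h \<times> 'h \<times> 'h \<times> 'm) fsum set" where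
  "pt3_flip act =
     induced (pt3_null act) (frag_extend (\<lambda>(p, q, r, m). frag_of (q, p, r, m)))"

text \<open>The images of \<open>(H \<otimes> H) \<otimes>\<^sub>H U\<close> and of \<open>(H \<otimes> k) \<otimes>\<^sub>H U\<close> in \<open>(H \<otimes> H) \<otimes>\<^sub>H M\<close>.\<close>

definition pt2_sub ::
    "('h \<Rightarrow> 'm::ab_group_add \<Rightarrow> 'm) \<Rightarrow> 'm set \<Rightarrow> ('h \<times> 'h \<times> 'm) fsum set set" where
  "pt2_sub act U =
     (\<lambda>z. z +o pt2_null act) ` group_closure {frag_of (f, g, u) | f g u. u \<in> U}"

definition pt2_sub_left ::
    "('h \<Rightarrow> 'm::ab_group_add \<Rightarrow> 'm) \<Rightarrow> 'm set \<Rightarrow> ('h \<times> 'h \<times> 'm) fsum set set" where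
  "pt2_sub_left act U =
     (\<lambda>z. z +o pt2_null act) ` group_closure {frag_of (f, 1, u) | f u. u \<in> U}"


subsection \<open>Composition of pseudoproducts\<close>

text \<open>
  For a pseudoproduct \<open>star\<close> with values in \<open>(H \<otimes> H) \<otimes>\<^sub>H M\<close>, \<open>comp_left act star a A\<close> is \<open>a * A\<close>
  for \<open>A\<close> in \<open>(H \<otimes> H) \<otimes>\<^sub>H M\<close>, and \<open>comp_right act star B m\<close> is \<open>B * m\<close> for \<open>B\<close> in
  \<open>(H \<otimes> H) \<otimes>\<^sub>H L\<close>; the action \<open>act\<close> is the one on \<open>M\<close>.
\<close>

definition comp_left :: "('h \<Rightarrow> 'm::ab_group_add \<Rightarrow> 'm) \<Rightarrow> ('l \<Rightarrow> 'm \<Rightarrow> ('h \<times> 'h \<times> 'm) fsum set) \<Rightarrow>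
    'l \<Rightarrow> ('h \<times> 'h \<times> 'm) fsum set \<Rightarrow> ('h \<times> 'h \<times> 'h \<times> 'm) fsum set" where
  "comp_left act star a A =
     frag_extend (\<lambda>(h\<^sub>1, h\<^sub>2, d).
       frag_extend (\<lambda>(h, l, e).
         frag_extend (\<lambda>(l\<^sub>1, l\<^sub>2). frag_of (h, h\<^sub>1 * l\<^sub>1, h\<^sub>2 * l\<^sub>2, e))
           (coset_rep (coproduct sH \<iota> l)))
         (coset_rep (star a d)))
       (coset_rep A) +o pt3_null act"

definition comp_right :: "('h \<Rightarrow> 'm::ab_group_add \<Rightarrow> 'm) \<Rightarrow> ('l \<Rightarrow> 'm \<Rightarrow> ('h \<times> 'h \<times> 'm) fsum set) \<Rightarrow>
    ('h \<times> 'h \<times> 'l) fsum set \<Rightarrow> 'm \<Rightarrow> ('h \<times> 'h \<times> 'h \<times> 'm) fsum set" where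
  "comp_right act star B m =
     frag_extend (\<lambda>(g\<^sub>1, g\<^sub>2, e).
       frag_extend (\<lambda>(f, g, d).
         frag_extend (\<lambda>(f\<^sub>1, f\<^sub>2). frag_of (g\<^sub>1 * f\<^sub>1, g\<^sub>2 * f\<^sub>2, g, d))
           (coset_rep (coproduct sH \<iota> f)))
         (coset_rep (star e m)))
       (coset_rep B) +o pt3_null act"

text \<open>
  Linearity over the ground field is contained in additivity and compatibility with the
  \<open>H\<close>-actions, since the field acts through \<open>H\<close>.
\<close>

definition pseudo_bilinear ::
    "('h \<Rightarrow> 'l::ab_group_add \<Rightarrow> 'l) \<Rightarrow> ('h \<Rightarrow> 'm::ab_group_add \<Rightarrow> 'm) \<Rightarrow>
     ('l \<Rightarrow> 'm \<Rightarrow> ('h \<times> 'h \<times> 'm) fsum set) \<Rightarrow> bool" where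
  "pseudo_bilinear actL actM star \<longleftrightarrow>
     (\<forall>a m. star a m \<in> cosets (pt2_null actM)) \<and>
     (\<forall>a b m. star (a + b) m = star a m + star b m) \<and>
     (\<forall>a m n. star a (m + n) = star a m + star a n) \<and>
     (\<forall>f g a m. star (actL f a) (actM g m) = pt2_lmult actM f g (star a m))"

text \<open>An ideal of \<open>L\<close> is the case where \<open>star\<close> is the pseudobracket.\<close>

definition pseudo_submodule :: "('h \<Rightarrow> 'm::ab_group_add \<Rightarrow> 'm) \<Rightarrow>
    ('l \<Rightarrow> 'm \<Rightarrow> ('h \<times> 'h \<times> 'm) fsum set) \<Rightarrow> 'm set \<Rightarrow> bool" where
  "pseudo_submodule act star U \<longleftrightarrow>
     h_submodule act U \<and> (\<forall>a. \<forall>u\<in>U. star a u \<in> pt2_sub act U)"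

definition phi_space :: "('h \<Rightarrow> 'm::ab_group_add \<Rightarrow> 'm) \<Rightarrow>
    ('l \<Rightarrow> 'm \<Rightarrow> ('h \<times> 'h \<times> 'm) fsum set) \<Rightarrow> 'l set \<Rightarrow> ('l \<Rightarrow> 'h) \<Rightarrow> 'm set" where
  "phi_space act star I \<phi> = {v. \<forall>a\<in>I. star a v = pt2_tensor act (\<phi> a) 1 v}"

text \<open>\<open>d U + U\<close>\<close>

definition d_span :: "('h \<Rightarrow> 'm::ab_group_add \<Rightarrow> 'm) \<Rightarrow> 'm set \<Rightarrow> 'm set" where
  "d_span act U = module.span (k_scale sH act) ({act (\<iota> p) u | p u. u \<in> U} \<union> U)"


subsection \<open>The annihilation algebra and its action\<close>

definition H_dual :: "('h \<Rightarrow> 'k) set" where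
  "H_dual = {x. Vector_Spaces.linear sH (*) x}"

definition dual_right :: "('h \<Rightarrow> 'k) \<Rightarrow> 'h \<Rightarrow> ('h \<Rightarrow> 'k)" where
  "dual_right x h = (\<lambda>f. x (f * antipode sH \<iota> h))"

definition annih_null :: "('h \<Rightarrow> 'l::ab_group_add \<Rightarrow> 'l) \<Rightarrow> (('h \<Rightarrow> 'k) \<times> 'l) fsum set" where
  "annih_null act = group_closure
     ({frag_of (\<lambda>f. x f + y f, a) - frag_of (x, a) - frag_of (y, a)
         | x y a. x \<in> H_dual \<and> y \<in> H_dual} \<union>
      {frag_of (x, a + b) - frag_of (x, a) - frag_of (x, b) | x a b. x \<in> H_dual} \<union>
      {frag_of (dual_right x h, a) - frag_of (x, act h a) | x h a. x \<in> H_dual})"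

text \<open>The underlying space \<open>H\<^sup>* \<otimes>\<^sub>H L\<close> of the annihilation algebra.\<close>

definition annih :: "('h \<Rightarrow> 'l::ab_group_add \<Rightarrow> 'l) \<Rightarrow> (('h \<Rightarrow> 'k) \<times> 'l) fsum set set" where
  "annih act = {z +o annih_null act | z. Poly_Mapping.keys z \<subseteq> H_dual \<times> UNIV}"

text \<open>\<open>(x \<otimes>\<^sub>H a) \<cdot> v\<close>, where \<open>z\<close> stands for \<open>\<Sum>\<^sub>i h\<^sub>i \<otimes> v\<^sub>i\<close> with \<open>a * v = \<Sum>\<^sub>i (h\<^sub>i \<otimes> 1) \<otimes>\<^sub>H v\<^sub>i\<close>.\<close>

definition fourier_act :: "('h \<Rightarrow> 'm::ab_group_add \<Rightarrow> 'm) \<Rightarrow>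
    ('l \<Rightarrow> 'm \<Rightarrow> ('h \<times> 'h \<times> 'm) fsum set) \<Rightarrow> ('h \<Rightarrow> 'k) \<Rightarrow> 'l \<Rightarrow> 'm \<Rightarrow> 'm" where
  "fourier_act act star x a v = (THE w. \<exists>z :: ('h \<times> 'm) fsum.
     star a v = frag_extend (\<lambda>(h, u). frag_of (h, 1, u)) z +o pt2_null act \<and>
     w = (\<Sum>(h, u)\<in>Poly_Mapping.keys z.
            k_scale sH act (of_int (Poly_Mapping.lookup z (h, u)) * x (antipode sH \<iota> h)) u))"

definition annih_act :: "('h \<Rightarrow> 'm::ab_group_add \<Rightarrow> 'm) \<Rightarrow>
    ('l \<Rightarrow> 'm \<Rightarrow> ('h \<times> 'h \<times> 'm) fsum set) \<Rightarrow> (('h \<Rightarrow> 'k) \<times> 'l) fsum set \<Rightarrow> 'm \<Rightarrow> 'm" where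
  "annih_act act star \<beta> v =
     (\<Sum>(x, a)\<in>Poly_Mapping.keys (coset_rep \<beta>).
        k_scale sH act (of_int (Poly_Mapping.lookup (coset_rep \<beta>) (x, a)))
          (fourier_act act star x a v))"

end


section \<open>Lie pseudoalgebras and their modules\<close>

text \<open>
  The Jacobi identity is written with the subtracted term moved to the other side.
\<close>

locale lie_pseudoalgebra = left_module actL
  for sH :: "'k::field \<Rightarrow> 'h::ring_1 \<Rightarrow> 'h" and \<iota> :: "'d \<Rightarrow> 'h"
    and actL :: "'h \<Rightarrow> 'l::ab_group_add \<Rightarrow> 'l" +
  fixes br :: "'l \<Rightarrow> 'l \<Rightarrow> ('h \<times> 'h \<times> 'l) fsum set"
  assumes bracket_bilinear: "pseudo_bilinear sH \<iota> actL actL br"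
    and bracket_skew: "br b a = pt2_neg_flip sH \<iota> actL (br a b)"
    and bracket_jacobi:
      "comp_left sH \<iota> actL br a (br b c) =
         comp_right sH \<iota> actL br (br a b) c +
         pt3_flip sH \<iota> actL (comp_left sH \<iota> actL br b (br a c))"

locale lie_pseudoalgebra_module = lie_pseudoalgebra sH \<iota> actL br + V: left_module actV
  for sH :: "'k::field \<Rightarrow> 'h::ring_1 \<Rightarrow> 'h" and \<iota> :: "'d \<Rightarrow> 'h"
    and actL :: "'h \<Rightarrow> 'l::ab_group_add \<Rightarrow> 'l"
    and br :: "'l \<Rightarrow> 'l \<Rightarrow> ('h \<times> 'h \<times> 'l) fsum set"
    and actV :: "'h \<Rightarrow> 'v::ab_group_add \<Rightarrow> 'v" +
  fixes star :: "'l \<Rightarrow> 'v \<Rightarrow> ('h \<times> 'h \<times> 'v) fsum set"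
  assumes star_bilinear: "pseudo_bilinear sH \<iota> actL actV star"
    and star_bracket:
      "comp_left sH \<iota> actV star a (star b v) =
         comp_right sH \<iota> actV star (br a b) v +
         pt3_flip sH \<iota> actV (comp_left sH \<iota> actV star b (star a v))"

end

theory Submission
  imports Defs
begin

text \<open>
  The idea is to replace pseudoactions by ordinary operators. An element of \<open>(H \<otimes> H) \<otimes>\<^sub>H V\<close> is
  determined by its Fourier coefficients with respect to functionals \<open>x\<close> on \<open>H\<close>
  (\<open>coef_determines\<close>), so the action of \<open>a\<close> amounts to a family of operators \<open>a\<^sub>x\<close> on \<open>V\<close>, the
  modes of \<open>a\<close>. The identity defining a module then says that a commutator of modes is a finite
  sum of modes (\<open>mode_commutator\<close>), and if one of the two elements lies in the ideal \<open>I\<close>, these are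
  modes of elements of \<open>I\<close>.

  A vector \<open>v\<close> is in \<open>V\<^sub>\<phi>\<close> exactly if it is killed by all \<open>\<tau>\<^sub>a\<^sub>,\<^sub>x = a\<^sub>x - x(\<phi>(a))\<close> with \<open>a\<close> in \<open>I\<close>. For
  \<open>b\<close> in \<open>L\<close> and \<open>v\<close> in \<open>V\<^sub>\<phi>\<close> the commutator formula gives \<open>\<tau>\<^sub>a\<^sub>,\<^sub>x (b\<^sub>y v) = \<psi>(a,x) v\<close>, where the scalar
  \<open>\<psi>(a,x)\<close> does not depend on \<open>v\<close>; and for \<open>p\<close> in \<open>\<dd>\<close> one has \<open>\<tau>\<^sub>a\<^sub>,\<^sub>x (p v) = - x(\<phi>(a) p) v\<close>. So
  \<open>b\<^sub>y v - p v\<close> lies in \<open>V\<^sub>\<phi>\<close> for every \<open>v\<close> as soon as \<open>\<psi>(a,x) = - x(\<phi>(a) p)\<close>, and all three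
  conclusions follow once such a \<open>p\<close> is found for every \<open>b\<close> and \<open>y\<close> (\<open>mode_shift_into_phi\<close>).

  If \<open>\<phi>\<close> vanishes on \<open>I\<close>, then so does \<open>\<psi>\<close>, and \<open>p = 0\<close> works. Otherwise let \<open>e\<^sub>1, \<dots>, e\<^sub>r\<close> be a basis of the
  image of \<open>\<dd>\<close> in \<open>H\<close>. The functions \<open>x(\<phi>(a) e\<^sub>i)\<close> of \<open>(a,x)\<close> are linearly independent, because right
  multiplication by a nonzero element of \<open>\<dd>\<close> is injective on \<open>H\<close> (\<open>right_mult_iota_injective\<close>).
  Suppose that \<open>\<psi>\<close> is not a combination of them. Up to terms of lower degree the \<open>\<tau>\<^sub>a\<^sub>,\<^sub>x\<close> act on
  monomials in the \<open>r + 1\<close> operators \<open>e\<^sub>1, \<dots>, e\<^sub>r, b\<^sub>y\<close> as derivations act on polynomials, and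
  independence of the \<open>r + 1\<close> functions means that there are enough derivations to show that the
  ordered monomials applied to a nonzero \<open>v\<close> in \<open>V\<^sub>\<phi>\<close> are linearly independent
  (\<open>mon_independent\<close>). The number of those with exponents at most \<open>n\<close> grows like \<open>n\<^sup>r\<^sup>+\<^sup>1\<close>. But all of
  them lie in the part of filtration degree \<open>O(n)\<close> of the finitely generated \<open>H\<close>-module \<open>V\<close>, whose
  dimension is \<open>O(n\<^sup>r)\<close>, because \<open>H\<close> is spanned by the ordered words in \<open>e\<^sub>1, \<dots>, e\<^sub>r\<close>
  (\<open>level_dimension\<close>). This is a contradiction (\<open>no_independent_raising_mode\<close>).
\<close>

section \<open>Cosets of additive subgroups\<close>

definition additive_subgroup :: "'a::ab_group_add set \<Rightarrow> bool" where
  "additive_subgroup N \<longleftrightarrow> 0 \<in> N \<and> (\<forall>a\<in>N. \<forall>b\<in>N. a - b \<in> N)"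

context
  fixes N :: "'a::ab_group_add set"
  assumes N: "additive_subgroup N"
begin

lemma subgroup_zero: "0 \<in> N"
  using N by (auto simp: additive_subgroup_def)

lemma subgroup_diff: "a \<in> N \<Longrightarrow> b \<in> N \<Longrightarrow> a - b \<in> N"
  using N by (auto simp: additive_subgroup_def)

lemma subgroup_minus: "a \<in> N \<Longrightarrow> - a \<in> N"
  using subgroup_diff[OF subgroup_zero, of a] by simp

lemma subgroup_add: "a \<in> N \<Longrightarrow> b \<in> N \<Longrightarrow> a + b \<in> N"
  using subgroup_diff[of a "- b"] subgroup_minus[of b] by simp

lemma subgroup_sum: "(\<And>i. i \<in> A \<Longrightarrow> f i \<in> N) \<Longrightarrow> sum f A \<in> N"
  by (induction A rule: infinite_finite_induct) (auto intro: subgroup_zero subgroup_add)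

lemma cong_trans: "a - b \<in> N \<Longrightarrow> b - c \<in> N \<Longrightarrow> a - c \<in> N"
  using subgroup_add[of "a - b" "b - c"] by simp

lemma cong_sym: "a - b \<in> N \<Longrightarrow> b - a \<in> N"
  using subgroup_minus[of "a - b"] by simp

lemma cong_add: "a - b \<in> N \<Longrightarrow> c - d \<in> N \<Longrightarrow> (a + c) - (b + d) \<in> N"
  using subgroup_add[of "a - b" "c - d"] by (simp add: algebra_simps)

lemma cong_diff: "a - b \<in> N \<Longrightarrow> c - d \<in> N \<Longrightarrow> (a - c) - (b - d) \<in> N"
  using subgroup_diff[of "a - b" "c - d"] by (simp add: algebra_simps)

lemma coset_eq_iff: "a +o N = b +o N \<longleftrightarrow> a - b \<in> N"
proof
  assume "a +o N = b +o N"
  moreover have "a \<in> a +o N" using subgroup_zero by (force simp: elt_set_plus_def)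
  ultimately show "a - b \<in> N" using set_minus_plus by blast
next
  assume ab: "a - b \<in> N"
  have "c \<in> a +o N \<longleftrightarrow> c \<in> b +o N" for c
    using ab cong_trans[of c a b] cong_trans[of c b a] cong_sym[of a b] by (auto simp: set_minus_plus[symmetric])
  then show "a +o N = b +o N" by blast
qed

lemma coset_rep_cong: "coset_rep (a +o N) - a \<in> N"
proof -
  have "a \<in> a +o N" using subgroup_zero by (force simp: elt_set_plus_def)
  then have "coset_rep (a +o N) \<in> a +o N" unfolding coset_rep_def by (rule someI)
  then show ?thesis by (simp add: set_minus_plus)
qed

lemma coset_rep_coset: "A \<in> cosets N \<Longrightarrow> coset_rep A +o N = A"
  unfolding cosets_def using coset_rep_cong coset_eq_iff by fastforce

lemma coset_add: "(a +o N) + (b +o N) = (a + b) +o N"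
proof -
  have "N + N = N"
    using subgroup_add subgroup_zero by (force simp: set_plus_def)
  then show ?thesis by (simp add: set_plus_rearrange)
qed

lemma coset_in_cosets: "a +o N \<in> cosets N"
  by (simp add: cosets_def)

end

lemma additive_subgroup_closure: "additive_subgroup (group_closure S)"
  by (simp add: additive_subgroup_def group_closure.diff)

lemma additive_subgroup_null: "additive_subgroup {0}"
  by (simp add: additive_subgroup_def)

text \<open>The subgroup may be any additive one, so that the same lemma serves for maps between
  quotients and for maps into a group.\<close>

lemma closure_image_subset:
  assumes N: "additive_subgroup N" and F: "\<And>a b. F (a - b) = F a - F b"
    and gen: "\<And>s. s \<in> S \<Longrightarrow> F s \<in> N" and z: "z \<in> group_closure S"
  shows "F z \<in> N"
  using z
proof induction
  case (base s)
  have "F 0 = 0" using F[of 0 0] by simp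
  with base show ?case using gen subgroup_zero[OF N] by auto
next
  case (diff s t) then show ?case using F subgroup_diff[OF N] by simp
qed

lemma closure_base: "z \<in> S \<Longrightarrow> z \<in> group_closure S"
  by (simp add: group_closure.base)

lemma closure_mono: "S \<subseteq> T \<Longrightarrow> group_closure S \<subseteq> group_closure T"
proof
  fix z assume "S \<subseteq> T" "z \<in> group_closure S"
  then show "z \<in> group_closure T"
    using closure_image_subset[where F = "\<lambda>z. z", OF additive_subgroup_closure[of T]] closure_base by blast
qed

section \<open>The universal property\<close>

lemma env_eval_superset:
  assumes "unital_algebra sH" "finite A" "Poly_Mapping.keys z \<subseteq> A"
  shows "env_eval sH \<iota> z = (\<Sum>w\<in>A. sH (Poly_Mapping.lookup z w) (prod_list (map \<iota> w)))"
proof -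
  interpret unital_algebra sH by fact
  show ?thesis unfolding env_eval_def
    by (rule sum.mono_neutral_left) (use assms in \<open>auto simp: in_keys_iff\<close>)
qed

lemma env_eval_add:
  assumes "unital_algebra sH"
  shows "env_eval sH \<iota> (z + z') = env_eval sH \<iota> z + env_eval sH \<iota> z'"
proof -
  interpret unital_algebra sH by fact
  let ?A = "Poly_Mapping.keys z \<union> Poly_Mapping.keys z' \<union> Poly_Mapping.keys (z + z')"
  show ?thesis
    by (subst (1 2 3) env_eval_superset[OF assms, of ?A])
      (auto simp: lookup_add scale_left_distrib sum.distrib)
qed

lemma env_eval_single:
  assumes "unital_algebra sH"
  shows "env_eval sH \<iota> (Poly_Mapping.single w t) = sH t (prod_list (map \<iota> w))"
proof -
  interpret unital_algebra sH by fact
  show ?thesis by (subst env_eval_superset[OF assms, of "{w}"]) auto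
qed

lemma env_eval_diff:
  assumes "unital_algebra sH"
  shows "env_eval sH \<iota> (z - z') = env_eval sH \<iota> z - env_eval sH \<iota> z'"
  using env_eval_add[OF assms, of \<iota> "z - z'" z'] by (simp add: algebra_simps)

context enveloping_algebra
begin

lemma env_eval_relator: "z \<in> env_relators sD brD \<Longrightarrow> env_eval sH \<iota> z = 0"
  using eval_kernel closure_base by blast

lemmas env_eval_simps = env_eval_diff[OF H.unital_algebra_axioms] env_eval_add[OF H.unital_algebra_axioms]
  env_eval_single[OF H.unital_algebra_axioms]

lemma iota_add: "\<iota> (x + y) = \<iota> x + \<iota> y"
proof -
  have "Poly_Mapping.single ([] @ [x + y] @ []) 1 - Poly_Mapping.single ([] @ [x] @ []) 1
      - Poly_Mapping.single ([] @ [y] @ []) 1 \<in> env_relators sD brD"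
    unfolding env_relators_def by blast
  from env_eval_relator[OF this] show ?thesis by (simp add: env_eval_simps algebra_simps)
qed

lemma iota_scale: "\<iota> (sD c x) = sH c (\<iota> x)"
proof -
  have "Poly_Mapping.single ([] @ [sD c x] @ []) 1 - Poly_Mapping.single ([] @ [x] @ []) (1 * c)
      \<in> env_relators sD brD"
    unfolding env_relators_def by blast
  from env_eval_relator[OF this] show ?thesis by (simp add: env_eval_simps)
qed

lemma iota_bracket: "\<iota> (brD x y) = \<iota> x * \<iota> y - \<iota> y * \<iota> x"
proof -
  have "Poly_Mapping.single ([] @ [x, y] @ []) 1 - Poly_Mapping.single ([] @ [y, x] @ []) 1
      - Poly_Mapping.single ([] @ [brD x y] @ []) 1 \<in> env_relators sD brD"
    unfolding env_relators_def by blast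
  from env_eval_relator[OF this] show ?thesis by (simp add: env_eval_simps algebra_simps)
qed

lemma H_induct_words [consumes 0, case_names word scale add]:
  assumes word: "\<And>w. P (prod_list (map \<iota> w))" and scale: "\<And>c h. P h \<Longrightarrow> P (sH c h)"
    and add: "\<And>g h. P g \<Longrightarrow> P h \<Longrightarrow> P (g + h)"
  shows "P h"
proof -
  obtain z where z: "h = env_eval sH \<iota> z" using eval_surj by (metis surjD)
  have "P 0" using scale[OF word, of 0] by simp
  then have "P (\<Sum>w\<in>A. sH (Poly_Mapping.lookup z w) (prod_list (map \<iota> w)))" for A
    by (induction A rule: infinite_finite_induct) (auto intro: assms)
  then show ?thesis by (simp add: z env_eval_def)
qed

lemma H_induct_left [consumes 0, case_names one scale add mult]:
  assumes "P 1" "\<And>c h. P h \<Longrightarrow> P (sH c h)" "\<And>g h. P g \<Longrightarrow> P h \<Longrightarrow> P (g + h)"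
    "\<And>p h. P h \<Longrightarrow> P (\<iota> p * h)"
  shows "P h"
proof (induction h rule: H_induct_words)
  case (word w) show ?case by (induction w) (auto intro: assms)
qed (auto intro: assms)

lemma H_induct_right [consumes 0, case_names one scale add mult]:
  assumes "P 1" "\<And>c h. P h \<Longrightarrow> P (sH c h)" "\<And>g h. P g \<Longrightarrow> P h \<Longrightarrow> P (g + h)"
    "\<And>p h. P h \<Longrightarrow> P (h * \<iota> p)"
  shows "P h"
proof (induction h rule: H_induct_words)
  case (word w) show ?case by (induction w rule: rev_induct) (auto intro: assms)
qed (auto intro: assms)

text \<open>A \<open>\<dd>\<close>-module structure \<open>L\<close> on a quotient by \<open>N\<close> extends to the enveloping algebra; \<open>\<delta> h\<close>
  represents \<open>h\<cdot>m\<^sub>0\<close>. The coproduct arises from the diagonal action on \<open>H \<otimes> H\<close>, the antipode from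
  the action of \<open>\<dd>\<close> on \<open>H\<close> by negated right multiplication.\<close>

lemma orbit_map_exists:
  fixes N :: "'m::ab_group_add set" and sc :: "'k \<Rightarrow> 'm \<Rightarrow> 'm" and L :: "'d \<Rightarrow> 'm \<Rightarrow> 'm"
  assumes N: "additive_subgroup N"
    and sc_add: "\<And>c m m'. sc c (m + m') = sc c m + sc c m'"
    and sc_N: "\<And>c m. m \<in> N \<Longrightarrow> sc c m \<in> N"
    and sc_plus: "\<And>c d m. sc (c + d) m - (sc c m + sc d m) \<in> N"
    and sc_mult: "\<And>c d m. sc (c * d) m - sc c (sc d m) \<in> N"
    and sc_one: "\<And>m. sc 1 m - m \<in> N"
    and L_add: "\<And>p m m'. L p (m + m') = L p m + L p m'"
    and L_N: "\<And>p m. m \<in> N \<Longrightarrow> L p m \<in> N"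
    and L_sc: "\<And>p c m. L p (sc c m) - sc c (L p m) \<in> N"
    and L_plus: "\<And>p q m. L (p + q) m - (L p m + L q m) \<in> N"
    and L_scale: "\<And>c p m. L (sD c p) m - sc c (L p m) \<in> N"
    and L_bracket: "\<And>p q m. L p (L q m) - L q (L p m) - L (brD p q) m \<in> N"
  shows "\<exists>\<delta>. (\<forall>g h. \<delta> (g + h) - (\<delta> g + \<delta> h) \<in> N) \<and> (\<forall>c h. \<delta> (sH c h) - sc c (\<delta> h) \<in> N) \<and>
    \<delta> 1 - m\<^sub>0 \<in> N \<and> (\<forall>p h. \<delta> (\<iota> p * h) - L p (\<delta> h) \<in> N)"
proof -
  note N_rules = subgroup_zero[OF N] subgroup_add[OF N] subgroup_diff[OF N] subgroup_minus[OF N]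
    subgroup_sum[OF N]
  \<comment> \<open>\<open>\<Psi>\<close> is the map on the free algebra, additive modulo \<open>N\<close>; it has to kill the relators.\<close>
  define T where "T w = foldr L w m\<^sub>0" for w
  define \<Psi> where "\<Psi> z = (\<Sum>w\<in>Poly_Mapping.keys z. sc (Poly_Mapping.lookup z w) (T w))" for z
  have additive: "f 0 = 0" "f (a - b) = f a - f b" "f (sum g A) = (\<Sum>i\<in>A. f (g i))"
    if "\<And>m m'. f (m + m') = f m + f m'"
    for f :: "'m \<Rightarrow> 'm" and a b and A :: "'d list set" and g
  proof -
    show f0: "f 0 = 0" using that[of 0 0] by simp
    show "f (a - b) = f a - f b" using that[of "a - b" b] by (simp add: algebra_simps)
    show "f (sum g A) = (\<Sum>i\<in>A. f (g i))"
      by (induction A rule: infinite_finite_induct) (auto simp: f0 that)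
  qed
  note sc_simps = additive[of "sc _", OF sc_add] and L_simps = additive[of "L _", OF L_add]
  have fold_add: "foldr L u (m + m') = foldr L u m + foldr L u m'" for u m m'
    by (induction u) (auto simp: L_add)
  note fold_simps = additive[of "foldr L _", OF fold_add]
  have fold_N: "m \<in> N \<Longrightarrow> foldr L u m \<in> N" for u m
    by (induction u) (auto simp: L_N)
  have sc0: "sc 0 m \<in> N" for m
    using sc_plus[of 0 0 m] N_rules(4) by fastforce
  have \<Psi>_superset: "\<Psi> z - (\<Sum>w\<in>A. sc (Poly_Mapping.lookup z w) (T w)) \<in> N"
    if "finite A" "Poly_Mapping.keys z \<subseteq> A" for z A
  proof -
    have "(\<Sum>w\<in>A. sc (Poly_Mapping.lookup z w) (T w)) =
        \<Psi> z + (\<Sum>w\<in>A - Poly_Mapping.keys z. sc (Poly_Mapping.lookup z w) (T w))"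
      unfolding \<Psi>_def using that by (metis add.commute sum.subset_diff)
    moreover have "(\<Sum>w\<in>A - Poly_Mapping.keys z. sc (Poly_Mapping.lookup z w) (T w)) \<in> N"
      by (rule N_rules(5)) (auto simp: in_keys_iff sc0)
    ultimately show ?thesis using N_rules(4) by simp
  qed
  have \<Psi>_add: "\<Psi> (z + z') - (\<Psi> z + \<Psi> z') \<in> N" for z z'
  proof -
    let ?A = "Poly_Mapping.keys z \<union> Poly_Mapping.keys z' \<union> Poly_Mapping.keys (z + z')"
    let ?S = "\<lambda>z. \<Sum>w\<in>?A. sc (Poly_Mapping.lookup z w) (T w)"
    have 1: "\<Psi> (z + z') - ?S (z + z') \<in> N" by (rule \<Psi>_superset) auto
    have "?S (z + z') - (?S z + ?S z') \<in> N"
      unfolding sum.distrib[symmetric] sum_subtractf[symmetric] lookup_add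
      by (rule N_rules(5)) (rule sc_plus)
    note 2 = cong_trans[OF N 1 this]
    have "(\<Psi> z + \<Psi> z') - (?S z + ?S z') \<in> N"
      by (intro cong_add[OF N] \<Psi>_superset) auto
    from cong_trans[OF N 2 cong_sym[OF N this]] show ?thesis .
  qed
  have \<Psi>_single: "\<Psi> (Poly_Mapping.single w t) - sc t (T w) \<in> N" for w t
    using \<Psi>_superset[of "{w}" "Poly_Mapping.single w t"] by simp
  have \<Psi>_diff: "\<Psi> (z - z') - (\<Psi> z - \<Psi> z') \<in> N" for z z'
    using N_rules(4)[OF \<Psi>_add[of "z - z'" z']] by (simp add: algebra_simps)
  have relator: "\<Psi> z \<in> N" if "z \<in> env_relators sD brD" for z
  proof -
    have three: "\<Psi> (Poly_Mapping.single a t - Poly_Mapping.single b t - Poly_Mapping.single c t) \<in> N"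
      if "T a - T b - T c \<in> N" for a b c t
    proof -
      have "sc t (T a - T b - T c) \<in> N" using that sc_N by blast
      then have 0: "sc t (T a) - sc t (T b) - sc t (T c) \<in> N" by (simp add: sc_simps)
      let ?s = "\<lambda>a. Poly_Mapping.single a t"
      have "\<Psi> (?s a - ?s b - ?s c) = (\<Psi> (?s a - ?s b - ?s c) - (\<Psi> (?s a - ?s b) - \<Psi> (?s c)))
         + (\<Psi> (?s a - ?s b) - (\<Psi> (?s a) - \<Psi> (?s b)))
         + (\<Psi> (?s a) - sc t (T a)) - (\<Psi> (?s b) - sc t (T b)) - (\<Psi> (?s c) - sc t (T c))
         + (sc t (T a) - sc t (T b) - sc t (T c))"
        by (simp add: algebra_simps)
      also have "\<dots> \<in> N" by (intro N_rules(2,3) \<Psi>_diff \<Psi>_single 0)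
      finally show ?thesis .
    qed
    have T_app: "T (u @ v) = foldr L u (T v)" for u v by (simp add: T_def)
    consider u x y v t where "z = Poly_Mapping.single (u @ [x + y] @ v) t
          - Poly_Mapping.single (u @ [x] @ v) t - Poly_Mapping.single (u @ [y] @ v) t"
      | u c x v t where "z = Poly_Mapping.single (u @ [sD c x] @ v) t - Poly_Mapping.single (u @ [x] @ v) (t * c)"
      | u x y v t where "z = Poly_Mapping.single (u @ [x, y] @ v) t - Poly_Mapping.single (u @ [y, x] @ v) t
          - Poly_Mapping.single (u @ [brD x y] @ v) t"
      using \<open>z \<in> env_relators sD brD\<close> unfolding env_relators_def by blast
    then show ?thesis
    proof cases
      case 1
      have "foldr L u (L (x + y) (T v) - (L x (T v) + L y (T v))) \<in> N" by (intro fold_N L_plus)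
      then show ?thesis unfolding 1 by (intro three) (simp add: T_app fold_simps fold_add T_def diff_diff_eq)
    next
      case 2
      let ?a = "u @ [sD c x] @ v" and ?b = "u @ [x] @ v"
      have fold_sc: "foldr L u (sc c m) - sc c (foldr L u m) \<in> N" for u m
      proof (induction u)
        case Nil then show ?case using N_rules(1) by simp
      next
        case (Cons p u)
        have "L p (foldr L u (sc c m)) - L p (sc c (foldr L u m)) \<in> N"
          using L_N[OF Cons] by (simp add: L_simps)
        from cong_trans[OF N this L_sc] show ?case by simp
      qed
      have "foldr L u (L (sD c x) (T v) - sc c (L x (T v))) \<in> N" by (intro fold_N L_scale)
      then have "T ?a - foldr L u (sc c (L x (T v))) \<in> N" by (simp add: T_app fold_simps T_def)
      from cong_trans[OF N this fold_sc] have "T ?a - sc c (T ?b) \<in> N" by (simp add: T_app T_def)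
      from sc_N[OF this] have "sc t (T ?a) - sc t (sc c (T ?b)) \<in> N" by (simp only: sc_simps)
      from cong_trans[OF N this cong_sym[OF N sc_mult]]
      have 0: "sc t (T ?a) - sc (t * c) (T ?b) \<in> N" .
      have "\<Psi> z = (\<Psi> z - (\<Psi> (Poly_Mapping.single ?a t) - \<Psi> (Poly_Mapping.single ?b (t * c))))
         + (\<Psi> (Poly_Mapping.single ?a t) - sc t (T ?a))
         - (\<Psi> (Poly_Mapping.single ?b (t * c)) - sc (t * c) (T ?b)) + (sc t (T ?a) - sc (t * c) (T ?b))"
        by (simp add: algebra_simps)
      also have "\<dots> \<in> N" unfolding 2 by (intro N_rules(2,3) \<Psi>_diff \<Psi>_single 0)
      finally show ?thesis .
    next
      case 3
      have "foldr L u (L x (L y (T v)) - L y (L x (T v)) - L (brD x y) (T v)) \<in> N" by (intro fold_N L_bracket)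
      then show ?thesis unfolding 3 by (intro three) (simp add: T_app fold_simps T_def)
    qed
  qed
  have kernel: "\<Psi> z \<in> N" if "env_eval sH \<iota> z = 0" for z
  proof -
    have "z \<in> group_closure (env_relators sD brD)" using that eval_kernel by blast
    then show ?thesis
    proof induction
      case (base s) then show ?case using relator N_rules(1) by (auto simp: \<Psi>_def)
    next
      case (diff s t)
      show ?case using N_rules(2)[OF \<Psi>_diff[of s t] N_rules(3)[OF diff(3,4)]] by simp
    qed
  qed
  \<comment> \<open>The induced map on \<open>H\<close>, as a relation that is functional modulo \<open>N\<close>.\<close>
  define R where "R h m \<longleftrightarrow> (\<exists>z. env_eval sH \<iota> z = h \<and> \<Psi> z - m \<in> N)" for h m
  have R_unique: "m - m' \<in> N" if R: "R h m" "R h m'" for h m m'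
  proof -
    obtain z z' where z: "env_eval sH \<iota> z = h" "\<Psi> z - m \<in> N" "env_eval sH \<iota> z' = h" "\<Psi> z' - m' \<in> N"
      using R unfolding R_def by blast
    have "env_eval sH \<iota> (z - z') = 0" using z by (simp add: env_eval_simps)
    then have "\<Psi> z - \<Psi> z' \<in> N" using N_rules(3)[OF kernel[of "z - z'"] \<Psi>_diff[of z z']] by simp
    then show ?thesis using z cong_trans[OF N] cong_sym[OF N] by meson
  qed
  have R_cong: "R h m'" if "R h m" "m - m' \<in> N" for h m m'
    using that unfolding R_def by (blast intro: cong_trans[OF N])
  have R_add: "R (g + h) (m + m')" if "R g m" "R h m'" for g h m m'
    using that cong_trans[OF N \<Psi>_add cong_add[OF N]] env_eval_add[OF H.unital_algebra_axioms]
    unfolding R_def by metis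
  have R_word: "R (sH t (prod_list (map \<iota> w))) (sc t (T w))" for t w
    unfolding R_def using \<Psi>_single by (auto simp: env_eval_simps intro!: exI[of _ "Poly_Mapping.single w t"])
  have R_zero: "R 0 0" unfolding R_def
    by (rule exI[of _ 0]) (simp add: env_eval_def \<Psi>_def N_rules(1))
  have R_sum: "R (sum f A) (sum m A)" if "\<And>w. w \<in> A \<Longrightarrow> R (f w) (m w)" for f m and A :: "'d list set"
    using that by (induction A rule: infinite_finite_induct) (auto intro: R_zero R_add)
  define \<delta> where "\<delta> h = (SOME m. R h m)" for h
  have R_\<delta>: "R h (\<delta> h)" for h
  proof -
    obtain z where "h = env_eval sH \<iota> z" using eval_surj by (metis surjD)
    then have "R h (\<Psi> z)" unfolding R_def using N_rules(1) by auto
    then show ?thesis unfolding \<delta>_def by (rule someI)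
  qed
  have R_scale: "R (sH c h) (sc c m)" if R: "R h m" for c h m
  proof -
    obtain z where z: "env_eval sH \<iota> z = h" "\<Psi> z - m \<in> N" using R unfolding R_def by blast
    let ?l = "Poly_Mapping.lookup z" and ?A = "Poly_Mapping.keys z"
    have "R (\<Sum>w\<in>?A. sH (c * ?l w) (prod_list (map \<iota> w))) (\<Sum>w\<in>?A. sc (c * ?l w) (T w))"
      by (intro R_sum R_word)
    also have "(\<Sum>w\<in>?A. sH (c * ?l w) (prod_list (map \<iota> w))) = sH c h"
      by (simp add: z(1)[symmetric] env_eval_def H.scale_sum_right)
    finally have 1: "R (sH c h) (\<Sum>w\<in>?A. sc (c * ?l w) (T w))" .
    have "(\<Sum>w\<in>?A. sc (c * ?l w) (T w)) - sc c (\<Psi> z) \<in> N"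
      unfolding \<Psi>_def sc_simps sum_subtractf[symmetric] by (rule N_rules(5)) (rule sc_mult)
    moreover have "sc c (\<Psi> z) - sc c m \<in> N" using sc_N[OF z(2)] by (simp add: sc_simps)
    ultimately show ?thesis using R_cong[OF 1] cong_trans[OF N] by blast
  qed
  have R_mult: "R (\<iota> p * h) (L p m)" if R: "R h m" for p h m
  proof -
    obtain z where z: "env_eval sH \<iota> z = h" "\<Psi> z - m \<in> N" using R unfolding R_def by blast
    let ?l = "Poly_Mapping.lookup z" and ?A = "Poly_Mapping.keys z"
    have "R (\<Sum>w\<in>?A. sH (?l w) (prod_list (map \<iota> (p # w)))) (\<Sum>w\<in>?A. sc (?l w) (T (p # w)))"
      by (intro R_sum R_word)
    also have "(\<Sum>w\<in>?A. sH (?l w) (prod_list (map \<iota> (p # w)))) = \<iota> p * h"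
      by (simp add: z(1)[symmetric] env_eval_def sum_distrib_left H.scale_mult_right)
    finally have 1: "R (\<iota> p * h) (\<Sum>w\<in>?A. sc (?l w) (T (p # w)))" .
    have "(\<Sum>w\<in>?A. sc (?l w) (T (p # w))) - L p (\<Psi> z) \<in> N"
      unfolding \<Psi>_def L_simps sum_subtractf[symmetric]
      by (rule N_rules(5)) (simp add: T_def, rule cong_sym[OF N L_sc])
    moreover have "L p (\<Psi> z) - L p m \<in> N" using L_N[OF z(2)] by (simp add: L_simps)
    ultimately show ?thesis using R_cong[OF 1] cong_trans[OF N] by blast
  qed
  have R_one: "R 1 m\<^sub>0" using R_cong[OF R_word[of 1 "[]"], of m\<^sub>0] sc_one[of m\<^sub>0] by (simp add: T_def)
  show ?thesis
    by (intro exI[of _ \<delta>] conjI allI R_unique[OF R_\<delta>] R_add R_scale R_mult R_\<delta> R_one)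
qed

end

section \<open>Linear extension of functions on formal sums\<close>

definition lin :: "('k \<Rightarrow> 'a::ab_group_add \<Rightarrow> 'a) \<Rightarrow> ('k \<Rightarrow> 'b::ab_group_add \<Rightarrow> 'b) \<Rightarrow> ('a \<Rightarrow> 'b) \<Rightarrow> bool" where
  "lin s t f \<longleftrightarrow> (\<forall>u v. f (u + v) = f u + f v) \<and> (\<forall>c u. f (s c u) = t c (f u))"

lemma linD:
  assumes "lin s t f"
  shows "f (u + v) = f u + f v" "f (s c u) = t c (f u)" "f 0 = 0" "f (u - v) = f u - f v" "f (- u) = - f u"
proof -
  show add: "f (u + v) = f u + f v" for u v using assms by (simp add: lin_def)
  show "f (s c u) = t c (f u)" using assms by (simp add: lin_def)
  show f0: "f 0 = 0" using add[of 0 0] by simp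
  show "f (u - v) = f u - f v" using add[of "u - v" v] by (simp add: algebra_simps)
  show "f (- u) = - f u" using add[of u "- u"] f0 by (simp add: eq_neg_iff_add_eq_0 add.commute)
qed

lemma lin_sum: "lin s t f \<Longrightarrow> f (sum g A) = (\<Sum>i\<in>A. f (g i))"
  by (induction A rule: infinite_finite_induct) (auto simp: linD)

definition feval :: "('k::field \<Rightarrow> 'v::ab_group_add \<Rightarrow> 'v) \<Rightarrow> ('a \<Rightarrow> 'v) \<Rightarrow> 'a fsum \<Rightarrow> 'v" where
  "feval s G z = (\<Sum>k\<in>Poly_Mapping.keys z. s (of_int (Poly_Mapping.lookup z k)) (G k))"

context vector_space
begin

lemma feval_superset:
  assumes "finite A" "Poly_Mapping.keys z \<subseteq> A"
  shows "feval scale G z = (\<Sum>k\<in>A. scale (of_int (Poly_Mapping.lookup z k)) (G k))"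
  unfolding feval_def
  by (rule sum.mono_neutral_left) (use assms in \<open>auto simp: in_keys_iff\<close>)

lemma feval_add: "feval scale G (y + z) = feval scale G y + feval scale G z"
proof -
  let ?A = "Poly_Mapping.keys y \<union> Poly_Mapping.keys z \<union> Poly_Mapping.keys (y + z)"
  show ?thesis
    by (subst (1 2 3) feval_superset[of ?A]) (auto simp: lookup_add scale_left_distrib sum.distrib)
qed

lemma feval_diff: "feval scale G (y - z) = feval scale G y - feval scale G z"
  using feval_add[of G "y - z" z] by (simp add: algebra_simps)

lemma feval_zero: "feval scale G 0 = 0"
  by (simp add: feval_def)

lemma feval_frag_of: "feval scale G (frag_of k) = G k"
  by (simp add: feval_def)

lemma feval_minus: "feval scale G (- z) = - feval scale G z"
  using feval_diff[of G 0 z] by (simp add: feval_zero)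

lemmas feval_simps = feval_add feval_diff feval_zero feval_frag_of feval_minus

lemma feval_sum: "feval scale G (sum f A) = (\<Sum>i\<in>A. feval scale G (f i))"
  by (induction A rule: infinite_finite_induct) (auto simp: feval_simps)

lemma feval_frag_extend: "feval scale G (frag_extend F z) = feval scale (\<lambda>k. feval scale G (F k)) z"
  using subset_UNIV
  by (induction z rule: frag_induction) (auto simp: feval_simps frag_extend_diff)

lemma feval_plus: "feval scale (\<lambda>k. F k + G k) z = feval scale F z + feval scale G z"
  by (simp add: feval_def scale_right_distrib sum.distrib)

lemma feval_subtract: "feval scale (\<lambda>k. F k - G k) z = feval scale F z - feval scale G z"
  by (simp add: feval_def scale_right_diff_distrib sum_subtractf)

lemma feval_scale: "feval scale (\<lambda>k. scale c (G k)) z = scale c (feval scale G z)"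
  by (simp add: feval_def scale_sum_right mult.commute)

lemma feval_linear:
  assumes "lin scale t T"
  shows "T (feval scale G z) = feval t (\<lambda>k. T (G k)) z"
  by (simp add: feval_def lin_sum[OF assms] linD[OF assms])

lemma feval_null:
  assumes gen: "\<And>r. r \<in> S \<Longrightarrow> feval scale G r = 0" and z: "z \<in> group_closure S"
  shows "feval scale G z = 0"
  using closure_image_subset[OF additive_subgroup_null, of "feval scale G" S z] assms
  by (simp add: feval_diff)

end

lemma vector_space_field: "vector_space ((*) :: 'k::field \<Rightarrow> 'k \<Rightarrow> 'k)"
  by unfold_locales (simp_all add: algebra_simps)

text \<open>The group version of linear extension, for congruences between maps on formal sums.\<close>

lemma frag_map_in_subgroup:
  assumes N: "additive_subgroup N" and "\<And>a b. F (a - b) = F a - F b" and "\<And>k. F (frag_of k) \<in> N"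
  shows "F m \<in> N"
  using subset_UNIV
proof (induction m rule: frag_induction)
  case zero
  have "F 0 = 0" using assms(2)[of 0 0] by simp
  then show ?case using subgroup_zero[OF N] by simp
qed (use assms subgroup_diff[OF N] in auto)

section \<open>The coproduct and the antipode\<close>

context enveloping_algebra
begin

lemmas scalar_out = H.scale_mult_left[symmetric] H.scale_mult_right[symmetric]

lemma HH_sub: "additive_subgroup (HH_null sH)"
  by (simp add: HH_null_def additive_subgroup_closure)

lemma HH_relators:
  "frag_of (f + f', g) - frag_of (f, g) - frag_of (f', g) \<in> HH_null sH"
  "frag_of (f, g + g') - frag_of (f, g) - frag_of (f, g') \<in> HH_null sH"
  "frag_of (sH c f, g) - frag_of (f, sH c g) \<in> HH_null sH"
  unfolding HH_null_def by (rule closure_base, blast)+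

lemma HH_null_map:
  assumes N: "additive_subgroup N" and F: "\<And>a b. F (a - b) = F a - F b"
    and "\<And>f f' g. F (frag_of (f + f', g)) - F (frag_of (f, g)) - F (frag_of (f', g)) \<in> N"
      "\<And>f g g'. F (frag_of (f, g + g')) - F (frag_of (f, g)) - F (frag_of (f, g')) \<in> N"
      "\<And>c f g. F (frag_of (sH c f, g)) - F (frag_of (f, sH c g)) \<in> N"
    and z: "z \<in> HH_null sH"
  shows "F z \<in> N"
  using z unfolding HH_null_def
  by (rule closure_image_subset[where F = F, OF N F, rotated]) (use assms in \<open>auto simp: F\<close>)

abbreviation sc2 where "sc2 c \<equiv> frag_extend (\<lambda>(f, g). frag_of (sH c f, g))"
abbreviation diag2 where "diag2 p \<equiv> frag_extend (\<lambda>(f, g). frag_of (\<iota> p * f, g) + frag_of (f, \<iota> p * g))"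
abbreviation mult2 where
  "mult2 z w \<equiv> frag_extend (\<lambda>(f, g). frag_extend (\<lambda>(f', g'). frag_of (f * f', g * g')) w) z"

lemmas HH_rules = subgroup_zero[OF HH_sub] subgroup_add[OF HH_sub] subgroup_diff[OF HH_sub]
  subgroup_minus[OF HH_sub]

lemma HH_relators':
  "frag_of (f + f', g) - (frag_of (f, g) + frag_of (f', g)) \<in> HH_null sH"
  "frag_of (f, g + g') - (frag_of (f, g) + frag_of (f, g')) \<in> HH_null sH"
  using HH_relators by (simp_all add: diff_diff_eq)

lemma HH_relators_diff:
  "frag_of (f - f', g) - (frag_of (f, g) - frag_of (f', g)) \<in> HH_null sH"
  "frag_of (f, g - g') - (frag_of (f, g) - frag_of (f, g')) \<in> HH_null sH"
  using HH_rules(4)[OF HH_relators(1)[of "f - f'" f' g]] HH_rules(4)[OF HH_relators(2)[of f "g - g'" g']]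
  by (simp_all add: algebra_simps)

lemma sc2_null: "z \<in> HH_null sH \<Longrightarrow> sc2 c z \<in> HH_null sH"
proof (erule HH_null_map[where F = "sc2 c", OF HH_sub, rotated -1])
  show "sc2 c (frag_of (sH d f, g)) - sc2 c (frag_of (f, sH d g)) \<in> HH_null sH" for d f g
    using HH_relators(3)[of d "sH c f" g] by (simp add: mult.commute)
qed (auto simp: frag_extend_diff H.scale_right_distrib HH_relators)

lemma diag2_null: "z \<in> HH_null sH \<Longrightarrow> diag2 p z \<in> HH_null sH"
proof (erule HH_null_map[where F = "diag2 p", OF HH_sub, rotated -1])
  show "diag2 p (frag_of (f + f', g)) - diag2 p (frag_of (f, g)) - diag2 p (frag_of (f', g)) \<in> HH_null sH" for f f' g
    using HH_rules(2)[OF HH_relators(1)[of "\<iota> p * f" "\<iota> p * f'" g] HH_relators(1)[of f f' "\<iota> p * g"]]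
    by (simp add: algebra_simps)
  show "diag2 p (frag_of (f, g + g')) - diag2 p (frag_of (f, g)) - diag2 p (frag_of (f, g')) \<in> HH_null sH" for f g g'
    using HH_rules(2)[OF HH_relators(2)[of f "\<iota> p * g" "\<iota> p * g'"] HH_relators(2)[of "\<iota> p * f" g g']]
    by (simp add: algebra_simps)
  show "diag2 p (frag_of (sH c f, g)) - diag2 p (frag_of (f, sH c g)) \<in> HH_null sH" for c f g
    using HH_rules(2)[OF HH_relators(3)[of c "\<iota> p * f" g] HH_relators(3)[of c f "\<iota> p * g"]]
    by (simp add: algebra_simps H.scale_mult_right)
qed (simp add: frag_extend_diff)

lemma mult2_null_right: "w \<in> HH_null sH \<Longrightarrow> mult2 z w \<in> HH_null sH"
proof (rule frag_map_in_subgroup[where F = "\<lambda>z. mult2 z w", OF HH_sub])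
  assume w: "w \<in> HH_null sH"
  fix k :: "'h \<times> 'h" obtain f g where k: "k = (f, g)" by (cases k)
  show "mult2 (frag_of k) w \<in> HH_null sH" unfolding k frag_extend_of prod.case
    by (rule HH_null_map[OF HH_sub _ _ _ _ w]) 
      (auto simp: frag_extend_diff distrib_left HH_relators scalar_out)
qed (simp add: frag_extend_diff)

lemma mult2_null_left: "z \<in> HH_null sH \<Longrightarrow> mult2 z w \<in> HH_null sH"
proof (erule HH_null_map[where F = "\<lambda>z. mult2 z w", OF HH_sub, rotated -1])
  show "mult2 (frag_of (f + f', g)) w - mult2 (frag_of (f, g)) w - mult2 (frag_of (f', g)) w \<in> HH_null sH" for f f' g
    by (rule frag_map_in_subgroup[OF HH_sub])
      (auto simp: frag_extend_diff algebra_simps HH_relators(1)[unfolded diff_diff_eq])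
  show "mult2 (frag_of (f, g + g')) w - mult2 (frag_of (f, g)) w - mult2 (frag_of (f, g')) w \<in> HH_null sH" for f g g'
    by (rule frag_map_in_subgroup[OF HH_sub])
      (auto simp: frag_extend_diff algebra_simps HH_relators(2)[unfolded diff_diff_eq])
  show "mult2 (frag_of (sH c f, g)) w - mult2 (frag_of (f, sH c g)) w \<in> HH_null sH" for c f g
    by (rule frag_map_in_subgroup[OF HH_sub])
      (auto simp: frag_extend_diff algebra_simps HH_relators scalar_out)
qed (simp add: frag_extend_diff)

text \<open>The coproduct is the orbit map of \<open>1 \<otimes> 1\<close> under the diagonal action of \<open>\<dd>\<close>. It is multiplicative
  because both sides of \<open>\<Delta>(g h) = \<Delta>(g) \<Delta>(h)\<close> behave in the same way when \<open>g\<close> is multiplied from the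
  left by an element of \<open>\<dd>\<close>.\<close>

lemma coproduct_exists: "\<exists>D. is_coproduct sH \<iota> D"
proof -
  let ?N = "HH_null sH"
  have diag_commute: "diag2 p (sc2 c m) = sc2 c (diag2 p m)" for p c m
    using subset_UNIV by (induction m rule: frag_induction)
      (auto simp: frag_extend_diff frag_extend_add H.scale_mult_right)
  have 1: "sc2 (c + d) m - (sc2 c m + sc2 d m) \<in> ?N" for c d m
    by (rule frag_map_in_subgroup[OF HH_sub])
      (auto simp: frag_extend_diff H.scale_left_distrib HH_relators')
  have 2: "sc2 (c * d) m - sc2 c (sc2 d m) \<in> ?N" for c d m
    by (rule frag_map_in_subgroup[OF HH_sub]) (auto simp: frag_extend_diff HH_rules)
  have 3: "sc2 1 m - m \<in> ?N" for m
    by (rule frag_map_in_subgroup[OF HH_sub]) (auto simp: frag_extend_diff HH_rules)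
  have 4: "diag2 (p + q) m - (diag2 p m + diag2 q m) \<in> ?N" for p q m
  proof (rule frag_map_in_subgroup[where F = "\<lambda>m. diag2 (p + q) m - (diag2 p m + diag2 q m)", OF HH_sub])
    fix k :: "'h \<times> 'h" obtain f g where k: "k = (f, g)" by (cases k)
    show "diag2 (p + q) (frag_of k) - (diag2 p (frag_of k) + diag2 q (frag_of k)) \<in> ?N"
      using HH_rules(2)[OF HH_relators'(1)[of "\<iota> p * f" "\<iota> q * f" g] HH_relators'(2)[of f "\<iota> p * g" "\<iota> q * g"]]
      by (simp add: k iota_add algebra_simps)
  qed (simp add: frag_extend_diff)
  have 5: "diag2 (sD c p) m - sc2 c (diag2 p m) \<in> ?N" for c p m
  proof (rule frag_map_in_subgroup[where F = "\<lambda>m. diag2 (sD c p) m - sc2 c (diag2 p m)", OF HH_sub])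
    fix k :: "'h \<times> 'h" obtain f g where k: "k = (f, g)" by (cases k)
    show "diag2 (sD c p) (frag_of k) - sc2 c (diag2 p (frag_of k)) \<in> ?N"
      using HH_rules(4)[OF HH_relators(3)[of c f "\<iota> p * g"]]
      by (simp add: k iota_scale frag_extend_add scalar_out)
  qed (simp add: frag_extend_diff)
  have 6: "diag2 p (diag2 q m) - diag2 q (diag2 p m) - diag2 (brD p q) m \<in> ?N" for p q m
  proof (rule frag_map_in_subgroup[where F = "\<lambda>m. diag2 p (diag2 q m) - diag2 q (diag2 p m) - diag2 (brD p q) m", OF HH_sub])
    fix k :: "'h \<times> 'h" obtain f g where k: "k = (f, g)" by (cases k)
    show "diag2 p (diag2 q (frag_of k)) - diag2 q (diag2 p (frag_of k)) - diag2 (brD p q) (frag_of k) \<in> ?N"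
      using HH_rules(4)[OF HH_rules(2)[OF
        HH_relators_diff(1)[of "\<iota> p * \<iota> q * f" "\<iota> q * \<iota> p * f" g]
        HH_relators_diff(2)[of f "\<iota> p * \<iota> q * g" "\<iota> q * \<iota> p * g"]]]
      by (simp add: k iota_bracket frag_extend_add algebra_simps)
  qed (simp add: frag_extend_diff)
  obtain \<delta> where d_add: "\<And>g h. \<delta> (g + h) - (\<delta> g + \<delta> h) \<in> ?N"
    and d_scale: "\<And>c h. \<delta> (sH c h) - sc2 c (\<delta> h) \<in> ?N"
    and d_one: "\<delta> 1 - frag_of (1, 1) \<in> ?N" and d_mult: "\<And>p h. \<delta> (\<iota> p * h) - diag2 p (\<delta> h) \<in> ?N"
    using orbit_map_exists[of ?N sc2 diag2 "frag_of (1, 1)"] HH_sub sc2_null diag2_null 1 2 3 4 5 6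
    by (auto simp: frag_extend_add diag_commute HH_rules)
  note trans = cong_trans[OF HH_sub] and sym = cong_sym[OF HH_sub]
  have sc2_cong: "sc2 c z - sc2 c z' \<in> ?N" if "z - z' \<in> ?N" for c z z'
    using sc2_null[OF that, of c] by (simp add: frag_extend_diff)
  have diag2_cong: "diag2 p z - diag2 p z' \<in> ?N" if "z - z' \<in> ?N" for p z z'
    using diag2_null[OF that, of p] by (simp add: frag_extend_diff)
  have mult2_cong1: "mult2 z w - mult2 z' w \<in> ?N" if "z - z' \<in> ?N" for w z z'
    using mult2_null_left[OF that, of w] by (simp add: frag_extend_diff)
  have mult2_diff: "mult2 w (z - z') = mult2 w z - mult2 w z'" for w z z'
    using subset_UNIV by (induction w rule: frag_induction)
      (auto simp: frag_extend_diff)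
  have mult2_cong2: "mult2 w z - mult2 w z' \<in> ?N" if "z - z' \<in> ?N" for w z z'
    using mult2_null_right[OF that, of w] by (simp only: mult2_diff)
  have mult_all: "\<delta> (g * h) - mult2 (\<delta> g) (\<delta> h) \<in> ?N" for g h
  proof (induction g rule: H_induct_left)
    case one
    have "(\<lambda>(f', g'). frag_of (f', g')) = (frag_of :: 'h \<times> 'h \<Rightarrow> _)" by auto
    then have "mult2 (frag_of (1, 1)) (\<delta> h) = \<delta> h"
      by (simp add: frag_expansion[symmetric])
    moreover have "mult2 (frag_of (1, 1)) (\<delta> h) - mult2 (\<delta> 1) (\<delta> h) \<in> ?N"
      by (rule sym[OF mult2_cong1[OF d_one]])
    ultimately show ?case by simp
  next
    case (scale c g)
    have sc2_mult: "mult2 (sc2 c z) w = sc2 c (mult2 z w)" for z w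
    proof -
      have "frag_extend (\<lambda>(f', g'). frag_of (sH c f * f', g * g')) w
          = sc2 c (frag_extend (\<lambda>(f', g'). frag_of (f * f', g * g')) w)" for f g
        using subset_UNIV by (induction w rule: frag_induction)
          (auto simp: frag_extend_diff scalar_out)
      note inner = this
      show ?thesis using subset_UNIV by (induction z rule: frag_induction)
          (auto simp: frag_extend_diff inner)
    qed
    have "mult2 (sc2 c (\<delta> g)) (\<delta> h) - mult2 (\<delta> (sH c g)) (\<delta> h) \<in> ?N"
      by (rule sym[OF mult2_cong1[OF d_scale]])
    then have "sc2 c (mult2 (\<delta> g) (\<delta> h)) - mult2 (\<delta> (sH c g)) (\<delta> h) \<in> ?N"
      by (simp only: sc2_mult)
    from trans[OF sc2_cong[OF scale] this]
    have "sc2 c (\<delta> (g * h)) - mult2 (\<delta> (sH c g)) (\<delta> h) \<in> ?N" .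
    then show ?case using trans[OF d_scale, of c "g * h"] by (simp add: scalar_out)
  next
    case (add g g')
    have "mult2 (\<delta> g + \<delta> g') (\<delta> h) - mult2 (\<delta> (g + g')) (\<delta> h) \<in> ?N"
      by (rule sym[OF mult2_cong1[OF d_add]])
    then have "(mult2 (\<delta> g) (\<delta> h) + mult2 (\<delta> g') (\<delta> h)) - mult2 (\<delta> (g + g')) (\<delta> h) \<in> ?N"
      by (simp only: frag_extend_add)
    from trans[OF cong_add[OF HH_sub add] this]
    have "\<delta> (g * h) + \<delta> (g' * h) - mult2 (\<delta> (g + g')) (\<delta> h) \<in> ?N" .
    then show ?case using trans[OF d_add, of "g * h" "g' * h"] by (simp add: distrib_right)
  next
    case (mult p g)
    have diag2_mult: "mult2 (diag2 p z) w = diag2 p (mult2 z w)" for z w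
    proof -
      have "frag_extend (\<lambda>(f', g'). frag_of (\<iota> p * f * f', g * g')) w + frag_extend (\<lambda>(f', g'). frag_of (f * f', \<iota> p * g * g')) w
          = diag2 p (frag_extend (\<lambda>(f', g'). frag_of (f * f', g * g')) w)" for f g
        using subset_UNIV by (induction w rule: frag_induction)
          (auto simp: frag_extend_diff algebra_simps)
      note inner = this
      show ?thesis using subset_UNIV by (induction z rule: frag_induction)
          (auto simp: frag_extend_diff frag_extend_add inner)
    qed
    have "mult2 (diag2 p (\<delta> g)) (\<delta> h) - mult2 (\<delta> (\<iota> p * g)) (\<delta> h) \<in> ?N"
      by (rule sym[OF mult2_cong1[OF d_mult]])
    then have "diag2 p (mult2 (\<delta> g) (\<delta> h)) - mult2 (\<delta> (\<iota> p * g)) (\<delta> h) \<in> ?N"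
      by (simp only: diag2_mult)
    from trans[OF diag2_cong[OF mult] this]
    have "diag2 p (\<delta> (g * h)) - mult2 (\<delta> (\<iota> p * g)) (\<delta> h) \<in> ?N" .
    then show ?case using trans[OF d_mult, of p "g * h"] by (simp add: mult.assoc)
  qed
  let ?D = "\<lambda>h. \<delta> h +o ?N"
  note rep = coset_rep_cong[OF HH_sub]
  note eqI = coset_eq_iff[OF HH_sub, THEN iffD2]
  have "is_coproduct sH \<iota> ?D" unfolding is_coproduct_def
  proof (intro conjI allI)
    show "?D h \<in> cosets ?N" for h by (rule coset_in_cosets[OF HH_sub])
    show "?D (g + h) = ?D g + ?D h" for g h
      by (simp add: coset_add[OF HH_sub] eqI d_add)
    show "?D (sH c h) = HH_scale sH c (?D h)" for c h
      unfolding HH_scale_def induced_def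
      by (rule eqI, rule trans[OF d_scale sc2_cong[OF sym[OF rep]]])
    show "?D 1 = HH_tensor sH 1 1" unfolding HH_tensor_def by (rule eqI, rule d_one)
    show "?D (g * h) = HH_mult sH (?D g) (?D h)" for g h
      unfolding HH_mult_def
      by (rule eqI, rule trans[OF trans[OF mult_all mult2_cong1[OF sym[OF rep]]] mult2_cong2[OF sym[OF rep]]])
    show "?D (\<iota> a) = HH_tensor sH (\<iota> a) 1 + HH_tensor sH 1 (\<iota> a)" for a
      unfolding HH_tensor_def coset_add[OF HH_sub]
      using trans[OF d_mult[of a 1] diag2_cong[OF d_one]] by (intro eqI) simp
  qed
  then show ?thesis by blast
qed

lemma coproduct_unique:
  assumes D: "is_coproduct sH \<iota> D" "is_coproduct sH \<iota> D'"
  shows "D h = D' h"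
proof (induction h rule: H_induct_left)
qed (use D in \<open>simp_all add: is_coproduct_def\<close>)

lemma is_coproduct_coproduct: "is_coproduct sH \<iota> (coproduct sH \<iota>)"
  unfolding coproduct_def using coproduct_exists coproduct_unique by (metis theI' ext)

lemma antipode_exists: "\<exists>S. is_antipode sH \<iota> S"
proof -
  have "\<exists>S. (\<forall>g h. S (g + h) - (S g + S h) \<in> {0}) \<and> (\<forall>c h. S (sH c h) - sH c (S h) \<in> {0}) \<and>
      S 1 - 1 \<in> {0} \<and> (\<forall>p h. S (\<iota> p * h) - - (S h * \<iota> p) \<in> {0})"
    by (rule orbit_map_exists[OF additive_subgroup_null])
      (auto simp: H.scale_right_distrib H.scale_left_distrib algebra_simps scalar_out iota_add iota_scale iota_bracket)
  then obtain S where add: "\<And>g h. S (g + h) = S g + S h" and scale: "\<And>c h. S (sH c h) = sH c (S h)"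
    and one: "S 1 = 1" and mult: "\<And>p h. S (\<iota> p * h) = - (S h * \<iota> p)"
    by (auto simp: eq_neg_iff_add_eq_0)
  have S_iota: "S (\<iota> a) = - \<iota> a" for a using mult[of a 1] one by simp
  have "S (g * h) = S h * S g" for g h
  proof (induction g rule: H_induct_left)
    case (mult p g)
    then show ?case using \<open>\<And>p h. S (\<iota> p * h) = - (S h * \<iota> p)\<close> by (simp add: mult.assoc)
  qed (simp_all add: one add scale scalar_out algebra_simps)
  then have "is_antipode sH \<iota> S" by (simp add: is_antipode_def add scale one S_iota)
  then show ?thesis by blast
qed

lemma antipode_unique:
  assumes "is_antipode sH \<iota> S" "is_antipode sH \<iota> S'"
  shows "S h = S' h"
  by (induction h rule: H_induct_left) (use assms in \<open>simp_all add: is_antipode_def\<close>)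

lemma is_antipode_antipode: "is_antipode sH \<iota> (antipode sH \<iota>)"
  unfolding antipode_def using antipode_exists antipode_unique by (metis theI' ext)

abbreviation "S \<equiv> antipode sH \<iota>"

lemma antipode_rules: "S (g + h) = S g + S h" "S (sH c h) = sH c (S h)" "S 1 = 1"
  "S (g * h) = S h * S g" "S (\<iota> p) = - \<iota> p"
  using is_antipode_antipode by (simp_all add: is_antipode_def)

subsection \<open>Evaluating bilinear maps on a coproduct\<close>

definition bil :: "('k \<Rightarrow> 'w::ab_group_add \<Rightarrow> 'w) \<Rightarrow> ('h \<Rightarrow> 'h \<Rightarrow> 'w) \<Rightarrow> bool" where
  "bil s G \<longleftrightarrow> (\<forall>g. lin sH s (\<lambda>f. G f g)) \<and> (\<forall>f. lin sH s (\<lambda>g. G f g))"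

text \<open>This is \<open>\<Sum> G(h\<^sub>1, h\<^sub>2)\<close> in Sweedler's notation. For bilinear \<open>G\<close> it does not depend on the chosen
  representative of \<open>\<Delta>(h)\<close>, and the rules below allow every identity between such sums to be
  proved by induction on elements of \<open>H\<close>, one factor from \<open>\<dd>\<close> at a time.\<close>

definition sweedler :: "('k \<Rightarrow> 'w::ab_group_add \<Rightarrow> 'w) \<Rightarrow> ('h \<Rightarrow> 'h \<Rightarrow> 'w) \<Rightarrow> 'h \<Rightarrow> 'w" where
  "sweedler s G h = feval s (\<lambda>(f, g). G f g) (coset_rep (coproduct sH \<iota> h))"

lemma cop_coset: "coset_rep (coproduct sH \<iota> h) +o HH_null sH = coproduct sH \<iota> h"
  using is_coproduct_coproduct by (intro coset_rep_coset[OF HH_sub]) (auto simp: is_coproduct_def)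

context
  fixes s :: "'k \<Rightarrow> 'w::ab_group_add \<Rightarrow> 'w"
  assumes s: "vector_space s"
begin

interpretation W: vector_space s by (rule s)

lemma feval_HH_null:
  assumes G: "bil s G" and z: "z \<in> HH_null sH"
  shows "feval s (\<lambda>(f, g). G f g) z = 0"
  using z unfolding HH_null_def
  by (rule W.feval_null[rotated]) (use G in \<open>auto simp: W.feval_simps bil_def lin_def\<close>)

lemma sweedler_coset:
  assumes G: "bil s G" and h: "coproduct sH \<iota> h = z +o HH_null sH"
  shows "sweedler s G h = feval s (\<lambda>(f, g). G f g) z"
proof -
  have "coset_rep (coproduct sH \<iota> h) - z \<in> HH_null sH" unfolding h by (rule coset_rep_cong[OF HH_sub])
  from feval_HH_null[OF G this] show ?thesis by (simp add: sweedler_def W.feval_simps)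
qed

lemma sweedler_add: assumes "bil s G" shows "sweedler s G (g + h) = sweedler s G g + sweedler s G h"
proof -
  have "coproduct sH \<iota> (g + h) = coproduct sH \<iota> g + coproduct sH \<iota> h"
    using is_coproduct_coproduct by (simp add: is_coproduct_def)
  also have "\<dots> = (coset_rep (coproduct sH \<iota> g) + coset_rep (coproduct sH \<iota> h)) +o HH_null sH"
    by (subst (1 2) cop_coset[symmetric]) (rule coset_add[OF HH_sub])
  finally show ?thesis using sweedler_coset[OF assms] by (simp add: sweedler_def W.feval_simps)
qed

lemma sweedler_scale: assumes G: "bil s G" shows "sweedler s G (sH c h) = s c (sweedler s G h)"
proof -
  have "coproduct sH \<iota> (sH c h) = sc2 c (coset_rep (coproduct sH \<iota> h)) +o HH_null sH"
    using is_coproduct_coproduct by (simp add: is_coproduct_def HH_scale_def induced_def)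
  from sweedler_coset[OF G this] have "sweedler s G (sH c h) = feval s (\<lambda>(f, g). G (sH c f) g) (coset_rep (coproduct sH \<iota> h))"
    by (simp add: W.feval_frag_extend W.feval_simps case_prod_beta')
  also have "(\<lambda>(f, g). G (sH c f) g) = (\<lambda>k. s c ((\<lambda>(f, g). G f g) k))"
    using G by (auto simp: bil_def lin_def)
  finally show ?thesis by (simp add: sweedler_def W.feval_scale)
qed

lemma sweedler_one: assumes G: "bil s G" shows "sweedler s G 1 = G 1 1"
proof -
  have "coproduct sH \<iota> 1 = frag_of (1, 1) +o HH_null sH"
    using is_coproduct_coproduct by (simp add: is_coproduct_def HH_tensor_def)
  from sweedler_coset[OF G this] show ?thesis by (simp add: W.feval_simps)
qed

lemma sweedler_iota: assumes G: "bil s G" shows "sweedler s G (\<iota> p) = G (\<iota> p) 1 + G 1 (\<iota> p)"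
proof -
  have "coproduct sH \<iota> (\<iota> p) = (frag_of (\<iota> p, 1) + frag_of (1, \<iota> p)) +o HH_null sH"
    using is_coproduct_coproduct by (simp add: is_coproduct_def HH_tensor_def coset_add[OF HH_sub])
  from sweedler_coset[OF G this] show ?thesis by (simp add: W.feval_simps)
qed

lemma bil_mult: assumes G: "bil s G"
  shows "bil s (\<lambda>f g. G (h * f) (h' * g))"
  using G by (simp add: bil_def lin_def algebra_simps scalar_out)

lemma bil_feval: assumes "\<And>k. bil s (\<lambda>f g. G f g k)"
  shows "bil s (\<lambda>f g. feval s (G f g) z)"
proof -
  have "G (f + f') g = (\<lambda>k. G f g k + G f' g k)" "G f (g + g') = (\<lambda>k. G f g k + G f g' k)"
    "G (sH c f) g = (\<lambda>k. s c (G f g k))" "G f (sH c g) = (\<lambda>k. s c (G f g k))" for f f' g g' c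
    using assms by (auto simp: bil_def lin_def)
  then show ?thesis by (simp add: bil_def lin_def W.feval_plus W.feval_scale)
qed

lemma sweedler_plus: "sweedler s (\<lambda>f g. F f g + G f g) h = sweedler s F h + sweedler s G h"
  unfolding sweedler_def by (subst W.feval_plus[symmetric]) (simp add: case_prod_beta')

lemma sweedler_linear: assumes T: "lin s t T" shows "T (sweedler s G h) = sweedler t (\<lambda>f g. T (G f g)) h"
  unfolding sweedler_def by (subst W.feval_linear[OF T]) (simp add: case_prod_beta')

lemma sweedler_sc: "sweedler s (\<lambda>f g. s c (G f g)) h = s c (sweedler s G h)"
  by (rule sweedler_linear[symmetric]) (simp add: lin_def W.scale_right_distrib W.scale_left_commute)

lemma sweedler_minus: "sweedler s (\<lambda>f g. - G f g) h = - sweedler s G h"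
  using sweedler_sc[of "-1" G h] by simp

lemma sweedler_diff: "sweedler s (\<lambda>f g. F f g - G f g) h = sweedler s F h - sweedler s G h"
  using sweedler_plus[of F "\<lambda>f g. - G f g" h] by (simp add: sweedler_minus)

lemma sweedler_zero: "sweedler s (\<lambda>f g. 0) h = 0"
  using sweedler_sc[of 0 "\<lambda>f g. 0" h] by simp

lemma sweedler_feval: "feval s (\<lambda>k. sweedler s (\<lambda>f g. G f g k) h) z = sweedler s (\<lambda>f g. feval s (G f g) z) h"
  using subset_UNIV by (induction z rule: frag_induction) (auto simp: W.feval_simps sweedler_zero sweedler_diff)

lemma sweedler_mult: assumes G: "bil s G"
  shows "sweedler s G (g * h) = sweedler s (\<lambda>f f'. sweedler s (\<lambda>k k'. G (f * k) (f' * k')) h) g"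
proof -
  let ?c = "\<lambda>h. coset_rep (coproduct sH \<iota> h)"
  have "coproduct sH \<iota> (g * h) = mult2 (?c g) (?c h) +o HH_null sH"
    using is_coproduct_coproduct by (simp add: is_coproduct_def HH_mult_def)
  from sweedler_coset[OF G this] show ?thesis
    by (simp add: sweedler_def W.feval_frag_extend W.feval_simps case_prod_beta')
qed

lemma bil_sweedler_mult: assumes G: "bil s G"
  shows "bil s (\<lambda>f f'. sweedler s (\<lambda>k k'. G (f * k) (f' * k')) h)"
    "bil s (\<lambda>k k'. sweedler s (\<lambda>f f'. G (f * k) (f' * k')) h)"
  unfolding sweedler_def
  by (rule bil_feval; use G in \<open>auto simp: bil_def lin_def algebra_simps scalar_out\<close>)+

lemma sweedler_left: assumes G: "bil s G"
  shows "sweedler s G (\<iota> p * h) = sweedler s (\<lambda>f g. G (\<iota> p * f) g) h + sweedler s (\<lambda>f g. G f (\<iota> p * g)) h"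
  by (simp add: sweedler_mult[OF G] sweedler_iota[OF bil_sweedler_mult(1)[OF G]])

lemma sweedler_right: assumes G: "bil s G"
  shows "sweedler s G (h * \<iota> p) = sweedler s (\<lambda>f g. G (f * \<iota> p) g) h + sweedler s (\<lambda>f g. G f (g * \<iota> p)) h"
  by (simp add: sweedler_mult[OF G] sweedler_iota[OF bil_mult[OF G]] sweedler_plus)

end

end

context enveloping_algebra
begin

subsection \<open>Linear functionals\<close>

abbreviation functional :: "('h \<Rightarrow> 'k) \<Rightarrow> bool" where
  "functional x \<equiv> lin sH (*) x"

lemma functional_right: "functional x \<Longrightarrow> functional (\<lambda>f. x (f * h))"
  and functional_plus: "functional x \<Longrightarrow> functional y \<Longrightarrow> functional (\<lambda>f. x f + y f)"
  and functional_antipode: "functional x \<Longrightarrow> functional (\<lambda>f. x (S f))"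
  by (simp_all add: lin_def algebra_simps scalar_out antipode_rules)

definition basisH :: "'h set" where "basisH = H.extend_basis {}"

lemma basisH: "H.independent basisH" "H.span basisH = UNIV"
  unfolding basisH_def using H.independent_extend_basis[of "{}"] H.span_extend_basis[of "{}"] H.independent_empty by auto

definition coord :: "'h \<Rightarrow> 'h \<Rightarrow> 'k" where "coord b h = H.representation basisH h b"

lemma functional_coord: "functional (coord b)"
  using basisH by (simp add: lin_def coord_def H.representation_add H.representation_scale)

lemma coord_basis: "b \<in> basisH \<Longrightarrow> c \<in> basisH \<Longrightarrow> coord b c = (if b = c then 1 else 0)"
  using basisH by (auto simp: coord_def H.representation_basis)

end

section \<open>Fourier coefficients of elements of \<open>(H \<otimes> H) \<otimes>\<^sub>H M\<close>\<close>

locale env_module = enveloping_algebra sD brD sH \<iota> + M: left_module act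
  for sD :: "'k::field \<Rightarrow> 'd::ab_group_add \<Rightarrow> 'd" and brD :: "'d \<Rightarrow> 'd \<Rightarrow> 'd"
    and sH :: "'k \<Rightarrow> 'h::ring_1 \<Rightarrow> 'h" and \<iota> :: "'d \<Rightarrow> 'h"
    and act :: "'h \<Rightarrow> 'm::ab_group_add \<Rightarrow> 'm"
begin

abbreviation "sM \<equiv> k_scale sH act"

lemma act_scalar: "act (sH c h) m = sM c (act h m)" "act h (sM c m) = sM c (act h m)"
proof -
  have "sH c h = sH c 1 * h" "sH c h = h * sH c 1" by (simp_all add: scalar_out)
  then show "act (sH c h) m = sM c (act h m)" "act h (sM c m) = sM c (act h m)"
    by (metis M.act_mult k_scale_def)+
qed

sublocale W: vector_space sM
  by unfold_locales
    (simp_all add: k_scale_def M.act_add_left M.act_add_right M.act_one H.scale_left_distrib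
      M.act_mult[symmetric] scalar_out mult.commute)

lemma act_diff: "act h (m - n) = act h m - act h n" and act_zero: "act h 0 = 0" "act 0 m = 0"
  and act_minus_left: "act (- h) m = - act h m"
proof -
  show "act h (m - n) = act h m - act h n" using M.act_add_right[of h "m - n" n] by (simp add: algebra_simps)
  show 0: "act h 0 = 0" using M.act_add_right[of h 0 0] by simp
  show 1: "act 0 m = 0" using M.act_add_left[of 0 0 m] by simp
  show "act (- h) m = - act h m" using M.act_add_left[of "h" "- h" m] 1 by (simp add: eq_neg_iff_add_eq_0 add.commute)
qed

abbreviation "N2 \<equiv> pt2_null sH \<iota> act"

lemma pt2_sub: "additive_subgroup N2"
  by (simp add: pt2_null_def additive_subgroup_closure)

lemmas pt2_rules = subgroup_zero[OF pt2_sub] subgroup_add[OF pt2_sub] subgroup_diff[OF pt2_sub]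
  subgroup_minus[OF pt2_sub] subgroup_sum[OF pt2_sub]

lemma pt2_relators:
  "frag_of (f + f', g, m) - frag_of (f, g, m) - frag_of (f', g, m) \<in> N2"
  "frag_of (f, g + g', m) - frag_of (f, g, m) - frag_of (f, g', m) \<in> N2"
  "frag_of (f, g, m + m') - frag_of (f, g, m) - frag_of (f, g, m') \<in> N2"
  "frag_of (sH c f, g, m) - frag_of (f, sH c g, m) \<in> N2"
  "frag_extend (\<lambda>(h\<^sub>1, h\<^sub>2). frag_of (f * h\<^sub>1, g * h\<^sub>2, m)) (coset_rep (coproduct sH \<iota> h))
         - frag_of (f, g, act h m) \<in> N2"
  unfolding pt2_null_def by (rule closure_base, blast)+

lemma pt2_relator_coset:
  assumes "coproduct sH \<iota> h = z +o HH_null sH"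
  shows "frag_extend (\<lambda>(h\<^sub>1, h\<^sub>2). frag_of (f * h\<^sub>1, g * h\<^sub>2, m)) z - frag_of (f, g, act h m) \<in> N2"
proof -
  let ?F = "frag_extend (\<lambda>(h\<^sub>1, h\<^sub>2). frag_of (f * h\<^sub>1, g * h\<^sub>2, m))"
  have "z - coset_rep (coproduct sH \<iota> h) \<in> HH_null sH"
    unfolding assms by (rule cong_sym[OF HH_sub coset_rep_cong[OF HH_sub]])
  then have "?F (z - coset_rep (coproduct sH \<iota> h)) \<in> N2"
    by (rule HH_null_map[where F = ?F, OF pt2_sub, rotated -1])
      (simp_all add: frag_extend_diff distrib_left pt2_relators scalar_out)
  then show ?thesis using cong_trans[OF pt2_sub _ pt2_relators(5)] by (simp add: frag_extend_diff)
qed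

lemma pt2_balance_iota: "frag_of (f * \<iota> p, g, m) + frag_of (f, g * \<iota> p, m) - frag_of (f, g, act (\<iota> p) m) \<in> N2"
proof -
  have "coproduct sH \<iota> (\<iota> p) = (frag_of (\<iota> p, 1) + frag_of (1, \<iota> p)) +o HH_null sH"
    using is_coproduct_coproduct by (simp add: is_coproduct_def HH_tensor_def coset_add[OF HH_sub])
  from pt2_relator_coset[OF this] show ?thesis by (simp add: frag_extend_add)
qed

lemma pt2_balance_scale: "frag_of (sH c f, g, m) - frag_of (f, g, sM c m) \<in> N2"
proof -
  have 1: "coproduct sH \<iota> 1 = frag_of (1, 1) +o HH_null sH"
    using is_coproduct_coproduct by (simp add: is_coproduct_def HH_tensor_def)
  have "HH_scale sH c (frag_of (1, 1) +o HH_null sH) = sc2 c (frag_of (1, 1)) +o HH_null sH"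
    unfolding HH_scale_def induced_def coset_eq_iff[OF HH_sub] frag_extend_diff[symmetric]
    by (rule sc2_null, rule coset_rep_cong[OF HH_sub])
  then have "coproduct sH \<iota> (sH c 1) = frag_of (sH c 1, 1) +o HH_null sH"
    using is_coproduct_coproduct 1 by (simp add: is_coproduct_def)
  from pt2_relator_coset[OF this, of f g m] show ?thesis by (simp add: k_scale_def scalar_out)
qed

lemma pt2_zero: "frag_of (f, g, 0) \<in> N2" "frag_of (0, g, m) \<in> N2" "frag_of (f, 0, m) \<in> N2"
  using pt2_rules(4)[OF pt2_relators(3)[of f g 0 0]] pt2_rules(4)[OF pt2_relators(1)[of 0 0 g m]]
    pt2_rules(4)[OF pt2_relators(2)[of f 0 0 m]] by simp_all

subsection \<open>Balanced maps\<close>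

text \<open>The balancing over \<open>H\<close> only has to be checked on the generators \<open>\<dd>\<close> of \<open>H\<close>.\<close>

definition balanced :: "('k \<Rightarrow> 'w::ab_group_add \<Rightarrow> 'w) \<Rightarrow> ('h \<Rightarrow> 'h \<Rightarrow> 'm \<Rightarrow> 'w) \<Rightarrow> bool" where
  "balanced s R \<longleftrightarrow> (\<forall>m. bil s (\<lambda>f g. R f g m)) \<and> (\<forall>f g. lin sM s (R f g)) \<and>
     (\<forall>f g p m. R (f * \<iota> p) g m + R f (g * \<iota> p) m = R f g (act (\<iota> p) m))"

context
  fixes s :: "'k \<Rightarrow> 'w::ab_group_add \<Rightarrow> 'w" and R
  assumes s: "vector_space s" and R: "balanced s R"
begin

interpretation T: vector_space s by (rule s)

lemma balanced_bil: "bil s (\<lambda>f g. R (f' * f) (g' * g) m)"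
  using R by (auto simp: balanced_def intro!: bil_mult[OF s, of "\<lambda>f g. R f g m"])

text \<open>In the induction step \<open>\<Delta>(p h) = (p \<otimes> 1 + 1 \<otimes> p) \<Delta>(h)\<close> moves \<open>p\<close> into the first two arguments, which
  is why \<open>f\<close> and \<open>g\<close> have to be arbitrary.\<close>

lemma balanced_coproduct: "sweedler s (\<lambda>h\<^sub>1 h\<^sub>2. R (f * h\<^sub>1) (g * h\<^sub>2) m) h = R f g (act h m)"
proof (induction h arbitrary: f g rule: H_induct_left)
  case one
  show ?case by (simp add: sweedler_one[OF s balanced_bil] M.act_one)
next
  case (scale c h)
  then show ?case using R by (simp add: sweedler_scale[OF s balanced_bil] act_scalar balanced_def lin_def)
next
  case (add h k)
  then show ?case using R by (simp add: sweedler_add[OF s balanced_bil] M.act_add_left balanced_def lin_def)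
next
  case (mult p h)
  have "sweedler s (\<lambda>h\<^sub>1 h\<^sub>2. R (f * h\<^sub>1) (g * h\<^sub>2) m) (\<iota> p * h) = R (f * \<iota> p) g (act h m) + R f (g * \<iota> p) (act h m)"
    using mult[of "f * \<iota> p" g] mult[of f "g * \<iota> p"] by (simp add: sweedler_left[OF s balanced_bil] mult.assoc)
  then show ?case using R by (simp add: balanced_def M.act_mult)
qed

lemma balanced_null: assumes z: "z \<in> N2" shows "feval s (\<lambda>(f, g, m). R f g m) z = 0"
proof -
  have coproduct: "feval s (\<lambda>(f, g, m). R f g m)
        (frag_extend (\<lambda>(h\<^sub>1, h\<^sub>2). frag_of (f * h\<^sub>1, g * h\<^sub>2, m)) (coset_rep (coproduct sH \<iota> h))) = R f g (act h m)"
    for f g h m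
    using balanced_coproduct[of f g m h] by (simp add: sweedler_def T.feval_frag_extend case_prod_beta' T.feval_simps)
  show ?thesis using z unfolding pt2_null_def
    by (rule T.feval_null[rotated]) (use R in \<open>auto simp: T.feval_simps balanced_def bil_def lin_def coproduct\<close>)
qed

lemma balanced_cong:
  "y - z \<in> N2 \<Longrightarrow> feval s (\<lambda>(f, g, m). R f g m) y = feval s (\<lambda>(f, g, m). R f g m) z"
  using balanced_null[of "y - z"] by (simp add: T.feval_simps)

end

subsection \<open>The coefficient maps\<close>

text \<open>\<open>(f \<otimes> g) \<otimes>\<^sub>H m\<close> equals \<open>(f S(g\<^sub>1) \<otimes> 1) \<otimes>\<^sub>H g\<^sub>2 m\<close>; to this a functional is applied.\<close>

definition K :: "('h \<Rightarrow> 'k) \<Rightarrow> 'h \<Rightarrow> 'h \<Rightarrow> 'm \<Rightarrow> 'm" where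
  "K x f g m = sweedler sM (\<lambda>g\<^sub>1 g\<^sub>2. sM (x (f * S g\<^sub>1)) (act g\<^sub>2 m)) g"

definition coef :: "('h \<Rightarrow> 'k) \<Rightarrow> ('h \<times> 'h \<times> 'm) fsum set \<Rightarrow> 'm" where
  "coef x A = feval sM (\<lambda>(f, g, m). K x f g m) (coset_rep A)"

lemmas bilinear_simps = bil_def lin_def distrib_left distrib_right scalar_out antipode_rules
  W.scale_right_distrib W.scale_left_distrib act_scalar M.act_add_left M.act_add_right
  W.scale_left_commute

lemma bil_K: assumes x: "functional x" shows "bil sM (\<lambda>g\<^sub>1 g\<^sub>2. sM (x (f * S g\<^sub>1)) (act g\<^sub>2 m))"
  using linD(1,2)[OF x] by (simp add: bilinear_simps)

lemmas sweedler_W = sweedler_add[OF W.vector_space_axioms] sweedler_scale[OF W.vector_space_axioms] sweedler_one[OF W.vector_space_axioms]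
  sweedler_left[OF W.vector_space_axioms] sweedler_right[OF W.vector_space_axioms]

lemmas sweedler_W_lin = sweedler_plus[OF W.vector_space_axioms] sweedler_sc[OF W.vector_space_axioms] sweedler_minus[OF W.vector_space_axioms]
  sweedler_diff[OF W.vector_space_axioms] sweedler_zero[OF W.vector_space_axioms]

lemma K_rules:
  assumes x: "functional x"
  shows K_one: "K x f 1 m = sM (x f) m"
    and K_right: "K x f (g * \<iota> p) m = K x f g (act (\<iota> p) m) - K x (f * \<iota> p) g m"
    and K_add: "K x (f + f') g m = K x f g m + K x f' g m" "K x f (g + g') m = K x f g m + K x f g' m"
      "K x f g (m + m') = K x f g m + K x f g m'"
    and K_scale: "K x (sH c f) g m = sM c (K x f g m)" "K x f (sH c g) m = sM c (K x f g m)"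
      "K x f g (sM c m) = sM c (K x f g m)"
proof -
  note xs = linD[OF x] and b = bil_K[OF x]
  show "K x f 1 m = sM (x f) m" by (simp add: K_def sweedler_W(3)[OF b] antipode_rules M.act_one)
  show "K x f (g * \<iota> p) m = K x f g (act (\<iota> p) m) - K x (f * \<iota> p) g m"
    by (simp add: K_def sweedler_W(5)[OF b] antipode_rules M.act_mult sweedler_W_lin xs mult.assoc)
  show "K x (f + f') g m = K x f g m + K x f' g m"
    by (simp add: K_def distrib_right xs W.scale_left_distrib sweedler_W_lin)
  show "K x f (g + g') m = K x f g m + K x f g' m" by (simp add: K_def sweedler_W(1)[OF b])
  show "K x f g (m + m') = K x f g m + K x f g m'"
    by (simp add: K_def M.act_add_right W.scale_right_distrib sweedler_W_lin)
  show "K x (sH c f) g m = sM c (K x f g m)"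
    by (simp add: K_def scalar_out xs W.scale_scale[symmetric] sweedler_W_lin del: W.scale_scale)
  show "K x f (sH c g) m = sM c (K x f g m)" by (simp add: K_def sweedler_W(2)[OF b])
  have "sM (x (f * S g\<^sub>1)) (act g\<^sub>2 (sM c m)) = sM c (sM (x (f * S g\<^sub>1)) (act g\<^sub>2 m))" for g\<^sub>1 g\<^sub>2
    by (simp add: act_scalar mult.commute)
  then show "K x f g (sM c m) = sM c (K x f g m)" by (simp only: K_def sweedler_W_lin)
qed

lemma K_left: "K x (h * f) g m = K (\<lambda>f. x (h * f)) f g m"
  by (simp add: K_def mult.assoc)

lemma K_functional:
  "K (\<lambda>f. x f + y f) f g m = K x f g m + K y f g m" "K (\<lambda>f. c * x f) f g m = sM c (K x f g m)"
  by (simp_all add: K_def W.scale_left_distrib sweedler_W_lin W.scale_scale[symmetric] del: W.scale_scale)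

lemma K_balanced: "functional x \<Longrightarrow> balanced sM (K x)"
  by (simp add: balanced_def bil_def lin_def K_rules)

lemmas coef_cong = balanced_cong[OF W.vector_space_axioms K_balanced]

lemma coef_coset: "functional x \<Longrightarrow> coef x (z +o N2) = feval sM (\<lambda>(f, g, m). K x f g m) z"
  unfolding coef_def by (rule coef_cong[OF _ coset_rep_cong[OF pt2_sub]])

lemma coef_add:
  assumes "functional x" "A \<in> cosets N2" "B \<in> cosets N2"
  shows "coef x (A + B) = coef x A + coef x B"
  using assms by (auto simp: cosets_def coset_add[OF pt2_sub] coef_coset W.feval_simps)

lemma coef_functional:
  "coef (\<lambda>f. x f + y f) A = coef x A + coef y A" "coef (\<lambda>f. c * x f) A = sM c (coef x A)"
  by (simp_all add: coef_def K_functional case_prod_beta' W.feval_plus W.feval_scale)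

text \<open>For a module the second rule says how a mode of \<open>a\<close> commutes with \<open>p\<close> in \<open>\<dd>\<close>: the commutator is
  again a mode of the same \<open>a\<close>, for a shifted functional.\<close>

lemma coef_lmult:
  assumes x: "functional x" and A: "A \<in> cosets N2"
  shows "coef x (pt2_lmult sH \<iota> act h 1 A) = coef (\<lambda>f. x (h * f)) A"
    and "coef x (pt2_lmult sH \<iota> act 1 (\<iota> p) A) = act (\<iota> p) (coef x A) - coef (\<lambda>f. x (f * \<iota> p)) A"
proof -
  show "coef x (pt2_lmult sH \<iota> act h 1 A) = coef (\<lambda>f. x (h * f)) A"
    unfolding pt2_lmult_def induced_def coef_coset[OF x]
    by (simp add: coef_def W.feval_frag_extend W.feval_simps case_prod_beta' K_left)
  have *: "K x f (\<iota> p * g) m = act (\<iota> p) (K x f g m) - K (\<lambda>f. x (f * \<iota> p)) f g m" for f g m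
  proof (induction g arbitrary: f m rule: H_induct_right)
    case one
    show ?case using K_right[OF x, of f 1] by (simp add: K_one x functional_right act_scalar)
  next
    case (mult q g)
    show ?case by (simp add: mult.assoc[symmetric] K_right[OF x] K_right[OF functional_right[OF x]] mult.IH act_diff)
  qed (simp_all add: K_rules x functional_right act_scalar M.act_add_right W.scale_right_diff_distrib
      scalar_out distrib_left)
  show "coef x (pt2_lmult sH \<iota> act 1 (\<iota> p) A) = act (\<iota> p) (coef x A) - coef (\<lambda>f. x (f * \<iota> p)) A"
  proof -
    have "lin sM sM (act (\<iota> p))" by (simp add: lin_def M.act_add_right act_scalar)
    note act_feval = W.feval_linear[OF this]
    show ?thesis
      unfolding pt2_lmult_def induced_def coef_coset[OF x]
      by (simp add: coef_def W.feval_frag_extend W.feval_simps case_prod_beta' W.feval_subtract act_feval * )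
  qed
qed

subsection \<open>Normal forms\<close>

abbreviation "nf \<equiv> frag_extend (\<lambda>(h, u). frag_of (h, 1, u))"

text \<open>Induction on the second tensor factor, by \<open>(f \<otimes> g p) \<otimes>\<^sub>H m = (f \<otimes> g) \<otimes>\<^sub>H p m - (f p \<otimes> g) \<otimes>\<^sub>H m\<close>.\<close>

lemma normal_form_exists: "\<exists>y. z - nf y \<in> N2"
  using subset_UNIV
proof (induction z rule: frag_induction)
  case zero show ?case using pt2_rules(1) by (intro exI[of _ 0]) simp
next
  case (diff a b)
  then obtain y z where "a - nf y \<in> N2" "b - nf z \<in> N2" by blast
  from pt2_rules(3)[OF this] show ?case by (intro exI[of _ "y - z"]) (simp add: frag_extend_diff algebra_simps)
next
  case (one t)
  obtain f g m where t: "t = (f, g, m)" by (cases t)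
  have "\<exists>y. frag_of (f, g, m) - nf y \<in> N2"
  proof (induction g arbitrary: f m rule: H_induct_right)
    case one show ?case using pt2_rules(1) by (intro exI[of _ "frag_of (f, m)"]) simp
  next
    case (scale c g)
    then obtain y where "frag_of (sH c f, g, m) - nf y \<in> N2" by blast
    from cong_trans[OF pt2_sub cong_sym[OF pt2_sub pt2_relators(4)] this] show ?case by blast
  next
    case (add g g')
    then obtain y z where y: "frag_of (f, g, m) - nf y \<in> N2" "frag_of (f, g', m) - nf z \<in> N2" by blast
    from pt2_rules(2)[OF pt2_relators(2)[of f g g' m] pt2_rules(2)[OF this]] show ?case
      by (intro exI[of _ "y + z"]) (simp add: frag_extend_add algebra_simps)
  next
    case (mult p g)
    obtain y z where "frag_of (f, g, act (\<iota> p) m) - nf y \<in> N2" "frag_of (f * \<iota> p, g, m) - nf z \<in> N2"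
      using mult by blast
    from pt2_rules(2)[OF pt2_balance_iota[of f p g m] pt2_rules(3)[OF this]] show ?case
      by (intro exI[of _ "y - z"]) (simp add: frag_extend_diff algebra_simps)
  qed
  then show ?case by (simp add: t)
qed

lemma pt2_sum: "frag_of (sum h A, 1, u) - (\<Sum>i\<in>A. frag_of (h i, 1, u)) \<in> N2"
proof (induction A rule: infinite_finite_induct)
  case (insert i A)
  from pt2_rules(2)[OF pt2_relators(1)[of "h i" "sum h A" 1 u] insert(3)] show ?case using insert(1,2)
    by (simp add: algebra_simps)
qed (simp_all add: pt2_zero)

lemma basis_form_exists: "\<exists>T u. finite T \<and> T \<subseteq> basisH \<and> z - (\<Sum>b\<in>T. frag_of (b, 1, u b)) \<in> N2"
proof -
  obtain y where y: "z - nf y \<in> N2" using normal_form_exists by blast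
  have "\<exists>T u. finite T \<and> T \<subseteq> basisH \<and> nf y - (\<Sum>b\<in>T. frag_of (b, 1, u b)) \<in> N2"
    using subset_UNIV
  proof (induction y rule: frag_induction)
    case zero show ?case by (intro exI[of _ "{}"]) (simp add: pt2_rules)
  next
    case (one t)
    obtain h u where t: "t = (h, u)" by (cases t)
    let ?T = "{b. coord b h \<noteq> 0}"
    have T: "finite ?T" "?T \<subseteq> basisH"
      unfolding coord_def by (auto intro: H.finite_representation H.representation_ne_zero)
    have "(\<Sum>b\<in>?T. sH (coord b h) b) = h"
      unfolding coord_def by (rule H.sum_nonzero_representation_eq[OF basisH(1)]) (simp add: basisH(2))
    then have "frag_of (h, 1, u) - (\<Sum>b\<in>?T. frag_of (sH (coord b h) b, 1, u)) \<in> N2"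
      by (rule subst[where P = "\<lambda>h'. frag_of (h', 1, u) - _ \<in> N2"]) (rule pt2_sum)
    moreover have "(\<Sum>b\<in>?T. frag_of (sH (coord b h) b, 1, u)) - (\<Sum>b\<in>?T. frag_of (b, 1, sM (coord b h) u)) \<in> N2"
      unfolding sum_subtractf[symmetric] by (intro pt2_rules(5) pt2_balance_scale)
    ultimately have "nf (frag_of t) - (\<Sum>b\<in>?T. frag_of (b, 1, sM (coord b h) u)) \<in> N2"
      unfolding t frag_extend_of prod.case by (rule cong_trans[OF pt2_sub])
    with T show ?case
      by (intro exI[of _ ?T] exI[of _ "\<lambda>b. sM (coord b h) u"] conjI)
  next
    case (diff a b)
    then obtain T u T' u' where T: "finite T" "T \<subseteq> basisH" "nf a - (\<Sum>b\<in>T. frag_of (b, 1, u b)) \<in> N2"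
      and T': "finite T'" "T' \<subseteq> basisH" "nf b - (\<Sum>b\<in>T'. frag_of (b, 1, u' b)) \<in> N2" by blast
    define v where "v b = (if b \<in> T then u b else 0)" for b
    define v' where "v' b = (if b \<in> T' then u' b else 0)" for b
    have ext: "(\<Sum>b\<in>T \<union> T'. frag_of (b, 1, (if b \<in> U then w b else 0))) - (\<Sum>b\<in>U. frag_of (b, 1, w b)) \<in> N2"
      if "U = T \<or> U = T'" for U w
    proof -
      let ?g = "\<lambda>b. frag_of (b, 1::'h, (if b \<in> U then w b else 0))"
      have "sum ?g (T \<union> T') = sum ?g U + sum ?g ((T \<union> T') - U)"
        using that T(1) T'(1) sum.subset_diff[of U "T \<union> T'" ?g] by (auto simp: add.commute)
      moreover have "sum ?g ((T \<union> T') - U) \<in> N2" by (rule pt2_rules(5)) (simp add: pt2_zero)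
      moreover have "sum ?g U = (\<Sum>b\<in>U. frag_of (b, 1, w b))" by simp
      ultimately show ?thesis by (simp only: add_diff_cancel_left')
    qed
    have "((\<Sum>b\<in>T \<union> T'. frag_of (b, 1, v b)) - (\<Sum>b\<in>T \<union> T'. frag_of (b, 1, v' b))) - (\<Sum>b\<in>T \<union> T'. frag_of (b, 1, v b - v' b)) \<in> N2"
      unfolding sum_subtractf[symmetric]
    proof (rule pt2_rules(5))
      show "frag_of (b, 1, v b) - frag_of (b, 1, v' b) - frag_of (b, 1, v b - v' b) \<in> N2" for b
        using pt2_relators(3)[of b 1 "v b - v' b" "v' b"] by (simp add: algebra_simps)
    qed
    moreover have "(nf a - nf b) - ((\<Sum>b\<in>T \<union> T'. frag_of (b, 1, v b)) - (\<Sum>b\<in>T \<union> T'. frag_of (b, 1, v' b))) \<in> N2"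
      unfolding v_def v'_def
      by (intro cong_diff[OF pt2_sub] cong_trans[OF pt2_sub T(3) cong_sym[OF pt2_sub ext]]
          cong_trans[OF pt2_sub T'(3) cong_sym[OF pt2_sub ext]]) auto
    ultimately have "nf (a - b) - (\<Sum>b\<in>T \<union> T'. frag_of (b, 1, v b - v' b)) \<in> N2"
      unfolding frag_extend_diff using cong_trans[OF pt2_sub] by blast
    moreover have "finite (T \<union> T')" "T \<union> T' \<subseteq> basisH" using T T' by auto
    ultimately show ?case
      by (intro exI[of _ "T \<union> T'"] exI[of _ "\<lambda>b. v b - v' b"] conjI)
  qed
  then show ?thesis using cong_trans[OF pt2_sub y] by blast
qed

text \<open>Collecting the first tensor factors with respect to a basis of \<open>H\<close> shows that
  \<open>(H \<otimes> H) \<otimes>\<^sub>H M\<close> is \<open>H \<otimes> M\<close>; the entries at the basis elements are the coefficients with respect to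
  the coordinate functionals.\<close>

lemma basis_form:
  obtains T where "finite T" "T \<subseteq> basisH"
    "z - (\<Sum>b\<in>T. frag_of (b, 1, feval sM (\<lambda>(f, g, m). K (coord b) f g m) z)) \<in> N2"
proof -
  obtain T u where T: "finite T" "T \<subseteq> basisH" and z: "z - (\<Sum>b\<in>T. frag_of (b, 1, u b)) \<in> N2"
    using basis_form_exists by blast
  have "feval sM (\<lambda>(f, g, m). K (coord c) f g m) z = u c" if c: "c \<in> T" for c
  proof -
    have "feval sM (\<lambda>(f, g, m). K (coord c) f g m) z = (\<Sum>b\<in>T. sM (coord c b) (u b))"
      by (simp add: coef_cong[OF functional_coord z] W.feval_sum W.feval_simps K_one functional_coord)
    also have "\<dots> = (\<Sum>b\<in>T. if b = c then u b else 0)"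
      using T(2) c by (intro sum.cong) (auto simp: coord_basis subsetD)
    finally show ?thesis using T(1) c by simp
  qed
  then have "(\<Sum>b\<in>T. frag_of (b, 1::'h, feval sM (\<lambda>(f, g, m). K (coord b) f g m) z)) = (\<Sum>b\<in>T. frag_of (b, 1, u b))"
    by (intro sum.cong) auto
  with z have "z - (\<Sum>b\<in>T. frag_of (b, 1, feval sM (\<lambda>(f, g, m). K (coord b) f g m) z)) \<in> N2"
    by (simp only:)
  with T show ?thesis by (rule that)
qed

lemma coef_determines:
  assumes A: "A \<in> cosets N2" and B: "B \<in> cosets N2"
    and eq: "\<And>x. functional x \<Longrightarrow> coef x A = coef x B"
  shows "A = B"
proof -
  obtain a b where ab: "A = a +o N2" "B = b +o N2" using A B by (auto simp: cosets_def)
  obtain T where T: "a - b - (\<Sum>c\<in>T. frag_of (c, 1, feval sM (\<lambda>(f, g, m). K (coord c) f g m) (a - b))) \<in> N2"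
    using basis_form by blast
  have "feval sM (\<lambda>(f, g, m). K (coord c) f g m) (a - b) = 0" for c
    using eq[OF functional_coord] by (simp add: ab coef_coset[OF functional_coord] W.feval_simps)
  then have "(\<Sum>c\<in>T. frag_of (c, 1, feval sM (\<lambda>(f, g, m). K (coord c) f g m) (a - b))) \<in> N2"
    by (intro pt2_rules(5)) (simp add: pt2_zero)
  from pt2_rules(2)[OF T this] show ?thesis by (simp add: ab coset_eq_iff[OF pt2_sub])
qed

end

section \<open>Fourier coefficients of a composition of pseudoproducts\<close>

context env_module
begin

abbreviation "N3 \<equiv> pt3_null sH \<iota> act"

lemma pt3_sub: "additive_subgroup N3"
  by (simp add: pt3_null_def additive_subgroup_closure)

text \<open>\<open>(f \<otimes> g \<otimes> k) \<otimes>\<^sub>H m\<close> equals \<open>(f S(k\<^sub>1) \<otimes> g S(k\<^sub>2) \<otimes> 1) \<otimes>\<^sub>H k\<^sub>3 m\<close>; to this \<open>x \<otimes> y\<close> is applied. The inner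
  splitting of \<open>k\<close> is hidden in \<open>K\<close>.\<close>

definition K3 :: "('h \<Rightarrow> 'k) \<Rightarrow> ('h \<Rightarrow> 'k) \<Rightarrow> 'h \<Rightarrow> 'h \<Rightarrow> 'h \<Rightarrow> 'm \<Rightarrow> 'm" where
  "K3 x y f g k m = sweedler sM (\<lambda>k\<^sub>1 k\<^sub>2. sM (x (f * S k\<^sub>1)) (K y g k\<^sub>2 m)) k"

definition coef3 :: "('h \<Rightarrow> 'k) \<Rightarrow> ('h \<Rightarrow> 'k) \<Rightarrow> ('h \<times> 'h \<times> 'h \<times> 'm) fsum set \<Rightarrow> 'm" where
  "coef3 x y A = feval sM (\<lambda>(f, g, k, m). K3 x y f g k m) (coset_rep A)"

context
  fixes x y :: "'h \<Rightarrow> 'k"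
  assumes x: "functional x" and y: "functional y"
begin

lemma bil_K3: "bil sM (\<lambda>k\<^sub>1 k\<^sub>2. sM (x (f * S k\<^sub>1)) (K y g k\<^sub>2 m))"
  using linD(1,2)[OF x] by (simp add: bilinear_simps K_rules[OF y])

lemma K3_rules:
  shows K3_one: "K3 x y f g 1 m = sM (x f) (sM (y g) m)"
    and K3_right: "K3 x y f g (k * \<iota> p) m =
        K3 x y f g k (act (\<iota> p) m) - K3 x y (f * \<iota> p) g k m - K3 x y f (g * \<iota> p) k m"
    and K3_add: "K3 x y (f + f') g k m = K3 x y f g k m + K3 x y f' g k m"
      "K3 x y f (g + g') k m = K3 x y f g k m + K3 x y f g' k m"
      "K3 x y f g (k + k') m = K3 x y f g k m + K3 x y f g k' m"
      "K3 x y f g k (m + m') = K3 x y f g k m + K3 x y f g k m'"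
    and K3_scale: "K3 x y (sH c f) g k m = sM c (K3 x y f g k m)" "K3 x y f (sH c g) k m = sM c (K3 x y f g k m)"
      "K3 x y f g (sH c k) m = sM c (K3 x y f g k m)" "K3 x y f g k (sM c m) = sM c (K3 x y f g k m)"
proof -
  note xs = linD[OF x] and b = bil_K3 and ys = K_rules[OF y]
  show "K3 x y f g 1 m = sM (x f) (sM (y g) m)" by (simp add: K3_def sweedler_W(3)[OF b] antipode_rules ys)
  show "K3 x y f g (k * \<iota> p) m =
        K3 x y f g k (act (\<iota> p) m) - K3 x y (f * \<iota> p) g k m - K3 x y f (g * \<iota> p) k m"
    by (simp add: K3_def sweedler_W(5)[OF b] antipode_rules ys sweedler_W_lin xs mult.assoc W.scale_right_diff_distrib)
  show "K3 x y (f + f') g k m = K3 x y f g k m + K3 x y f' g k m"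
    by (simp add: K3_def distrib_right xs W.scale_left_distrib sweedler_W_lin)
  show "K3 x y f (g + g') k m = K3 x y f g k m + K3 x y f g' k m"
    by (simp add: K3_def ys W.scale_right_distrib sweedler_W_lin)
  show "K3 x y f g (k + k') m = K3 x y f g k m + K3 x y f g k' m" by (simp add: K3_def sweedler_W(1)[OF b])
  show "K3 x y f g k (m + m') = K3 x y f g k m + K3 x y f g k m'"
    by (simp add: K3_def ys W.scale_right_distrib sweedler_W_lin)
  show "K3 x y (sH c f) g k m = sM c (K3 x y f g k m)"
    by (simp add: K3_def scalar_out xs W.scale_scale[symmetric] sweedler_W_lin del: W.scale_scale)
  show "K3 x y f g (sH c k) m = sM c (K3 x y f g k m)" by (simp add: K3_def sweedler_W(2)[OF b])
  have "sM (x (f * S k\<^sub>1)) (sM c u) = sM c (sM (x (f * S k\<^sub>1)) u)" for k\<^sub>1 u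
    by (simp add: mult.commute)
  then show "K3 x y f (sH c g) k m = sM c (K3 x y f g k m)" "K3 x y f g k (sM c m) = sM c (K3 x y f g k m)"
    by (simp_all only: K3_def ys sweedler_W_lin)
qed

end

text \<open>A form of cocommutativity: both sides satisfy the same recursion in \<open>k\<close>.\<close>

lemma K3_flip:
  assumes x: "functional x" and y: "functional y"
  shows "K3 x y f g k m = K3 y x g f k m"
  by (induction k arbitrary: f g m rule: H_induct_right)
    (simp_all add: K3_rules[OF x y] K3_rules[OF y x] mult.commute)

context
  fixes x y :: "'h \<Rightarrow> 'k"
  assumes x: "functional x" and y: "functional y"
begin

lemma bil_K3_12: "bil sM (\<lambda>h\<^sub>1 h\<^sub>2. K3 x y (f * h\<^sub>1) (g * h\<^sub>2) k m)"
  and bil_K3_23: "bil sM (\<lambda>h\<^sub>1 h\<^sub>2. K3 x y f (g * h\<^sub>1) (k * h\<^sub>2) m)"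
  by (simp_all add: bilinear_simps K3_rules[OF x y])

lemma bil_K3_iterated: "bil sM (\<lambda>p k\<^sub>3. sweedler sM (\<lambda>h\<^sub>1 h\<^sub>2. K3 x y (f * h\<^sub>1) (g * h\<^sub>2) (k * k\<^sub>3) m) p)"
  unfolding bil_def lin_def
  by (simp add: sweedler_W[OF bil_K3_12] distrib_left scalar_out K3_rules[OF x y] sweedler_W_lin)

lemma K3_coproduct:
  "sweedler sM (\<lambda>p k\<^sub>3. sweedler sM (\<lambda>h\<^sub>1 h\<^sub>2. K3 x y (f * h\<^sub>1) (g * h\<^sub>2) (k * k\<^sub>3) m) p) h = K3 x y f g k (act h m)"
proof (induction h arbitrary: f g k rule: H_induct_left)
  case one
  show ?case by (simp add: sweedler_W(3)[OF bil_K3_iterated] sweedler_W(3)[OF bil_K3_12] M.act_one)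
next
  case (mult p h)
  have "sweedler sM (\<lambda>p k\<^sub>3. sweedler sM (\<lambda>h\<^sub>1 h\<^sub>2. K3 x y (f * h\<^sub>1) (g * h\<^sub>2) (k * k\<^sub>3) m) p) (\<iota> p * h) =
     K3 x y (f * \<iota> p) g k (act h m) + K3 x y f (g * \<iota> p) k (act h m) + K3 x y f g (k * \<iota> p) (act h m)"
    unfolding mult[symmetric]
    by (simp add: sweedler_W(4)[OF bil_K3_iterated] sweedler_W(4)[OF bil_K3_12] sweedler_W_lin mult.assoc)
  then show ?case by (simp add: K3_rules[OF x y] M.act_mult)
qed (simp_all add: sweedler_W[OF bil_K3_iterated] act_scalar K3_rules[OF x y] M.act_add_left)

lemma K3_null: assumes z: "z \<in> N3" shows "feval sM (\<lambda>(f, g, k, m). K3 x y f g k m) z = 0"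
proof -
  have coproduct: "feval sM (\<lambda>(f, g, k, m). K3 x y f g k m)
        (frag_extend (\<lambda>(p, h\<^sub>3).
           frag_extend (\<lambda>(h\<^sub>1, h\<^sub>2). frag_of (f * h\<^sub>1, g * h\<^sub>2, k * h\<^sub>3, m))
             (coset_rep (coproduct sH \<iota> p)))
         (coset_rep (coproduct sH \<iota> h))) = K3 x y f g k (act h m)" for f g k h m
    using K3_coproduct[of f g k m h] by (simp add: sweedler_def W.feval_frag_extend case_prod_beta' W.feval_simps)
  show ?thesis using z unfolding pt3_null_def
    by (rule W.feval_null[rotated], elim UnE CollectE exE conjE)
      (simp_all add: W.feval_simps K3_rules[OF x y] coproduct)
qed

lemma coef3_coset: "coef3 x y (z +o N3) = feval sM (\<lambda>(f, g, k, m). K3 x y f g k m) z"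
  using K3_null[OF coset_rep_cong[OF pt3_sub, of z]] by (simp add: coef3_def W.feval_simps)

lemma coef3_add: "A \<in> cosets N3 \<Longrightarrow> B \<in> cosets N3 \<Longrightarrow> coef3 x y (A + B) = coef3 x y A + coef3 x y B"
  by (auto simp: cosets_def coset_add[OF pt3_sub] coef3_coset W.feval_simps)

lemma coef3_flip: "coef3 x y (pt3_flip sH \<iota> act A) = coef3 y x A"
  unfolding pt3_flip_def induced_def coef3_coset
  by (simp add: coef3_def W.feval_frag_extend W.feval_simps case_prod_beta' K3_flip[OF x y])

subsection \<open>The two composites\<close>

text \<open>The two sides are the contributions of \<open>(h \<otimes> l) \<otimes>\<^sub>H e\<close> in \<open>a * d\<close> to the coefficients of \<open>a * A\<close> and of
  \<open>a * (coef y A)\<close>, when \<open>A\<close> is \<open>(h\<^sub>1 \<otimes> h\<^sub>2) \<otimes>\<^sub>H d\<close>.\<close>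

lemma K3_outer_left:
  "sweedler sM (\<lambda>l\<^sub>1 l\<^sub>2. K3 x y h (h\<^sub>1 * l\<^sub>1) (h\<^sub>2 * l\<^sub>2) e) l = sweedler sM (\<lambda>p q. sM (y (h\<^sub>1 * S p)) (K x h (q * l) e)) h\<^sub>2"
proof -
  have b1: "bil sM (\<lambda>l\<^sub>1 l\<^sub>2. K3 x y h (h\<^sub>1 * l\<^sub>1) l\<^sub>2 e)" for h h\<^sub>1 e
    using bil_K3_23[of h h\<^sub>1 1 e] by simp
  have one_left: "sweedler sM (\<lambda>l\<^sub>1 l\<^sub>2. K3 x y h (h\<^sub>1 * l\<^sub>1) l\<^sub>2 e) l = sM (y h\<^sub>1) (K x h l e)" for h h\<^sub>1 l e
  proof (induction l arbitrary: h e rule: H_induct_right)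
    case one show ?case by (simp add: sweedler_W(3)[OF b1] K3_rules[OF x y] K_rules[OF x] mult.commute)
  next
    case (mult p l)
    show ?case
      by (simp add: sweedler_W(5)[OF b1] K3_rules[OF x y] sweedler_W_lin mult.assoc[symmetric] mult.IH K_rules[OF x]
          W.scale_right_diff_distrib)
  qed (simp_all add: sweedler_W[OF b1] K_rules[OF x] W.scale_right_distrib mult.commute)
  have b2: "bil sM (\<lambda>p q. sM (y (h\<^sub>1 * S p)) (K x h (q * l) e))" for h\<^sub>1 l
    using linD(1,2)[OF y] by (simp add: bilinear_simps K_rules[OF x])
  show ?thesis
  proof (induction h\<^sub>2 arbitrary: h\<^sub>1 l rule: H_induct_right)
    case one show ?case by (simp add: sweedler_W(3)[OF b2] one_left antipode_rules)
  next
    case (scale c k)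
    then show ?case by (simp add: sweedler_W(2)[OF b2] scalar_out K3_rules[OF x y] sweedler_W_lin)
  next
    case (add k k')
    then show ?case by (simp add: sweedler_W(1)[OF b2] distrib_right K3_rules[OF x y] sweedler_W_lin)
  next
    case (mult p k)
    have "sweedler sM (\<lambda>l\<^sub>1 l\<^sub>2. K3 x y h (h\<^sub>1 * l\<^sub>1) (k * \<iota> p * l\<^sub>2) e) l =
        sweedler sM (\<lambda>l\<^sub>1 l\<^sub>2. K3 x y h (h\<^sub>1 * l\<^sub>1) (k * l\<^sub>2) e) (\<iota> p * l)
        - sweedler sM (\<lambda>l\<^sub>1 l\<^sub>2. K3 x y h (h\<^sub>1 * \<iota> p * l\<^sub>1) (k * l\<^sub>2) e) l"
      by (simp add: sweedler_W(4)[OF bil_K3_23] mult.assoc)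
    also have "\<dots> = sweedler sM (\<lambda>q r. sM (y (h\<^sub>1 * S q)) (K x h (r * l) e)) (k * \<iota> p)"
      unfolding mult by (simp add: sweedler_W(5)[OF b2] antipode_rules linD[OF y] sweedler_W_lin mult.assoc)
    finally show ?case .
  qed
qed

text \<open>The convolution of two translated functionals.\<close>

definition conv :: "'h \<Rightarrow> 'h \<Rightarrow> 'h \<Rightarrow> 'k" where
  "conv g\<^sub>1 g\<^sub>2 f = sweedler (*) (\<lambda>f\<^sub>1 f\<^sub>2. x (g\<^sub>1 * f\<^sub>1) * y (g\<^sub>2 * f\<^sub>2)) f"

lemmas sweedler_F = sweedler_add[OF vector_space_field] sweedler_scale[OF vector_space_field] sweedler_one[OF vector_space_field]
  sweedler_left[OF vector_space_field] sweedler_right[OF vector_space_field]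
lemmas sweedler_F_lin = sweedler_plus[OF vector_space_field] sweedler_sc[OF vector_space_field] sweedler_minus[OF vector_space_field]
  sweedler_diff[OF vector_space_field] sweedler_zero[OF vector_space_field]

lemma bil_conv: "bil (*) (\<lambda>f\<^sub>1 f\<^sub>2. x (g\<^sub>1 * f\<^sub>1) * y (g\<^sub>2 * f\<^sub>2))"
  using linD(1,2)[OF x] linD(1,2)[OF y] by (simp add: bil_def lin_def algebra_simps scalar_out)

lemma conv_rules:
  shows functional_conv: "functional (conv g\<^sub>1 g\<^sub>2)"
    and conv_left: "conv g\<^sub>1 g\<^sub>2 (\<iota> p * f) = conv (g\<^sub>1 * \<iota> p) g\<^sub>2 f + conv g\<^sub>1 (g\<^sub>2 * \<iota> p) f"
    and conv_add: "conv (g\<^sub>1 + h\<^sub>1) g\<^sub>2 = (\<lambda>f. conv g\<^sub>1 g\<^sub>2 f + conv h\<^sub>1 g\<^sub>2 f)"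
      "conv g\<^sub>1 (g\<^sub>2 + h\<^sub>2) = (\<lambda>f. conv g\<^sub>1 g\<^sub>2 f + conv g\<^sub>1 h\<^sub>2 f)"
    and conv_scale: "conv (sH c g\<^sub>1) g\<^sub>2 = (\<lambda>f. c * conv g\<^sub>1 g\<^sub>2 f)" "conv g\<^sub>1 (sH c g\<^sub>2) = (\<lambda>f. c * conv g\<^sub>1 g\<^sub>2 f)"
proof -
  show "functional (conv g\<^sub>1 g\<^sub>2)" by (simp add: lin_def conv_def sweedler_F[OF bil_conv])
  show "conv g\<^sub>1 g\<^sub>2 (\<iota> p * f) = conv (g\<^sub>1 * \<iota> p) g\<^sub>2 f + conv g\<^sub>1 (g\<^sub>2 * \<iota> p) f"
    by (simp add: conv_def sweedler_F[OF bil_conv] mult.assoc)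
  show "conv (g\<^sub>1 + h\<^sub>1) g\<^sub>2 = (\<lambda>f. conv g\<^sub>1 g\<^sub>2 f + conv h\<^sub>1 g\<^sub>2 f)"
    "conv g\<^sub>1 (g\<^sub>2 + h\<^sub>2) = (\<lambda>f. conv g\<^sub>1 g\<^sub>2 f + conv g\<^sub>1 h\<^sub>2 f)"
    by (simp_all add: fun_eq_iff conv_def distrib_right distrib_left linD[OF x] linD[OF y] sweedler_F_lin)
  have "a * (c * b) = c * (a * b)" "(c * a) * b = c * (a * b)" for a b :: 'k by (simp_all add: algebra_simps)
  then show "conv (sH c g\<^sub>1) g\<^sub>2 = (\<lambda>f. c * conv g\<^sub>1 g\<^sub>2 f)" "conv g\<^sub>1 (sH c g\<^sub>2) = (\<lambda>f. c * conv g\<^sub>1 g\<^sub>2 f)"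
    by (simp_all only: fun_eq_iff conv_def scalar_out linD[OF x] linD[OF y] sweedler_F_lin simp_thms)
qed

lemma K3_outer_right:
  "sweedler sM (\<lambda>f\<^sub>1 f\<^sub>2. K3 x y (g\<^sub>1 * f\<^sub>1) (g\<^sub>2 * f\<^sub>2) g d) f = K (conv g\<^sub>1 g\<^sub>2) f g d"
proof (induction g arbitrary: f d rule: H_induct_right)
  case one
  have "lin (*) sM (\<lambda>c. sM c d)" by (simp add: lin_def W.scale_left_distrib)
  from sweedler_linear[OF vector_space_field this]
  show ?case unfolding K_one[OF functional_conv] by (simp add: K3_rules[OF x y] conv_def)
next
  case (mult p g)
  have "sweedler sM (\<lambda>f\<^sub>1 f\<^sub>2. K3 x y (g\<^sub>1 * f\<^sub>1) (g\<^sub>2 * f\<^sub>2) (g * \<iota> p) d) f =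
     sweedler sM (\<lambda>f\<^sub>1 f\<^sub>2. K3 x y (g\<^sub>1 * f\<^sub>1) (g\<^sub>2 * f\<^sub>2) g (act (\<iota> p) d)) f
     - sweedler sM (\<lambda>f\<^sub>1 f\<^sub>2. K3 x y (g\<^sub>1 * f\<^sub>1) (g\<^sub>2 * f\<^sub>2) g d) (f * \<iota> p)"
    by (simp add: sweedler_W(5)[OF bil_K3_12] K3_rules[OF x y] sweedler_W_lin mult.assoc)
  then show ?case by (simp add: mult K_rules[OF functional_conv])
qed (simp_all add: K3_rules[OF x y] K_rules[OF functional_conv] sweedler_W_lin)

lemma coef3_comp_right:
  "coef3 x y (comp_right sH \<iota> act star B m) =
    feval sM (\<lambda>(g\<^sub>1, g\<^sub>2, e). coef (conv g\<^sub>1 g\<^sub>2) (star e m)) (coset_rep B)"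
proof -
  have "feval sM (\<lambda>(f\<^sub>1, f\<^sub>2). K3 x y (g\<^sub>1 * f\<^sub>1) (g\<^sub>2 * f\<^sub>2) g d) (coset_rep (coproduct sH \<iota> f)) = K (conv g\<^sub>1 g\<^sub>2) f g d"
    for g\<^sub>1 g\<^sub>2 f g d using K3_outer_right[of g\<^sub>1 g\<^sub>2 g d f] by (simp add: sweedler_def)
  then show ?thesis unfolding comp_right_def coef3_coset
    by (simp add: W.feval_frag_extend case_prod_beta' W.feval_simps coef_def)
qed

text \<open>For \<open>A = b * v\<close> this is the composition of the modes \<open>a\<^sub>x\<close> and \<open>b\<^sub>y\<close>, applied to \<open>v\<close>.\<close>

lemma coef3_comp_left:
  assumes T: "\<And>d. star a d \<in> cosets N2" "\<And>d e. star a (d + e) = star a d + star a e"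
    "\<And>q d. star a (act q d) = pt2_lmult sH \<iota> act 1 q (star a d)"
  shows "coef3 x y (comp_left sH \<iota> act star a A) = coef x (star a (coef y A))"
proof -
  have coef_act: "coef x (star a (act q d)) = feval sM (\<lambda>(h, l, e). K x h (q * l) e) (coset_rep (star a d))" for q d
    unfolding T(3) pt2_lmult_def induced_def coef_coset[OF x]
    by (simp add: W.feval_frag_extend case_prod_beta' W.feval_simps)
  have "coef x (star a (sM c d)) = sM c (coef x (star a d))" for c d
    unfolding k_scale_def[of sH act c d] coef_act
    by (simp add: scalar_out K_rules[OF x] case_prod_beta' W.feval_scale coef_def)
  then have lin: "lin sM sM (\<lambda>d. coef x (star a d))"
    using T by (simp add: lin_def coef_add[OF x])
  have inner: "feval sM (\<lambda>(h, l, e). feval sM (\<lambda>(l\<^sub>1, l\<^sub>2). K3 x y h (h\<^sub>1 * l\<^sub>1) (h\<^sub>2 * l\<^sub>2) e) (coset_rep (coproduct sH \<iota> l))) (coset_rep (star a d))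
      = coef x (star a (K y h\<^sub>1 h\<^sub>2 d))" for h\<^sub>1 h\<^sub>2 d
  proof -
    have expand: "feval sM (\<lambda>(l\<^sub>1, l\<^sub>2). K3 x y h (h\<^sub>1 * l\<^sub>1) (h\<^sub>2 * l\<^sub>2) e) (coset_rep (coproduct sH \<iota> l))
        = sweedler sM (\<lambda>p q. sM (y (h\<^sub>1 * S p)) (K x h (q * l) e)) h\<^sub>2" for h l e
      unfolding K3_outer_left[symmetric] by (simp add: sweedler_def)
    have "feval sM (\<lambda>(h, l, e). feval sM (\<lambda>(l\<^sub>1, l\<^sub>2). K3 x y h (h\<^sub>1 * l\<^sub>1) (h\<^sub>2 * l\<^sub>2) e) (coset_rep (coproduct sH \<iota> l))) (coset_rep (star a d))
      = feval sM (\<lambda>(h, l, e). sweedler sM (\<lambda>p q. sM (y (h\<^sub>1 * S p)) (K x h (q * l) e)) h\<^sub>2) (coset_rep (star a d))"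
      by (simp only: expand)
    also have "\<dots> = sweedler sM (\<lambda>p q. feval sM (\<lambda>(h, l, e). sM (y (h\<^sub>1 * S p)) (K x h (q * l) e)) (coset_rep (star a d))) h\<^sub>2"
      using sweedler_feval[OF W.vector_space_axioms, of "\<lambda>p q (h, l, e). sM (y (h\<^sub>1 * S p)) (K x h (q * l) e)" h\<^sub>2 "coset_rep (star a d)"]
      by (simp add: case_prod_beta')
    also have "\<dots> = sweedler sM (\<lambda>p q. coef x (star a (sM (y (h\<^sub>1 * S p)) (act q d)))) h\<^sub>2"
      unfolding linD(2)[OF lin] coef_act by (simp add: case_prod_beta' W.feval_scale)
    also have "\<dots> = coef x (star a (K y h\<^sub>1 h\<^sub>2 d))"
      unfolding K_def using sweedler_linear[OF W.vector_space_axioms lin] by simp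
    finally show ?thesis .
  qed
  have "coef3 x y (comp_left sH \<iota> act star a A) = feval sM (\<lambda>(h\<^sub>1, h\<^sub>2, d). coef x (star a (K y h\<^sub>1 h\<^sub>2 d))) (coset_rep A)"
    unfolding comp_left_def coef3_coset
    by (simp add: W.feval_frag_extend case_prod_beta' W.feval_simps inner[unfolded case_prod_beta'])
  also have "\<dots> = coef x (star a (coef y A))"
    unfolding coef_def[of y] using W.feval_linear[OF lin, of "\<lambda>(f, g, m). K y f g m" "coset_rep A"]
    by (simp add: case_prod_beta')
  finally show ?thesis .
qed

end

end

section \<open>Fourier modes of a module over a Lie pseudoalgebra\<close>

locale pseudo_module = enveloping_algebra sD brD sH \<iota> + lie_pseudoalgebra_module sH \<iota> actL br actV star
  for sD :: "'k::field \<Rightarrow> 'd::ab_group_add \<Rightarrow> 'd" and brD :: "'d \<Rightarrow> 'd \<Rightarrow> 'd"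
    and sH :: "'k \<Rightarrow> 'h::ring_1 \<Rightarrow> 'h" and \<iota> :: "'d \<Rightarrow> 'h"
    and actL :: "'h \<Rightarrow> 'l::ab_group_add \<Rightarrow> 'l" and br :: "'l \<Rightarrow> 'l \<Rightarrow> ('h \<times> 'h \<times> 'l) fsum set"
    and actV :: "'h \<Rightarrow> 'v::ab_group_add \<Rightarrow> 'v" and star :: "'l \<Rightarrow> 'v \<Rightarrow> ('h \<times> 'h \<times> 'v) fsum set"
begin

sublocale LM: env_module sD brD sH \<iota> actL
  by (intro env_module.intro enveloping_algebra_axioms left_module_axioms)
sublocale VM: env_module sD brD sH \<iota> actV
  by (intro env_module.intro enveloping_algebra_axioms V.left_module_axioms)

abbreviation "sV \<equiv> k_scale sH actV"

text \<open>The action of \<open>x \<otimes>\<^sub>H a\<close>, except that \<open>x\<close> is paired with \<open>h\<close> and not with \<open>S h\<close>.\<close>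

definition mode :: "'l \<Rightarrow> ('h \<Rightarrow> 'k) \<Rightarrow> 'v \<Rightarrow> 'v" where
  "mode a x v = VM.coef x (star a v)"

lemma star_rules:
  "star a v \<in> cosets VM.N2" "star (a + b) v = star a v + star b v" "star a (v + w) = star a v + star a w"
  "star (actL f a) (actV g v) = pt2_lmult sH \<iota> actV f g (star a v)"
  "star (actL f a) v = pt2_lmult sH \<iota> actV f 1 (star a v)"
  "star a (actV g v) = pt2_lmult sH \<iota> actV 1 g (star a v)"
proof -
  show 1: "star a v \<in> cosets VM.N2" "star (a + b) v = star a v + star b v" "star a (v + w) = star a v + star a w"
    and 2: "star (actL f a) (actV g v) = pt2_lmult sH \<iota> actV f g (star a v)" for a b f g v w
    using star_bilinear by (simp_all add: pseudo_bilinear_def)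
  show "star (actL f a) v = pt2_lmult sH \<iota> actV f 1 (star a v)" using 2[of f a 1 v] by (simp add: V.act_one)
  show "star a (actV g v) = pt2_lmult sH \<iota> actV 1 g (star a v)" using 2[of 1 a g v] by (simp add: act_one)
qed

context
  fixes x :: "'h \<Rightarrow> 'k"
  assumes x: "functional x"
begin

lemma mode_add: "mode a x (v + w) = mode a x v + mode a x w"
  and mode_add_left: "mode (a + b) x v = mode a x v + mode b x v"
  by (simp_all add: mode_def star_rules(2,3) VM.coef_add[OF x star_rules(1) star_rules(1)])

lemma mode_act_left: "mode (actL h a) x v = mode a (\<lambda>f. x (h * f)) v"
  unfolding mode_def star_rules(5) by (rule VM.coef_lmult(1)[OF x star_rules(1)])

lemma mode_iota: "mode a x (actV (\<iota> p) v) = actV (\<iota> p) (mode a x v) - mode a (\<lambda>f. x (f * \<iota> p)) v"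
  unfolding mode_def star_rules(6) by (rule VM.coef_lmult(2)[OF x star_rules(1)])

lemma mode_scale: "mode a x (sV c v) = sV c (mode a x v)"
proof -
  have "VM.coef x (pt2_lmult sH \<iota> actV 1 (sH c 1) A) = sV c (VM.coef x A)" for A
    unfolding pt2_lmult_def induced_def VM.coef_coset[OF x]
    by (simp add: VM.W.feval_frag_extend case_prod_beta' VM.W.feval_simps scalar_out VM.K_rules[OF x]
        VM.W.feval_scale VM.coef_def)
  then show ?thesis unfolding mode_def k_scale_def[of sH actV c v] star_rules(6) by simp
qed

lemma mode_lin: "lin sV sV (mode a x)"
  by (simp add: lin_def mode_add mode_scale)

lemma mode_scale_left: "mode (k_scale sH actL c a) x v = sV c (mode a x v)"
  unfolding k_scale_def[of sH actL c a] mode_act_left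
  using VM.coef_functional(2)[of c x] by (simp add: mode_def scalar_out linD[OF x])

end

lemma mode_functional:
  "mode a (\<lambda>f. x f + y f) v = mode a x v + mode a y v" "mode a (\<lambda>f. c * x f) v = sV c (mode a x v)"
  by (simp_all add: mode_def VM.coef_functional)

text \<open>The identity \<open>a * (b * v) = [a * b] * v + b * (a * v)\<close>, read off at the functional \<open>x \<otimes> y\<close>; the flip
  exchanges \<open>x\<close> and \<open>y\<close> in the last term.\<close>

lemma mode_commutator:
  assumes x: "functional x" and y: "functional y"
  shows "mode a x (mode b y v) =
    feval sV (\<lambda>(g\<^sub>1, g\<^sub>2, e). mode e (VM.conv x y g\<^sub>1 g\<^sub>2) v) (coset_rep (br a b)) + mode b y (mode a x v)"
proof -
  have "VM.coef3 x y (comp_left sH \<iota> actV star a (star b v)) =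
      VM.coef3 x y (comp_right sH \<iota> actV star (br a b) v + pt3_flip sH \<iota> actV (comp_left sH \<iota> actV star b (star a v)))"
    using star_bracket[of a b v] by (rule arg_cong)
  also have "\<dots> = VM.coef3 x y (comp_right sH \<iota> actV star (br a b) v)
      + VM.coef3 y x (comp_left sH \<iota> actV star b (star a v))"
    by (subst VM.coef3_add[OF x y])
      (simp_all add: comp_right_def pt3_flip_def induced_def cosets_def VM.coef3_flip[OF x y, unfolded pt3_flip_def induced_def])
  finally show ?thesis
    by (simp add: VM.coef3_comp_right[OF x y] VM.coef3_comp_left[OF x y] VM.coef3_comp_left[OF y x] star_rules mode_def)
qed

text \<open>When \<open>[a * b]\<close> lies in \<open>(H \<otimes> H) \<otimes>\<^sub>H I\<close>, the commutator of modes of \<open>a\<close> and \<open>b\<close> is a sum of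
  modes of elements of \<open>I\<close> that does not depend on the vector.\<close>

lemma mode_commutator_ideal:
  assumes x: "functional x" and y: "functional y" and I: "br a b \<in> pt2_sub sH \<iota> actL I"
  obtains w where "\<And>g\<^sub>1 g\<^sub>2 e. (g\<^sub>1, g\<^sub>2, e) \<in> Poly_Mapping.keys w \<Longrightarrow> e \<in> I"
    "\<And>v. mode a x (mode b y v) =
      feval sV (\<lambda>(g\<^sub>1, g\<^sub>2, e). mode e (VM.conv x y g\<^sub>1 g\<^sub>2) v) w + mode b y (mode a x v)"
proof -
  obtain w where w: "br a b = w +o LM.N2" and w_mem: "w \<in> group_closure {frag_of (f, g, u) | f g u. u \<in> I}"
    using I unfolding pt2_sub_def by blast
  have keys: "Poly_Mapping.keys w \<subseteq> {(f, g, u). u \<in> I}"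
    using w_mem
  proof induction
    case (diff s t)
    then show ?case using keys_diff[of s t] by blast
  qed auto
  have "feval sV (\<lambda>(g\<^sub>1, g\<^sub>2, e). mode e (VM.conv x y g\<^sub>1 g\<^sub>2) v) (coset_rep (br a b)) =
      feval sV (\<lambda>(g\<^sub>1, g\<^sub>2, e). mode e (VM.conv x y g\<^sub>1 g\<^sub>2) v) w" for v
  proof (rule LM.balanced_cong)
    show "vector_space sV" by (rule VM.W.vector_space_axioms)
    show "coset_rep (br a b) - w \<in> LM.N2" unfolding w by (rule coset_rep_cong[OF LM.pt2_sub])
    note c = VM.conv_rules[OF x y]
    show "LM.balanced sV (\<lambda>g\<^sub>1 g\<^sub>2 e. mode e (VM.conv x y g\<^sub>1 g\<^sub>2) v)"
      unfolding LM.balanced_def bil_def lin_def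
      by (simp add: c mode_functional mode_add_left mode_scale_left mode_act_left)
  qed
  then show ?thesis using mode_commutator[OF x y] keys by (intro that[of w]) auto
qed

end

section \<open>Families of lowering operators\<close>

text \<open>The model is a polynomial ring with \<open>\<tau>\<close> the family of all directional derivatives: the set \<open>filt n\<close>
  then consists of the polynomials of degree less than \<open>n\<close>, and multiplication by a linear form \<open>t\<close>
  raises with \<open>\<theta> \<alpha>\<close> the derivative of \<open>t\<close> along \<open>\<alpha>\<close>. In general the commutator of \<open>\<tau> \<alpha>\<close> with a raising
  operator may differ from this scalar by operators that lower the degree.\<close>

locale lowering_family = vector_space scale
  for scale :: "'k::field_char_0 \<Rightarrow> 'v::ab_group_add \<Rightarrow> 'v" +
  fixes \<Lambda> :: "'a set" and \<tau> :: "'a \<Rightarrow> 'v \<Rightarrow> 'v"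
  assumes lin_\<tau>: "\<alpha> \<in> \<Lambda> \<Longrightarrow> lin scale scale (\<tau> \<alpha>)"
begin

primrec filt :: "nat \<Rightarrow> 'v set" where
  "filt 0 = {0}"
| "filt (Suc n) = {u. \<forall>\<alpha>\<in>\<Lambda>. \<tau> \<alpha> u \<in> filt n}"

definition raises :: "('v \<Rightarrow> 'v) \<Rightarrow> ('a \<Rightarrow> 'k) \<Rightarrow> bool" where
  "raises D \<theta> \<longleftrightarrow> lin scale scale D \<and>
     (\<forall>\<alpha>\<in>\<Lambda>. \<forall>u. \<tau> \<alpha> (D u) - D (\<tau> \<alpha> u) - scale (\<theta> \<alpha>) u \<in> span ((\<lambda>\<beta>. \<tau> \<beta> u) ` \<Lambda>))"

lemma subspace_filt: "subspace (filt n)"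
  by (induction n) (auto simp: subspace_def linD[OF lin_\<tau>])

lemma filt_Suc: "filt n \<subseteq> filt (Suc n)"
  by (induction n) (auto simp: linD[OF lin_\<tau>])

lemma filt_mono: "m \<le> n \<Longrightarrow> filt m \<subseteq> filt n"
  by (rule lift_Suc_mono_le[of filt]) (use filt_Suc in auto)

lemma filt_lower: "\<alpha> \<in> \<Lambda> \<Longrightarrow> u \<in> filt n \<Longrightarrow> \<tau> \<alpha> u \<in> filt (n - 1)"
  by (cases n) (auto simp: linD[OF lin_\<tau>])

lemmas filt_closed = subspace_0[OF subspace_filt] subspace_add[OF subspace_filt] subspace_diff[OF subspace_filt]
  subspace_scale[OF subspace_filt] subspace_sum[OF subspace_filt]

lemma raises_remainder:
  assumes D: "raises D \<theta>" and \<alpha>: "\<alpha> \<in> \<Lambda>" and u: "u \<in> filt n"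
  shows "\<tau> \<alpha> (D u) - (D (\<tau> \<alpha> u) + scale (\<theta> \<alpha>) u) \<in> filt (n - 1)"
proof -
  have "span ((\<lambda>\<beta>. \<tau> \<beta> u) ` \<Lambda>) \<subseteq> filt (n - 1)"
    by (rule span_minimal) (use u filt_lower subspace_filt in auto)
  then show ?thesis using D \<alpha> by (auto simp: raises_def diff_diff_eq)
qed

lemma raises_linD: "raises D \<theta> \<Longrightarrow> lin scale scale D"
  by (simp add: raises_def)

lemma raises_filt:
  assumes D: "raises D \<theta>"
  shows "u \<in> filt n \<Longrightarrow> D u \<in> filt (Suc n)"
proof (induction n arbitrary: u)
  case 0
  then show ?case by (simp add: linD[OF raises_linD[OF D]] linD[OF lin_\<tau>])
next
  case (Suc n)
  have "\<tau> \<alpha> (D u) \<in> filt (Suc n)" if \<alpha>: "\<alpha> \<in> \<Lambda>" for \<alpha>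
  proof -
    have 1: "\<tau> \<alpha> (D u) - (D (\<tau> \<alpha> u) + scale (\<theta> \<alpha>) u) \<in> filt (Suc n)"
      by (rule subsetD[OF filt_Suc raises_remainder[OF D \<alpha> Suc.prems, unfolded diff_Suc_1]])
    have "D (\<tau> \<alpha> u) \<in> filt (Suc n)" by (rule Suc.IH) (use Suc.prems \<alpha> in simp)
    from filt_closed(2)[OF this filt_closed(4)[OF Suc.prems]]
    have "D (\<tau> \<alpha> u) + scale (\<theta> \<alpha>) u \<in> filt (Suc n)" .
    from filt_closed(2)[OF 1 this] show ?thesis by (simp only: diff_add_cancel)
  qed
  then show ?case by simp
qed

lemma raises_filt': "raises D \<theta> \<Longrightarrow> u \<in> filt (n - 1) \<Longrightarrow> D u \<in> filt n"
  using raises_filt[of D \<theta> u "n - 1"] by (cases n) (auto simp: linD[OF raises_linD])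

subsection \<open>Injectivity of a raising operator\<close>

text \<open>In the polynomial model \<open>D\<close> is multiplication by \<open>t\<close>, and the hypothesis is \<open>t f' + j f = 0\<close> for the
  leading part \<open>f\<close> of \<open>u\<close>, if \<open>\<theta> \<beta> = 1\<close>. Its derivative is \<open>t f'' + (j + 1) f' = 0\<close>, hence \<open>f' = 0\<close> by induction on
  the degree, and then \<open>f = 0\<close> because \<open>j\<close> is invertible.\<close>

lemma raises_descend:
  assumes D: "raises D \<theta>" and \<beta>: "\<beta> \<in> \<Lambda>" "\<theta> \<beta> \<noteq> 0"
  shows "j > 0 \<Longrightarrow> u \<in> filt (Suc n) \<Longrightarrow> D (\<tau> \<beta> u) + scale (of_nat j * \<theta> \<beta>) u \<in> filt n \<Longrightarrow> u \<in> filt n"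
proof (induction n arbitrary: u j)
  case 0
  then show ?case using \<beta> by (auto simp: linD[OF raises_linD[OF D]])
next
  case (Suc n)
  let ?u = "\<tau> \<beta> u"
  have u: "?u \<in> filt (Suc n)" using Suc.prems \<beta> by simp
  have rem: "\<tau> \<beta> (D ?u) - (D (\<tau> \<beta> ?u) + scale (\<theta> \<beta>) ?u) \<in> filt n"
    using raises_remainder[OF D \<beta>(1) u] by simp
  have "\<tau> \<beta> (D ?u + scale (of_nat j * \<theta> \<beta>) u) \<in> filt n" using Suc.prems(3) \<beta> by simp
  then have "\<tau> \<beta> (D ?u) + scale (of_nat j * \<theta> \<beta>) ?u \<in> filt n" by (simp add: linD[OF lin_\<tau>[OF \<beta>(1)]])
  from filt_closed(3)[OF this rem] have "D (\<tau> \<beta> ?u) + scale (of_nat (Suc j) * \<theta> \<beta>) ?u \<in> filt n"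
    by (simp add: algebra_simps scale_left_distrib)
  from Suc.IH[OF _ u this] have "?u \<in> filt n" by simp
  then have "D ?u \<in> filt (Suc n)" by (rule raises_filt[OF D])
  from filt_closed(3)[OF Suc.prems(3) this] have "scale (of_nat j * \<theta> \<beta>) u \<in> filt (Suc n)" by simp
  from filt_closed(4)[OF this, of "inverse (of_nat j * \<theta> \<beta>)"] show ?case
    using Suc.prems(1) \<beta>(2) by (simp del: filt.simps inverse_mult_distrib)
qed

lemma raises_injective:
  assumes D: "raises D \<theta>" and \<beta>: "\<beta> \<in> \<Lambda>" "\<theta> \<beta> \<noteq> 0" and u: "D u = 0" "u \<in> filt n"
  shows "u = 0"
  using u(2)
proof (induction n)
  case (Suc n)
  have "\<tau> \<beta> (D u) - (D (\<tau> \<beta> u) + scale (\<theta> \<beta>) u) \<in> filt n"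
    using raises_remainder[OF D \<beta>(1) Suc.prems] by simp
  then have "- (D (\<tau> \<beta> u) + scale (\<theta> \<beta>) u) \<in> filt n" by (simp add: u linD[OF lin_\<tau>[OF \<beta>(1)]])
  from filt_closed(4)[OF this, of "-1"] have "D (\<tau> \<beta> u) + scale (of_nat 1 * \<theta> \<beta>) u \<in> filt n"
    by (simp add: add.commute)
  from raises_descend[OF D \<beta> _ Suc.prems this] Suc.IH show ?case by simp
qed simp

subsection \<open>Independence of ordered monomials\<close>

primrec mon :: "(nat \<Rightarrow> 'v \<Rightarrow> 'v) \<Rightarrow> 'v \<Rightarrow> nat \<Rightarrow> (nat \<Rightarrow> nat) \<Rightarrow> 'v" where
  "mon D v 0 I = v"
| "mon D v (Suc m) I = (D m ^^ I m) (mon D v m I)"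

lemma mon_cong: "(\<And>i. i < m \<Longrightarrow> I i = J i) \<Longrightarrow> mon D v m I = mon D v m J"
  by (induction m) auto

lemma raises_power_filt: "raises D \<theta> \<Longrightarrow> u \<in> filt n \<Longrightarrow> (D ^^ k) u \<in> filt (n + k)"
  by (induction k) (auto simp del: filt.simps intro: raises_filt)

lemma raises_power_filt': "raises D \<theta> \<Longrightarrow> u \<in> filt (n - 1) \<Longrightarrow> (D ^^ k) u \<in> filt (n + k - 1)"
proof (cases n)
  case 0
  moreover assume "raises D \<theta>" "u \<in> filt (n - 1)"
  moreover have "(D ^^ k) 0 = 0" using \<open>raises D \<theta>\<close> by (induction k) (auto simp: linD[OF raises_linD])
  ultimately show ?thesis by (simp add: filt_closed(1))
qed (use raises_power_filt[of D \<theta> u "n - 1" k] in auto)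

lemma raises_power_lin: "raises D \<theta> \<Longrightarrow> lin scale scale (D ^^ k)"
  by (induction k) (auto simp: lin_def raises_def)

lemma raises_power_symbol:
  assumes D: "raises D \<theta>" and \<alpha>: "\<alpha> \<in> \<Lambda>" and u: "u \<in> filt (Suc n)"
  shows "\<tau> \<alpha> ((D ^^ k) u) - ((D ^^ k) (\<tau> \<alpha> u) + scale (of_nat k * \<theta> \<alpha>) ((D ^^ (k - 1)) u)) \<in> filt (n + k - 1)"
proof (induction k)
  case 0 show ?case by (simp add: filt_closed(1))
next
  case (Suc k)
  note lin = linD[OF raises_linD[OF D]]
  let ?w = "(D ^^ k) u"
  let ?r = "\<tau> \<alpha> ?w - ((D ^^ k) (\<tau> \<alpha> u) + scale (of_nat k * \<theta> \<alpha>) ((D ^^ (k - 1)) u))"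
  have "?w \<in> filt (Suc (n + k))" using raises_power_filt[OF D u, of k] by simp
  from raises_remainder[OF D \<alpha> this] have 1: "\<tau> \<alpha> (D ?w) - (D (\<tau> \<alpha> ?w) + scale (\<theta> \<alpha>) ?w) \<in> filt (n + k)" by simp
  have 2: "D ?r \<in> filt (n + k)" by (rule raises_filt'[OF D]) (use Suc in simp)
  have "scale (of_nat k * \<theta> \<alpha>) (D ((D ^^ (k - 1)) u)) = scale (of_nat k * \<theta> \<alpha>) ?w"
    by (cases k) auto
  then have "\<tau> \<alpha> (D ?w) - ((D ^^ Suc k) (\<tau> \<alpha> u) + scale (of_nat (Suc k) * \<theta> \<alpha>) ?w)
      = (\<tau> \<alpha> (D ?w) - (D (\<tau> \<alpha> ?w) + scale (\<theta> \<alpha>) ?w)) + D ?r"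
    by (simp add: lin algebra_simps scale_left_distrib)
  also have "\<dots> \<in> filt (n + k)" by (rule filt_closed(2)[OF 1 2])
  finally show ?case by simp
qed

context
  fixes D :: "nat \<Rightarrow> 'v \<Rightarrow> 'v" and \<theta> :: "nat \<Rightarrow> 'a \<Rightarrow> 'k" and v :: 'v
  assumes v: "v \<in> filt 1"
begin

lemma mon_filt: "(\<And>i. i < m \<Longrightarrow> raises (D i) (\<theta> i)) \<Longrightarrow> mon D v m I \<in> filt (Suc (\<Sum>i<m. I i))"
proof (induction m)
  case (Suc m)
  then show ?case using raises_power_filt[of "D m" "\<theta> m" "mon D v m I" "Suc (\<Sum>i<m. I i)" "I m"] by simp
qed (use v in simp)

text \<open>The Leibniz rule for ordered monomials, up to lower degree.\<close>

lemma mon_symbol: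
  assumes \<alpha>: "\<alpha> \<in> \<Lambda>"
  shows "(\<And>i. i < m \<Longrightarrow> raises (D i) (\<theta> i)) \<Longrightarrow>
    \<tau> \<alpha> (mon D v m I) - (\<Sum>i<m. scale (of_nat (I i) * \<theta> i \<alpha>) (mon D v m (I(i := I i - 1))))
      \<in> filt ((\<Sum>i<m. I i) - 1)"
proof (induction m)
  case 0
  then show ?case using v \<alpha> by simp
next
  case (Suc m)
  let ?n = "\<Sum>i<m. I i" and ?k = "I m" and ?u = "mon D v m I"
  let ?s = "\<lambda>m i. scale (of_nat (I i) * \<theta> i \<alpha>) (mon D v m (I(i := I i - 1)))"
  have D: "raises (D m) (\<theta> m)" by (simp add: Suc.prems)
  note lin = linD[OF raises_power_lin[OF D, of ?k]] lin_sum[OF raises_power_lin[OF D, of ?k]]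
  have 1: "\<tau> \<alpha> ((D m ^^ ?k) ?u) - ((D m ^^ ?k) (\<tau> \<alpha> ?u) + scale (of_nat ?k * \<theta> m \<alpha>) ((D m ^^ (?k - 1)) ?u))
      \<in> filt (?n + ?k - 1)"
    by (rule raises_power_symbol[OF D \<alpha> mon_filt]) (simp add: Suc.prems)
  have 2: "(D m ^^ ?k) (\<tau> \<alpha> ?u - (\<Sum>i<m. ?s m i)) \<in> filt (?n + ?k - 1)"
    by (rule raises_power_filt'[OF D Suc.IH]) (simp add: Suc.prems)
  have A: "(D m ^^ ?k) (\<Sum>i<m. ?s m i) = (\<Sum>i<m. ?s (Suc m) i)"
    by (simp add: lin)
  have "mon D v m (I(m := I m - 1)) = ?u" by (rule mon_cong) simp
  then have B: "?s (Suc m) m = scale (of_nat ?k * \<theta> m \<alpha>) ((D m ^^ (?k - 1)) ?u)" by simp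
  have "\<tau> \<alpha> (mon D v (Suc m) I) - (\<Sum>i<Suc m. ?s (Suc m) i)
      = (\<tau> \<alpha> ((D m ^^ ?k) ?u) - ((D m ^^ ?k) (\<tau> \<alpha> ?u) + scale (of_nat ?k * \<theta> m \<alpha>) ((D m ^^ (?k - 1)) ?u)))
        + (D m ^^ ?k) (\<tau> \<alpha> ?u - (\<Sum>i<m. ?s m i))"
    by (simp only: sum.lessThan_Suc B A[symmetric], simp only: lin(4) mon.simps(2), simp add: algebra_simps)
  also have "\<dots> \<in> filt (?n + ?k - 1)" by (rule filt_closed(2)[OF 1 2])
  finally show ?case by (simp only: sum.lessThan_Suc)
qed

abbreviation exps :: "nat \<Rightarrow> nat \<Rightarrow> (nat \<Rightarrow> nat) set" where
  "exps m n \<equiv> {I \<in> extensional {..<m}. (\<Sum>i<m. I i) = n}"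

lemma finite_exps: "finite (exps m n)"
proof (rule finite_subset)
  show "exps m n \<subseteq> {..<m} \<rightarrow>\<^sub>E {..n}"
    by (auto simp: PiE_def intro!: member_le_sum)
qed (simp add: finite_PiE)

context
  fixes m :: nat
  assumes D: "\<And>i. i < m \<Longrightarrow> raises (D i) (\<theta> i)"
    and \<theta>: "\<And>c i. (\<And>\<alpha>. \<alpha> \<in> \<Lambda> \<Longrightarrow> (\<Sum>i<m. c i * \<theta> i \<alpha>) = 0) \<Longrightarrow> i < m \<Longrightarrow> c i = 0"
    and v0: "v \<noteq> 0"
begin

text \<open>Applying \<open>\<tau> \<alpha>\<close> to a relation of degree \<open>n + 1\<close> yields one of degree \<open>n\<close> for every \<open>\<alpha>\<close>. Its coefficient
  at \<open>J\<close> is the sum over \<open>i\<close> of \<open>\<theta> i \<alpha>\<close> times \<open>J i + 1\<close> times the original coefficient at \<open>J\<close> with \<open>J i\<close>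
  increased by one. These sums vanish by induction, and the \<open>\<theta> i\<close> are independent as functions of \<open>\<alpha>\<close>.\<close>

lemma mon_homogeneous_independent:
  "(\<Sum>I\<in>exps m n. scale (c I) (mon D v m I)) \<in> filt n \<Longrightarrow> I \<in> exps m n \<Longrightarrow> c I = 0"
proof (induction n arbitrary: c I)
  case 0
  define Z where "Z = (\<lambda>i\<in>{..<m}. 0::nat)"
  have Z_eq: "exps m 0 = {Z}" by (auto simp: Z_def extensional_def fun_eq_iff)
  have "mon D v k Z = v" if "k \<le> m" for k using that by (induction k) (auto simp: Z_def)
  then have "scale (c Z) v = 0" using 0(1) unfolding Z_eq by simp
  with v0 0(2) show ?case unfolding Z_eq by auto
next
  case (Suc n)
  let ?up = "\<lambda>J i. J(i := Suc (J i))"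
  have up: "?up J i \<in> exps m (Suc n)" if "J \<in> exps m n" "i < m" for J i
  proof -
    have "(\<Sum>k<m. ?up J i k) = Suc (J i) + (\<Sum>k\<in>{..<m} - {i}. J k)"
      using that(2) by (subst sum.remove[of _ i]) (auto intro!: sum.cong)
    also have "\<dots> = Suc (\<Sum>k<m. J k)" using that(2) by (subst (2) sum.remove[of _ i]) auto
    finally show ?thesis using that by (auto simp: extensional_def)
  qed
  have down: "I(i := I i - 1) \<in> exps m n" if "I \<in> exps m (Suc n)" "i < m" "I i \<noteq> 0" for I i
  proof -
    have "(\<Sum>k<m. (I(i := I i - 1)) k) = (I i - 1) + (\<Sum>k\<in>{..<m} - {i}. I k)"
      using that(2) by (subst sum.remove[of _ i]) (auto intro!: sum.cong)
    also have "\<dots> = (\<Sum>k<m. I k) - 1" using that(2,3) by (subst (2) sum.remove[of _ i]) auto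
    finally show ?thesis using that by (auto simp: extensional_def)
  qed
  have coeff: "(\<Sum>i<m. c (?up J i) * of_nat (Suc (J i)) * \<theta> i \<alpha>) = 0" if J: "J \<in> exps m n" and \<alpha>: "\<alpha> \<in> \<Lambda>" for J \<alpha>
  proof (rule Suc.IH[OF _ J])
    let ?s = "\<lambda>I i. scale (of_nat (I i) * \<theta> i \<alpha>) (mon D v m (I(i := I i - 1)))"
    note lin = linD[OF lin_\<tau>[OF \<alpha>]] lin_sum[OF lin_\<tau>[OF \<alpha>]]
    have 1: "\<tau> \<alpha> (\<Sum>I\<in>exps m (Suc n). scale (c I) (mon D v m I)) \<in> filt n" using Suc.prems(1) \<alpha> by simp
    have "(\<Sum>I\<in>exps m (Suc n). scale (c I) (\<tau> \<alpha> (mon D v m I) - (\<Sum>i<m. ?s I i))) \<in> filt n"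
    proof (rule filt_closed(5), rule filt_closed(4))
      fix I assume "I \<in> exps m (Suc n)"
      then show "\<tau> \<alpha> (mon D v m I) - (\<Sum>i<m. ?s I i) \<in> filt n"
        using mon_symbol[OF \<alpha>, of m I] D by simp
    qed
    from filt_closed(3)[OF 1 this] have 2: "(\<Sum>I\<in>exps m (Suc n). scale (c I) (\<Sum>i<m. ?s I i)) \<in> filt n"
      by (simp add: lin scale_right_diff_distrib sum_subtractf)
    have "(\<Sum>I\<in>exps m (Suc n). scale (c I) (\<Sum>i<m. ?s I i)) = (\<Sum>i<m. \<Sum>I\<in>exps m (Suc n). scale (c I) (?s I i))"
      unfolding scale_sum_right by (rule sum.swap)
    also have "\<dots> = (\<Sum>i<m. \<Sum>J\<in>exps m n. scale (c (?up J i) * of_nat (Suc (J i)) * \<theta> i \<alpha>) (mon D v m J))"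
    proof (rule sum.cong[OF refl])
      fix i assume "i \<in> {..<m}"
      then have i: "i < m" by simp
      have "(\<Sum>I\<in>exps m (Suc n). scale (c I) (?s I i)) = (\<Sum>I\<in>{I \<in> exps m (Suc n). I i \<noteq> 0}. scale (c I) (?s I i))"
        by (rule sum.mono_neutral_right) (use finite_exps in auto)
      also have "\<dots> = (\<Sum>J\<in>exps m n. scale (c (?up J i) * of_nat (Suc (J i)) * \<theta> i \<alpha>) (mon D v m J))"
      proof (rule sum.reindex_bij_witness[where i = "\<lambda>J. ?up J i" and j = "\<lambda>I. I(i := I i - 1)"])
        fix I assume "I \<in> {I \<in> exps m (Suc n). I i \<noteq> 0}"
        then show "I(i := I i - 1) \<in> exps m n" using down i by blast
      next
        fix J assume "J \<in> exps m n"
        then show "?up J i \<in> {I \<in> exps m (Suc n). I i \<noteq> 0}" using up[of J i] i by simp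
      qed (auto simp: fun_upd_idem mult.assoc)
      finally show "(\<Sum>I\<in>exps m (Suc n). scale (c I) (?s I i)) = \<dots>" .
    qed
    also have "\<dots> = (\<Sum>J\<in>exps m n. scale (\<Sum>i<m. c (?up J i) * of_nat (Suc (J i)) * \<theta> i \<alpha>) (mon D v m J))"
      unfolding scale_sum_left by (rule sum.swap)
    finally show "(\<Sum>J\<in>exps m n. scale (\<Sum>i<m. c (?up J i) * of_nat (Suc (J i)) * \<theta> i \<alpha>) (mon D v m J)) \<in> filt n"
      using 2 by simp
  qed
  have "\<exists>i<m. I i \<noteq> 0"
  proof (rule ccontr)
    assume "\<not> ?thesis"
    then have "(\<Sum>i<m. I i) = 0" by simp
    with Suc.prems(2) show False by simp
  qed
  then obtain i where i: "i < m" "I i \<noteq> 0" by blast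
  have "c (?up (I(i := I i - 1)) i) * of_nat (Suc ((I(i := I i - 1)) i)) = 0"
    using \<theta>[OF coeff[OF down[OF Suc.prems(2) i]] i(1)] by simp
  then show ?case using i by (simp add: fun_upd_idem)
qed

text \<open>The monomials of maximal degree in a relation satisfy one modulo lower degree.\<close>

lemma mon_independent:
  assumes A: "finite A" "A \<subseteq> extensional {..<m}" and zero: "(\<Sum>I\<in>A. scale (c I) (mon D v m I)) = 0"
    and I: "I \<in> A"
  shows "c I = 0"
proof (rule ccontr)
  assume "c I \<noteq> 0"
  let ?deg = "\<lambda>I. \<Sum>i<m. I i" and ?B = "{I \<in> A. c I \<noteq> 0}"
  let ?f = "\<lambda>I. scale (c I) (mon D v m I)"
  define n where "n = Max (?deg ` ?B)"
  have B: "finite (?deg ` ?B)" "?deg ` ?B \<noteq> {}" using A I \<open>c I \<noteq> 0\<close> by auto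
  have "n \<in> ?deg ` ?B" unfolding n_def by (rule Max_in[OF B])
  then obtain J where J: "J \<in> A" "c J \<noteq> 0" "?deg J = n" by blast
  have le_n: "?deg I \<le> n" if "I \<in> A" "c I \<noteq> 0" for I
    unfolding n_def by (rule Max_ge[OF B(1)]) (use that in blast)
  have "(\<Sum>I\<in>A. ?f I) = (\<Sum>I\<in>A \<inter> exps m n. ?f I) + (\<Sum>I\<in>A - exps m n. ?f I)"
    by (rule sum.Int_Diff[OF A(1)])
  then have split: "(\<Sum>I\<in>A \<inter> exps m n. ?f I) = 0 - (\<Sum>I\<in>A - exps m n. ?f I)"
    by (simp only: zero eq_diff_eq)
  have "(\<Sum>I\<in>A - exps m n. ?f I) \<in> filt n"
  proof (rule filt_closed(5))
    fix I assume I: "I \<in> A - exps m n"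
    show "?f I \<in> filt n"
    proof (cases "c I = 0")
      case True
      then show ?thesis by (simp only: scale_zero_left filt_closed(1))
    next
      case False
      have "?deg I \<noteq> n" using I A(2) by blast
      moreover have "?deg I \<le> n" using le_n[of I] False I by blast
      ultimately have "Suc (?deg I) \<le> n" by linarith
      from subsetD[OF filt_mono[OF this] mon_filt[OF D]] show ?thesis by (rule filt_closed(4))
    qed
  qed
  then have "(\<Sum>I\<in>A \<inter> exps m n. ?f I) \<in> filt n"
    unfolding split by (intro filt_closed(3) filt_closed(1))
  moreover have "(\<Sum>I\<in>exps m n. scale (if I \<in> A then c I else 0) (mon D v m I)) = (\<Sum>I\<in>A \<inter> exps m n. ?f I)"
    by (rule sum.mono_neutral_cong_right) (use finite_exps in auto)
  ultimately have "(\<Sum>I\<in>exps m n. scale (if I \<in> A then c I else 0) (mon D v m I)) \<in> filt n" by (simp only:)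
  moreover have "J \<in> exps m n" using J A(2) by blast
  ultimately have "(\<lambda>I. if I \<in> A then c I else 0) J = 0"
    by (rule mon_homogeneous_independent)
  with J show False by simp
qed

lemma card_le_of_mon_in_span:
  assumes A: "finite A" "A \<subseteq> extensional {..<m}" and T: "finite T" "\<And>I. I \<in> A \<Longrightarrow> mon D v m I \<in> span T"
  shows "card A \<le> card T"
proof -
  have inj: "inj_on (mon D v m) A"
  proof (rule inj_onI, rule ccontr)
    fix I J assume IJ: "I \<in> A" "J \<in> A" "mon D v m I = mon D v m J" "I \<noteq> J"
    define c where "c K = (if K = I then 1 else -1 :: 'k)" for K
    have "c I = 0"
    proof (rule mon_independent[of "{I, J}" c])
      show "finite {I, J}" "{I, J} \<subseteq> extensional {..<m}" "I \<in> {I, J}" using IJ(1,2) A(2) by blast+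
      have "c I = 1" "c J = - 1" using IJ(4) by (simp_all add: c_def)
      then show "(\<Sum>K\<in>{I, J}. scale (c K) (mon D v m K)) = 0" using IJ(3,4) by simp
    qed
    then show False by (simp add: c_def)
  qed
  have "u w = 0" if t: "finite t" "t \<subseteq> mon D v m ` A" "(\<Sum>w\<in>t. scale (u w) w) = 0" "w \<in> t" for t u w
  proof -
    obtain C where C: "C \<subseteq> A" "t = mon D v m ` C" using t(2) by (rule subset_imageE)
    obtain I where I: "I \<in> C" "w = mon D v m I" using t(4) C(2) by blast
    have "(\<Sum>I\<in>C. scale (u (mon D v m I)) (mon D v m I)) = (\<Sum>w\<in>t. scale (u w) w)"
      unfolding C(2) sum.reindex[OF inj_on_subset[OF inj C(1)]] comp_def ..
    then have "(\<Sum>I\<in>C. scale (u (mon D v m I)) (mon D v m I)) = 0" using t(3) by (rule trans)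
    from mon_independent[OF finite_subset[OF C(1) A(1)] order_trans[OF C(1) A(2)] this I(1)]
    show ?thesis unfolding I(2) .
  qed
  then have "independent (mon D v m ` A)" unfolding independent_explicit_module by blast
  from independent_span_bound[OF T(1) this] T(2) have "card (mon D v m ` A) \<le> card T" by blast
  with card_image[OF inj] show ?thesis by simp
qed

end

end

end

section \<open>Growth of a finitely generated module\<close>

lemma card_sorted_words:
  "card {w. sorted w \<and> set w \<subseteq> {..<r::nat} \<and> length w \<le> k} \<le> (k + 1) ^ r"
    and finite_sorted_words: "finite {w. sorted w \<and> set w \<subseteq> {..<r::nat} \<and> length w \<le> k}"
proof -
  let ?A = "{w. sorted w \<and> set w \<subseteq> {..<r} \<and> length w \<le> k}" and ?f = "\<lambda>w. \<lambda>i\<in>{..<r}. count_list w i"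
  have maps: "?f ` ?A \<subseteq> {..<r} \<rightarrow>\<^sub>E {..k}"
  proof (rule image_subsetI)
    fix w assume "w \<in> ?A"
    then have "count_list w i \<le> k" for i using le_trans[OF count_le_length[of w i]] by blast
    then show "?f w \<in> {..<r} \<rightarrow>\<^sub>E {..k}" by (intro restrict_PiE_iff[THEN iffD2]) simp
  qed
  have inj: "inj_on ?f ?A"
  proof (rule inj_onI)
    fix w w' assume w: "w \<in> ?A" "w' \<in> ?A" "?f w = ?f w'"
    have "count_list w i = count_list w' i" for i
    proof (cases "i < r")
      case True then show ?thesis using fun_cong[OF w(3), of i] by simp
    next
      case False
      then have "i \<notin> set w" "i \<notin> set w'" using w by auto
      then show ?thesis by simp
    qed
    then have "mset w = mset w'" by (simp add: multiset_eq_iff count_mset)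
    moreover have "sorted w" "sorted w'" using w(1,2) by simp_all
    ultimately have "sort w' = w" "sort w' = w'" using properties_for_sort[of w w'] sorted_sort_id by blast+
    then show "w = w'" by simp
  qed
  have fin: "finite ({..<r} \<rightarrow>\<^sub>E {..k})" by (simp add: finite_PiE)
  show "finite ?A" using inj_on_finite[OF inj maps fin] .
  have "card ?A \<le> card ({..<r} \<rightarrow>\<^sub>E {..k})" by (rule card_inj_on_le[OF inj maps fin])
  then show "card ?A \<le> (k + 1) ^ r" by (simp add: card_PiE)
qed

context vector_space
begin

context
  fixes e :: "nat \<Rightarrow> 'b \<Rightarrow> 'b" and r :: nat and S :: "'b set"
  assumes e_lin: "\<And>i. i < r \<Longrightarrow> lin scale scale (e i)"
    and e_bracket: "\<And>i j u. i < r \<Longrightarrow> j < r \<Longrightarrow> e i (e j u) - e j (e i u) \<in> span ((\<lambda>l. e l u) ` {..<r})"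
begin

definition level :: "nat \<Rightarrow> 'b set" where
  "level k = span {foldr e w s | w s. s \<in> S \<and> set w \<subseteq> {..<r} \<and> length w \<le> k}"

lemma level_word: "s \<in> S \<Longrightarrow> set w \<subseteq> {..<r} \<Longrightarrow> length w \<le> k \<Longrightarrow> foldr e w s \<in> level k"
  unfolding level_def by (rule span_base) blast

lemma subspace_level: "subspace (level k)"
  by (simp add: level_def)

lemma level_mono: "k \<le> l \<Longrightarrow> level k \<subseteq> level l"
  unfolding level_def by (rule span_mono) (blast intro: le_trans)

lemma level_induct [consumes 1, case_names word add zero scale]:
  assumes u: "u \<in> level k" and word: "\<And>w s. s \<in> S \<Longrightarrow> set w \<subseteq> {..<r} \<Longrightarrow> length w \<le> k \<Longrightarrow> P (foldr e w s)"
    and add: "\<And>u v. P u \<Longrightarrow> P v \<Longrightarrow> P (u + v)" and zero: "P 0" and scale: "\<And>c u. P u \<Longrightarrow> P (scale c u)"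
  shows "P u"
proof -
  have "level k \<subseteq> Collect P" unfolding level_def
    by (rule span_minimal) (use word add zero scale in \<open>auto simp: subspace_def\<close>)
  with u show ?thesis by blast
qed

lemma e_level: "i < r \<Longrightarrow> u \<in> level k \<Longrightarrow> e i u \<in> level (Suc k)"
proof (rule level_induct[of u k], assumption)
  assume i: "i < r"
  fix w s assume "s \<in> S" "set w \<subseteq> {..<r}" "length w \<le> k"
  with i level_word[of s "i # w" "Suc k"] show "e i (foldr e w s) \<in> level (Suc k)" by simp
qed (auto simp: linD[OF e_lin] intro: subspace_add[OF subspace_level] subspace_0[OF subspace_level]
    subspace_scale[OF subspace_level])

text \<open>Straightening: moving \<open>e i\<close> past a letter costs a commutator, which is a combination of single
  letters and therefore shortens the word.\<close>

lemma insort_word: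
  assumes s: "s \<in> S" and i: "i < r"
  shows "set w \<subseteq> {..<r} \<Longrightarrow> e i (foldr e w s) - foldr e (insort i w) s \<in> level (length w)"
proof (induction w)
  case Nil
  show ?case by (simp add: subspace_0[OF subspace_level])
next
  case (Cons j w)
  have j: "j < r" and w: "set w \<subseteq> {..<r}" using Cons.prems by auto
  show ?case
  proof (cases "i \<le> j")
    case True then show ?thesis by (simp add: subspace_0[OF subspace_level])
  next
    case False
    let ?u = "foldr e w s"
    have "(\<lambda>l. e l ?u) ` {..<r} \<subseteq> level (Suc (length w))"
      using e_level level_word[OF s w le_refl] by blast
    then have "e i (e j ?u) - e j (e i ?u) \<in> level (Suc (length w))"
      using e_bracket[OF i j] span_minimal[OF _ subspace_level] by blast
    moreover have "e j (e i ?u - foldr e (insort i w) s) \<in> level (Suc (length w))"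
      using Cons.IH[OF w] by (rule e_level[OF j])
    ultimately have "(e i (e j ?u) - e j (e i ?u)) + e j (e i ?u - foldr e (insort i w) s) \<in> level (Suc (length w))"
      by (rule subspace_add[OF subspace_level])
    then show ?thesis using False by (simp add: linD[OF e_lin[OF j]])
  qed
qed

lemma level_sorted:
  "level k \<subseteq> span {foldr e w s | w s. s \<in> S \<and> sorted w \<and> set w \<subseteq> {..<r} \<and> length w \<le> k}"
    (is "_ \<subseteq> span (?G k)")
proof (induction k)
  case 0
  have "foldr e w s \<in> ?G 0" if "s \<in> S" "length w \<le> 0" for w s
    using that by (intro CollectI exI[of _ "[]"] exI[of _ s]) simp
  then show ?case unfolding level_def by (intro span_mono) blast
next
  case (Suc k)
  have mono: "span (?G k) \<subseteq> span (?G (Suc k))" by (rule span_mono) (blast intro: le_SucI)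
  have step: "e i u \<in> span (?G (Suc k))" if i: "i < r" and u: "u \<in> span (?G k)" for i u
    using u
  proof (rule span_induct_alt)
    show "e i 0 \<in> span (?G (Suc k))" by (simp add: linD[OF e_lin[OF i]] span_zero)
  next
    fix c x y assume x: "x \<in> ?G k" and y: "e i y \<in> span (?G (Suc k))"
    from x obtain w s where w: "x = foldr e w s" "s \<in> S" "sorted w" "set w \<subseteq> {..<r}" "length w \<le> k" by blast
    have diff: "e i x - foldr e (insort i w) s \<in> span (?G (Suc k))"
      using insort_word[OF w(2) i w(4)] level_mono[OF w(5)] Suc mono w(1) by blast
    have "foldr e (insort i w) s \<in> ?G (Suc k)"
      using w(2-5) i by (intro CollectI exI[of _ "insort i w"] exI[of _ s]) (auto simp: sorted_insort set_insort_key)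
    from span_add[OF diff span_base[OF this]] have "e i x \<in> span (?G (Suc k))" by (simp only: diff_add_cancel)
    with y show "e i (scale c x + y) \<in> span (?G (Suc k))"
      by (simp add: linD[OF e_lin[OF i]] span_add span_scale)
  qed
  show ?case unfolding level_def
  proof (rule span_minimal)
    show "{foldr e w s |w s. s \<in> S \<and> set w \<subseteq> {..<r} \<and> length w \<le> Suc k} \<subseteq> span (?G (Suc k))"
    proof clarify
      fix w s assume w: "s \<in> S" "set w \<subseteq> {..<r}" "length w \<le> Suc k"
      show "foldr e w s \<in> span (?G (Suc k))"
      proof (cases w)
        case Nil
        have "foldr e [] s \<in> ?G (Suc k)" using w(1) by (intro CollectI exI[of _ "[]"] exI[of _ s]) simp
        with Nil show ?thesis by (simp only: span_base)
      next
        case (Cons i w')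
        then show ?thesis using step[of i "foldr e w' s"] w level_word[of s w' k] Suc by auto
      qed
    qed
  qed simp
qed

lemma level_dimension:
  assumes "finite S"
  obtains T where "finite T" "card T \<le> card S * (k + 1) ^ r" "level k \<subseteq> span T"
proof -
  let ?W = "{w. sorted w \<and> set w \<subseteq> {..<r} \<and> length w \<le> k}"
  let ?T = "(\<lambda>(s, w). foldr e w s) ` (S \<times> ?W)"
  have "{foldr e w s | w s. s \<in> S \<and> sorted w \<and> set w \<subseteq> {..<r} \<and> length w \<le> k} \<subseteq> ?T" by auto
  with level_sorted[of k] have "level k \<subseteq> span ?T" using span_mono by blast
  moreover have "card ?T \<le> card (S \<times> ?W)"
    using assms finite_sorted_words by (intro card_image_le) blast
  then have "card ?T \<le> card S * (k + 1) ^ r"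
    using card_sorted_words[of r k] by (simp add: card_cartesian_product) (meson le_trans mult_le_mono2)
  ultimately show ?thesis using assms finite_sorted_words by (intro that[of ?T]) auto
qed

text \<open>The constant \<open>c\<close> is the same for all levels because the operators \<open>b \<beta>\<close> share it on \<open>S\<close> and because
  commuting one of them with a letter produces another one.\<close>

lemma level_shift:
  assumes base: "\<And>\<beta> s. \<beta> \<in> B \<Longrightarrow> s \<in> S \<Longrightarrow> b \<beta> s \<in> level c" and b: "\<And>\<beta>. \<beta> \<in> B \<Longrightarrow> lin scale scale (b \<beta>)"
    and comm: "\<And>\<beta> i. \<beta> \<in> B \<Longrightarrow> i < r \<Longrightarrow> \<exists>\<gamma>\<in>B. \<forall>u. b \<beta> (e i u) = e i (b \<beta> u) - b \<gamma> u"
  shows "\<beta> \<in> B \<Longrightarrow> u \<in> level k \<Longrightarrow> b \<beta> u \<in> level (k + c)"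
proof -
  have word: "\<beta> \<in> B \<Longrightarrow> set w \<subseteq> {..<r} \<Longrightarrow> b \<beta> (foldr e w s) \<in> level (length w + c)" if s: "s \<in> S" for w s \<beta>
  proof (induction w arbitrary: \<beta>)
    case Nil then show ?case using base s by simp
  next
    case (Cons i w)
    obtain \<gamma> where \<gamma>: "\<gamma> \<in> B" "\<And>u. b \<beta> (e i u) = e i (b \<beta> u) - b \<gamma> u" using comm[of \<beta> i] Cons.prems by auto
    have "e i (b \<beta> (foldr e w s)) \<in> level (Suc (length w + c))" using Cons by (intro e_level) auto
    moreover have "b \<gamma> (foldr e w s) \<in> level (Suc (length w + c))"
      using Cons \<gamma>(1) level_mono[of "length w + c" "Suc (length w + c)"] by auto
    ultimately show ?case using \<gamma>(2) subspace_diff[OF subspace_level] by simp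
  qed
  assume \<beta>: "\<beta> \<in> B" and "u \<in> level k"
  from this(2) show ?thesis
  proof (induction rule: level_induct)
    case (word w s)
    then show ?case using \<open>\<And>w s \<beta>. s \<in> S \<Longrightarrow> \<beta> \<in> B \<Longrightarrow> set w \<subseteq> {..<r} \<Longrightarrow> b \<beta> (foldr e w s) \<in> level (length w + c)\<close>[of s \<beta> w] \<beta>
        level_mono[of "length w + c" "k + c"] by auto
  qed (use linD[OF b[OF \<beta>]] subspace_add[OF subspace_level] subspace_0[OF subspace_level]
      subspace_scale[OF subspace_level] in auto)
qed

end

end

lemma polynomial_growth_bound:
  fixes a c d r :: nat
  assumes "\<And>n. (n + 1) ^ Suc r \<le> a * (c * n + d + 1) ^ r"
  shows False
proof -
  \<comment> \<open>The right-hand side is at most \<open>a C\<^sup>r (n + 1)\<^sup>r\<close>, so the inequality fails at \<open>n = a C\<^sup>r\<close>.\<close>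
  define C where "C = c + d + 1"
  let ?n = "a * C ^ r"
  have "c * ?n + d + 1 \<le> C * (?n + 1)" by (simp add: C_def algebra_simps)
  then have "(c * ?n + d + 1) ^ r \<le> (C * (?n + 1)) ^ r" by (rule power_mono) simp
  then have "a * (c * ?n + d + 1) ^ r \<le> a * (C * (?n + 1)) ^ r" by (rule mult_le_mono2)
  with assms[of ?n] have "(?n + 1) ^ Suc r \<le> a * (C * (?n + 1)) ^ r" by linarith
  also have "\<dots> = ?n * (?n + 1) ^ r" by (simp only: power_mult_distrib mult.assoc)
  finally have "(?n + 1) * (?n + 1) ^ r \<le> ?n * (?n + 1) ^ r" by simp
  then show False by simp
qed

section \<open>Right multiplication by primitive elements\<close>

locale enveloping_algebra_char_0 = enveloping_algebra sD brD sH \<iota>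
  for sD :: "'k::field_char_0 \<Rightarrow> 'd::ab_group_add \<Rightarrow> 'd" and brD :: "'d \<Rightarrow> 'd \<Rightarrow> 'd"
    and sH :: "'k \<Rightarrow> 'h::ring_1 \<Rightarrow> 'h" and \<iota> :: "'d \<Rightarrow> 'h"
begin

text \<open>The operators \<open>h \<mapsto> x(h\<^sub>1) h\<^sub>2 - x(1) h\<close> kill the constants, and right multiplication by an element of
  \<open>\<dd>\<close> is a raising operator for them, because \<open>\<Delta>(h p) = \<Delta>(h) (p \<otimes> 1 + 1 \<otimes> p)\<close>. The resulting
  filtration of \<open>H\<close> is the coradical filtration; it is exhaustive since \<open>\<dd>\<close> generates \<open>H\<close>.\<close>

definition shift :: "('h \<Rightarrow> 'k) \<Rightarrow> 'h \<Rightarrow> 'h" where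
  "shift x h = sweedler sH (\<lambda>h\<^sub>1 h\<^sub>2. sH (x h\<^sub>1) h\<^sub>2) h - sH (x 1) h"

lemma bil_shift: "functional x \<Longrightarrow> bil sH (\<lambda>h\<^sub>1 h\<^sub>2. sH (x h\<^sub>1) h\<^sub>2)"
  by (simp add: bil_def lin_def H.scale_left_distrib H.scale_right_distrib mult.commute)

lemma lin_shift: "functional x \<Longrightarrow> lin sH sH (shift x)"
  using sweedler_add[OF H.vector_space_axioms bil_shift] sweedler_scale[OF H.vector_space_axioms bil_shift]
  by (simp add: lin_def shift_def H.scale_right_distrib H.scale_right_diff_distrib mult.commute)

sublocale shift: lowering_family sH "Collect functional" shift
  by unfold_locales (use lin_shift in auto)

lemma raises_right_mult: "shift.raises (\<lambda>h. h * \<iota> p) (\<lambda>x. x (\<iota> p))"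
  unfolding shift.raises_def
proof (intro conjI ballI allI)
  show "lin sH sH (\<lambda>h. h * \<iota> p)" by (simp add: lin_def distrib_right scalar_out)
  fix x h assume "x \<in> Collect functional"
  then have x: "functional x" by simp
  let ?x = "\<lambda>f. x (f * \<iota> p)"
  have "sweedler sH (\<lambda>h\<^sub>1 h\<^sub>2. sH (x h\<^sub>1) (h\<^sub>2 * \<iota> p)) h = sweedler sH (\<lambda>h\<^sub>1 h\<^sub>2. sH (x h\<^sub>1) h\<^sub>2) h * \<iota> p"
    using sweedler_linear[OF H.vector_space_axioms, of sH "\<lambda>h. h * \<iota> p" "\<lambda>h\<^sub>1 h\<^sub>2. sH (x h\<^sub>1) h\<^sub>2" h]
    by (simp add: lin_def distrib_right scalar_out)
  then have "shift x (h * \<iota> p) - shift x h * \<iota> p - sH (x (\<iota> p)) h = shift ?x h"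
    by (simp add: shift_def sweedler_right[OF H.vector_space_axioms bil_shift[OF x]] scalar_out left_diff_distrib)
  moreover have "?x \<in> Collect functional" using functional_right[OF x] by simp
  ultimately show "shift x (h * \<iota> p) - shift x h * \<iota> p - sH (x (\<iota> p)) h \<in> H.span ((\<lambda>x. shift x h) ` Collect functional)"
    by (metis (mono_tags, lifting) H.span_base imageI)
qed

lemma shift_exhaustive: "\<exists>n. h \<in> shift.filt n"
proof (induction h rule: H_induct_right)
  case one
  have "shift x 1 = 0" if "functional x" for x
    using that by (simp add: shift_def sweedler_one[OF H.vector_space_axioms bil_shift])
  then show ?case by (intro exI[of _ 1]) simp
next
  case (scale c h)
  then show ?case using shift.filt_closed(4) by blast
next
  case (add g h)
  then obtain m n where "g \<in> shift.filt m" "h \<in> shift.filt n" by blast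
  then have "g \<in> shift.filt (max m n)" "h \<in> shift.filt (max m n)"
    using shift.filt_mono[of m "max m n"] shift.filt_mono[of n "max m n"] by auto
  then show ?case using shift.filt_closed(2) by blast
next
  case (mult p h)
  then show ?case using shift.raises_filt[OF raises_right_mult] by blast
qed

lemma functionals_separate: assumes "\<And>x. functional x \<Longrightarrow> x h = 0" shows "h = 0"
proof -
  have "coord b h = 0" for b by (rule assms[OF functional_coord])
  then show ?thesis
    using H.sum_nonzero_representation_eq[OF basisH(1), of h] basisH(2) by (simp add: coord_def)
qed

lemma right_mult_iota_injective: assumes "h * \<iota> p = 0" "\<iota> p \<noteq> 0" shows "h = 0"
proof -
  obtain x where x: "functional x" "x (\<iota> p) \<noteq> 0" using functionals_separate assms(2) by blast
  obtain n where "h \<in> shift.filt n" using shift_exhaustive by blast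
  then show ?thesis
    using shift.raises_injective[of "\<lambda>h. h * \<iota> p" "\<lambda>x. x (\<iota> p)" x h n] raises_right_mult assms(1) x by simp
qed

lemma iota_zero: "\<iota> 0 = 0"
  using iota_add[of 0 0] by simp

lemma iota_sum: "\<iota> (sum f A) = (\<Sum>i\<in>A. \<iota> (f i))"
  by (induction A rule: infinite_finite_induct) (auto simp: iota_add iota_zero)

text \<open>Independence is asked of the \<open>\<iota> (p i)\<close>, because these, and not the \<open>p i\<close>, act on modules.\<close>

lemma iota_basis:
  assumes "finite_dimensional_vector_space sD B"
  obtains r p where "\<And>c i. (\<Sum>i<r. sH (c i) (\<iota> (p i))) = 0 \<Longrightarrow> i < r \<Longrightarrow> c i = 0"
    "\<And>q. \<exists>c. \<iota> q = (\<Sum>i<r::nat. sH (c i) (\<iota> (p i)))"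
proof -
  interpret fd: finite_dimensional_vector_space sD B by fact
  obtain C where C: "C \<subseteq> \<iota> ` B" "H.independent C" "\<iota> ` B \<subseteq> H.span C"
    using H.maximal_independent_subset by blast
  have finC: "finite C" using C(1) fd.finite_Basis finite_subset by blast
  obtain g where g: "bij_betw g {..<card C} C"
    using ex_bij_betw_nat_finite[OF finC] by (auto simp: atLeast0LessThan)
  have "\<forall>i\<in>{..<card C}. \<exists>q. g i = \<iota> q" using bij_betwE[OF g] C(1) by blast
  from bchoice[OF this] obtain p where p: "\<And>i. i < card C \<Longrightarrow> g i = \<iota> (p i)" by auto
  have reindex: "(\<Sum>i<card C. sH (c (g i)) (\<iota> (p i))) = (\<Sum>b\<in>C. sH (c b) b)" for c
    using sum.reindex_bij_betw[OF g, of "\<lambda>b. sH (c b) b"] p by simp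
  show ?thesis
  proof (rule that[of p "card C"])
    fix c i assume zero: "(\<Sum>i<card C. sH (c i) (\<iota> (p i))) = 0" and i: "i < card C"
    define d where "d b = c (the_inv_into {..<card C} g b)" for b
    have d: "d (g i) = c i" if "i < card C" for i
      using that the_inv_into_f_f[OF bij_betw_imp_inj_on[OF g], of i] by (simp add: d_def)
    have "(\<Sum>b\<in>C. sH (d b) b) = 0" using zero d by (simp add: reindex[symmetric])
    from H.independentD[OF C(2) finC subset_refl this, of "g i"] show "c i = 0"
      using d[OF i] bij_betwE[OF g] i by simp
  next
    fix q
    have "q \<in> span B" using fd.span_Basis by simp
    then have "\<iota> q \<in> H.span C"
    proof (induction rule: span_induct_alt)
      case base then show ?case by (simp add: iota_zero H.span_zero)
    next
      case (step c x y)
      then show ?case using C(3) by (auto simp: iota_add iota_scale intro!: H.span_add H.span_scale)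
    qed
    then obtain c where "\<iota> q = (\<Sum>b\<in>C. sH (c b) b)" unfolding H.span_finite[OF finC] by auto
    then have "\<iota> q = (\<Sum>i<card C. sH ((c \<circ> g) i) (\<iota> (p i)))" using reindex[of c] by simp
    then show "\<exists>c. \<iota> q = (\<Sum>i<card C. sH (c i) (\<iota> (p i)))" by blast
  qed
qed

end

section \<open>Eigenspaces of an ideal\<close>

locale ideal_eigenspace = pseudo_module sD brD sH \<iota> actL br actV star
  for sD :: "'k::field_char_0 \<Rightarrow> 'd::ab_group_add \<Rightarrow> 'd" and brD :: "'d \<Rightarrow> 'd \<Rightarrow> 'd"
    and sH :: "'k \<Rightarrow> 'h::ring_1 \<Rightarrow> 'h" and \<iota> :: "'d \<Rightarrow> 'h"
    and actL :: "'h \<Rightarrow> 'l::ab_group_add \<Rightarrow> 'l" and br :: "'l \<Rightarrow> 'l \<Rightarrow> ('h \<times> 'h \<times> 'l) fsum set"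
    and actV :: "'h \<Rightarrow> 'v::ab_group_add \<Rightarrow> 'v" and star :: "'l \<Rightarrow> 'v \<Rightarrow> ('h \<times> 'h \<times> 'v) fsum set" +
  fixes I :: "'l set" and \<phi> :: "'l \<Rightarrow> 'h"
  assumes ideal: "pseudo_submodule sH \<iota> actL br I"
begin

sublocale enveloping_algebra_char_0 sD brD sH \<iota>
  by (intro enveloping_algebra_char_0.intro enveloping_algebra_axioms)

abbreviation "modes \<equiv> I \<times> Collect functional"

text \<open>The operators whose common kernel is the eigenspace.\<close>

definition \<tau> :: "'l \<times> ('h \<Rightarrow> 'k) \<Rightarrow> 'v \<Rightarrow> 'v" where
  "\<tau> = (\<lambda>(a, x) u. mode a x u - sV (x (\<phi> a)) u)"

lemma lin_\<tau>_mode: "functional x \<Longrightarrow> lin sV sV (\<tau> (a, x))"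
  using linD(1,2)[OF mode_lin]
  by (simp add: lin_def \<tau>_def VM.W.scale_right_distrib VM.W.scale_right_diff_distrib mult.commute)

sublocale eigen: lowering_family sV modes \<tau>
  by unfold_locales (use lin_\<tau>_mode in auto)

abbreviation "V\<phi> \<equiv> phi_space sH \<iota> actV star I \<phi>"

lemma coef_tensor: "functional x \<Longrightarrow> VM.coef x (pt2_tensor sH \<iota> actV f 1 v) = sV (x f) v"
  by (simp add: pt2_tensor_def VM.coef_coset VM.W.feval_simps VM.K_one)

lemma phi_space_iff: "v \<in> V\<phi> \<longleftrightarrow> (\<forall>\<alpha>\<in>modes. \<tau> \<alpha> v = 0)"
proof
  assume v: "v \<in> V\<phi>"
  show "\<forall>\<alpha>\<in>modes. \<tau> \<alpha> v = 0"
    using v by (auto simp: phi_space_def \<tau>_def mode_def coef_tensor)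
next
  assume v: "\<forall>\<alpha>\<in>modes. \<tau> \<alpha> v = 0"
  have "star a v = pt2_tensor sH \<iota> actV (\<phi> a) 1 v" if a: "a \<in> I" for a
  proof (rule VM.coef_determines[OF star_rules(1)])
    show "pt2_tensor sH \<iota> actV (\<phi> a) 1 v \<in> cosets VM.N2" by (simp add: pt2_tensor_def cosets_def)
    fix x :: "'h \<Rightarrow> 'k" assume "functional x"
    with v a show "VM.coef x (star a v) = VM.coef x (pt2_tensor sH \<iota> actV (\<phi> a) 1 v)"
      by (auto simp: coef_tensor \<tau>_def mode_def)
  qed
  then show "v \<in> V\<phi>" by (simp add: phi_space_def)
qed

lemma phi_space_filt: "V\<phi> = eigen.filt 1"
  using phi_space_iff by auto

lemma subspace_phi: "VM.W.subspace V\<phi>"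
  unfolding phi_space_filt by (rule eigen.subspace_filt)

lemma raises_iota: "eigen.raises (actV (\<iota> p)) (\<lambda>(a, x). - x (\<phi> a * \<iota> p))"
  unfolding eigen.raises_def
proof (intro conjI ballI allI)
  show "lin sV sV (actV (\<iota> p))" by (simp add: lin_def V.act_add_right VM.act_scalar)
  fix \<alpha> u assume "\<alpha> \<in> modes"
  then obtain a x where \<alpha>: "\<alpha> = (a, x)" "a \<in> I" "functional x" by auto
  have "\<tau> \<alpha> (actV (\<iota> p) u) - actV (\<iota> p) (\<tau> \<alpha> u) - sV ((\<lambda>(a, x). - x (\<phi> a * \<iota> p)) \<alpha>) u
      = - \<tau> (a, \<lambda>f. x (f * \<iota> p)) u"
    by (simp add: \<alpha> \<tau>_def mode_iota VM.act_diff VM.act_scalar)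
  also have "\<dots> \<in> VM.W.span ((\<lambda>\<beta>. \<tau> \<beta> u) ` modes)"
    using \<alpha> functional_right[OF \<alpha>(3)] by (intro VM.W.span_neg VM.W.span_base imageI) simp
  finally show "\<tau> \<alpha> (actV (\<iota> p) u) - actV (\<iota> p) (\<tau> \<alpha> u) - sV ((\<lambda>(a, x). - x (\<phi> a * \<iota> p)) \<alpha>) u
      \<in> VM.W.span ((\<lambda>\<beta>. \<tau> \<beta> u) ` modes)" .
qed

text \<open>The commutator of \<open>b\<^sub>y\<close> with \<open>a\<^sub>x\<close> is a sum of modes of elements of \<open>I\<close>. Each of these is an operator
  of the family \<open>\<tau>\<close> plus a scalar, and the scalars add up to \<open>\<psi> (a, x)\<close>.\<close>

lemma raises_mode:
  assumes y: "functional y"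
  obtains \<psi> where "eigen.raises (mode b y) \<psi>" "(\<forall>e\<in>I. \<phi> e = 0) \<Longrightarrow> \<forall>\<alpha>\<in>modes. \<psi> \<alpha> = 0"
proof -
  have "\<exists>c. (\<forall>u. \<tau> \<alpha> (mode b y u) - mode b y (\<tau> \<alpha> u) - sV c u \<in> VM.W.span ((\<lambda>\<beta>. \<tau> \<beta> u) ` modes))
      \<and> ((\<forall>e\<in>I. \<phi> e = 0) \<longrightarrow> c = 0)" if mode: "\<alpha> \<in> modes" for \<alpha>
  proof -
    obtain a x where \<alpha>: "\<alpha> = (a, x)" "a \<in> I" "functional x" using mode by auto
    note x = \<alpha>(3)
    have "br b a \<in> pt2_sub sH \<iota> actL I" using ideal \<alpha>(2) by (simp add: pseudo_submodule_def)
    from mode_commutator_ideal[OF y x this] obtain w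
      where w: "\<And>g\<^sub>1 g\<^sub>2 e. (g\<^sub>1, g\<^sub>2, e) \<in> Poly_Mapping.keys w \<Longrightarrow> e \<in> I"
        "\<And>v. mode b y (mode a x v) =
          feval sV (\<lambda>(g\<^sub>1, g\<^sub>2, e). mode e (VM.conv y x g\<^sub>1 g\<^sub>2) v) w + mode a x (mode b y v)" by blast
    define \<gamma> where "\<gamma> = (\<lambda>(g\<^sub>1, g\<^sub>2, e :: 'l). (e, VM.conv y x g\<^sub>1 g\<^sub>2))"
    define c where "c = - feval (*) (\<lambda>(g\<^sub>1, g\<^sub>2, e). VM.conv y x g\<^sub>1 g\<^sub>2 (\<phi> e)) w"
    have \<gamma>: "\<gamma> k \<in> modes" if "k \<in> Poly_Mapping.keys w" for k
      using that w(1) VM.functional_conv[OF y x] by (cases k) (auto simp: \<gamma>_def)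
    have "\<tau> \<alpha> (mode b y u) - mode b y (\<tau> \<alpha> u) - sV c u \<in> VM.W.span ((\<lambda>\<beta>. \<tau> \<beta> u) ` modes)" for u
    proof -
      have lin: "lin (*) sV (\<lambda>c. sV c u)" by (simp add: lin_def VM.W.scale_left_distrib)
      interpret F: vector_space "(*) :: 'k \<Rightarrow> 'k \<Rightarrow> 'k" by (rule vector_space_field)
      have "\<tau> \<alpha> (mode b y u) - mode b y (\<tau> \<alpha> u) = - feval sV (\<lambda>(g\<^sub>1, g\<^sub>2, e). mode e (VM.conv y x g\<^sub>1 g\<^sub>2) u) w"
        by (simp add: \<alpha> \<tau>_def linD[OF mode_lin[OF y]] w(2))
      moreover have "sV c u = - feval sV (\<lambda>(g\<^sub>1, g\<^sub>2, e). sV (VM.conv y x g\<^sub>1 g\<^sub>2 (\<phi> e)) u) w"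
        using F.feval_linear[OF lin, of "\<lambda>(g\<^sub>1, g\<^sub>2, e). VM.conv y x g\<^sub>1 g\<^sub>2 (\<phi> e)" w]
        by (simp add: c_def case_prod_beta')
      ultimately have "\<tau> \<alpha> (mode b y u) - mode b y (\<tau> \<alpha> u) - sV c u =
          - (feval sV (\<lambda>(g\<^sub>1, g\<^sub>2, e). mode e (VM.conv y x g\<^sub>1 g\<^sub>2) u) w
          - feval sV (\<lambda>(g\<^sub>1, g\<^sub>2, e). sV (VM.conv y x g\<^sub>1 g\<^sub>2 (\<phi> e)) u) w)" by simp
      also have "\<dots> = - feval sV (\<lambda>k. \<tau> (\<gamma> k) u) w"
        unfolding VM.W.feval_subtract[symmetric] by (simp add: \<gamma>_def \<tau>_def case_prod_beta')
      also have "\<dots> \<in> VM.W.span ((\<lambda>\<beta>. \<tau> \<beta> u) ` modes)"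
        unfolding feval_def using \<gamma> by (intro VM.W.span_neg VM.W.span_sum VM.W.span_scale VM.W.span_base imageI)
      finally show ?thesis .
    qed
    moreover have "c = 0" if "\<forall>e\<in>I. \<phi> e = 0"
    proof -
      have "VM.conv y x g\<^sub>1 g\<^sub>2 (\<phi> e) = 0" if "(g\<^sub>1, g\<^sub>2, e) \<in> Poly_Mapping.keys w" for g\<^sub>1 g\<^sub>2 e
        using w(1)[OF that] \<open>\<forall>e\<in>I. \<phi> e = 0\<close> linD(3)[OF VM.functional_conv[OF y x]] by simp
      then show ?thesis unfolding c_def feval_def by (auto intro!: sum.neutral)
    qed
    ultimately show ?thesis by blast
  qed
  then have "\<forall>\<alpha>\<in>modes. \<exists>c. (\<forall>u. \<tau> \<alpha> (mode b y u) - mode b y (\<tau> \<alpha> u) - sV c u \<in> VM.W.span ((\<lambda>\<beta>. \<tau> \<beta> u) ` modes))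
      \<and> ((\<forall>e\<in>I. \<phi> e = 0) \<longrightarrow> c = 0)" by (rule ballI)
  from bchoice[OF this] obtain \<psi> where "\<forall>\<alpha>\<in>modes.
      (\<forall>u. \<tau> \<alpha> (mode b y u) - mode b y (\<tau> \<alpha> u) - sV (\<psi> \<alpha>) u \<in> VM.W.span ((\<lambda>\<beta>. \<tau> \<beta> u) ` modes))
      \<and> ((\<forall>e\<in>I. \<phi> e = 0) \<longrightarrow> \<psi> \<alpha> = 0)" by blast
  then show ?thesis using mode_lin[OF y] by (intro that[of \<psi>]) (simp_all only: eigen.raises_def simp_thms, blast+)
qed

lemma raises_on_phi:
  assumes "eigen.raises D \<theta>" "v \<in> V\<phi>" "\<alpha> \<in> modes"
  shows "\<tau> \<alpha> (D v) = sV (\<theta> \<alpha>) v"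
proof -
  have "v \<in> eigen.filt 1" using assms(2) by (simp add: phi_space_filt)
  moreover have "\<tau> \<alpha> v = 0" using assms(2,3) phi_space_iff[of v] by blast
  moreover note eigen.raises_remainder[OF assms(1,3) calculation(1)]
  ultimately show ?thesis by (simp add: linD(3)[OF eigen.raises_linD[OF assms(1)]])
qed

text \<open>
  The \<open>r + 1\<close> operators are the basis of the image of \<open>\<dd>\<close> and \<open>b\<^sub>y\<close>. The last one raises the filtration
  of \<open>V\<close> by words in \<open>\<dd>\<close> by a bounded amount: for a generator \<open>s\<close> the vectors \<open>b\<^sub>z s\<close>, for all \<open>z\<close>, lie in
  the span of the finitely many vectors occurring in \<open>b * s\<close>, and the commutator of a mode of \<open>b\<close>
  with an element of \<open>\<dd>\<close> is a mode of \<open>b\<close>.\<close>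

lemma no_independent_raising_mode:
  assumes fin: "finite_h_module actV" and v: "v \<in> V\<phi>" "v \<noteq> 0" and y: "functional y"
    and \<psi>: "eigen.raises (mode b y) \<psi>"
    and span: "\<And>q. \<exists>c. \<iota> q = (\<Sum>i<r::nat. sH (c i) (\<iota> (p i)))"
    and indep: "\<And>c i. (\<And>\<alpha>. \<alpha> \<in> modes \<Longrightarrow>
        (\<Sum>i<r. c i * (\<lambda>(a, x). - x (\<phi> a * \<iota> (p i))) \<alpha>) + c r * \<psi> \<alpha> = 0) \<Longrightarrow> i < Suc r \<Longrightarrow> c i = 0"
  shows False
proof -
  define e where "e i = actV (\<iota> (p i))" for i
  define D where "D i = (if i < r then e i else mode b y)" for i
  define \<theta> where "\<theta> i = (if i < r then (\<lambda>(a, x). - x (\<phi> a * \<iota> (p i))) else \<psi>)" for i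
  obtain S where S: "finite S" "h_span actV S = UNIV" using fin by (auto simp: finite_h_module_def)
  have e_lin: "lin sV sV (e i)" for i
    by (simp add: e_def lin_def V.act_add_right VM.act_scalar)
  have iota_span: "actV (\<iota> q) u \<in> VM.W.span ((\<lambda>l. e l u) ` {..<r})" for q u
  proof -
    obtain c where c: "\<iota> q = (\<Sum>i<r. sH (c i) (\<iota> (p i)))" using span by blast
    have act_sum: "actV (\<Sum>i\<in>A. f i) u = (\<Sum>i\<in>A. actV (f i) u)" for f and A :: "nat set"
      by (induction A rule: infinite_finite_induct) (auto simp: V.act_add_left VM.act_zero)
    show ?thesis unfolding c act_sum VM.act_scalar e_def[symmetric]
      by (intro VM.W.span_sum VM.W.span_scale VM.W.span_base) auto
  qed
  have e_bracket: "e i (e j u) - e j (e i u) \<in> VM.W.span ((\<lambda>l. e l u) ` {..<r})" for i j u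
  proof -
    have "actV (\<iota> (p i) * \<iota> (p j) - \<iota> (p j) * \<iota> (p i)) u = e i (e j u) - e j (e i u)"
      using V.act_add_left[of "\<iota> (p i) * \<iota> (p j)" "- (\<iota> (p j) * \<iota> (p i))" u]
      by (simp add: e_def V.act_mult VM.act_minus_left)
    then have "e i (e j u) - e j (e i u) = actV (\<iota> (brD (p i) (p j))) u" by (simp add: iota_bracket)
    then show ?thesis using iota_span by simp
  qed
  let ?L = "VM.W.level e r S"
  note L_e = VM.W.e_level[where e = e and r = r and S = S, OF e_lin e_bracket]
    and L_sub = VM.W.subspace_level[where e = e and r = r and S = S, OF e_lin e_bracket] and L_mono = VM.W.level_mono[where e = e and r = r and S = S, OF e_lin e_bracket]
  note L_rules = VM.W.subspace_add[OF L_sub] VM.W.subspace_0[OF L_sub] VM.W.subspace_scale[OF L_sub]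
    VM.W.subspace_diff[OF L_sub] VM.W.subspace_sum[OF L_sub]
  have L_iota: "actV (\<iota> q) u \<in> ?L (Suc k)" if "u \<in> ?L k" for q u k
  proof -
    have "VM.W.span ((\<lambda>l. e l u) ` {..<r}) \<subseteq> ?L (Suc k)"
      by (rule VM.W.span_minimal[OF _ L_sub]) (use that L_e in auto)
    then show ?thesis using iota_span by blast
  qed
  have L_act: "\<exists>k. actV h s \<in> ?L k" if s: "s \<in> S" for h s
  proof (induction h rule: H_induct_left)
    case one
    have "s \<in> ?L 0" using VM.W.level_word[where e = e and w = "[]" and k = 0 and r = r, OF e_lin e_bracket s] by simp
    then show ?case by (auto simp: V.act_one)
  next
    case (scale c h)
    then show ?case using L_rules(3) by (auto simp: VM.act_scalar)
  next
    case (add g h)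
    then obtain m n where "actV g s \<in> ?L m" "actV h s \<in> ?L n" by blast
    then have "actV g s \<in> ?L (max m n)" "actV h s \<in> ?L (max m n)"
      using L_mono[of m "max m n"] L_mono[of n "max m n"] by auto
    then show ?case using L_rules(1) by (auto simp: V.act_add_left)
  next
    case (mult q h)
    then show ?case using L_iota by (auto simp: V.act_mult)
  qed
  have L_exhaustive: "\<exists>k. u \<in> ?L k" for u
  proof -
    have "u \<in> group_closure {actV h s | h s. s \<in> S}" using S(2) by (simp add: h_span_def set_eq_iff)
    then show ?thesis
    proof induction
      case (base s) then show ?case using L_act L_rules(2) by auto
    next
      case (diff s t)
      then obtain m n where "s \<in> ?L m" "t \<in> ?L n" by blast
      then have "s \<in> ?L (max m n)" "t \<in> ?L (max m n)"
        using L_mono[of m "max m n"] L_mono[of n "max m n"] by auto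
      then show ?case using L_rules(4) by blast
    qed
  qed
  have uniform: "\<exists>k. \<forall>u\<in>U. u \<in> ?L k" if "finite U" for U
    using that
  proof induction
    case (insert u U)
    then obtain m n where "u \<in> ?L m" "\<forall>u\<in>U. u \<in> ?L n" using L_exhaustive by blast
    then have "\<forall>u\<in>insert u U. u \<in> ?L (max m n)"
      using L_mono[of m "max m n"] L_mono[of n "max m n"] by auto
    then show ?case by blast
  qed simp
  have "\<exists>U. finite U \<and> (\<forall>z. functional z \<longrightarrow> mode b z s \<in> VM.W.span U)" for s
  proof -
    obtain t where t: "star b s = t +o VM.N2" using star_rules(1)[of b s] by (auto simp: cosets_def)
    obtain t' where t': "t - VM.nf t' \<in> VM.N2" using VM.normal_form_exists by blast
    have "mode b z s \<in> VM.W.span (snd ` Poly_Mapping.keys t')" if z: "functional z" for z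
    proof -
      have "mode b z s = feval sV (\<lambda>(h, u). sV (z h) u) t'"
        unfolding mode_def t VM.coef_coset[OF z] VM.coef_cong[OF z t']
        by (simp add: VM.W.feval_frag_extend case_prod_beta' VM.W.feval_simps VM.K_one[OF z])
      also have "\<dots> \<in> VM.W.span (snd ` Poly_Mapping.keys t')"
        unfolding feval_def by (intro VM.W.span_sum VM.W.span_scale)
          (auto simp: case_prod_beta' intro: VM.W.span_scale[OF VM.W.span_base[OF rev_image_eqI]])
      finally show ?thesis .
    qed
    then show ?thesis by (intro exI[of _ "snd ` Poly_Mapping.keys t'"]) simp
  qed
  then obtain U where U: "\<And>s. finite (U s)" "\<And>s z. functional z \<Longrightarrow> mode b z s \<in> VM.W.span (U s)" by metis
  obtain c\<^sub>1 where c\<^sub>1: "\<forall>u\<in>(\<Union>s\<in>S. U s). u \<in> ?L c\<^sub>1" using uniform[of "\<Union>s\<in>S. U s"] S(1) U(1) by blast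
  \<comment> \<open>The successor makes \<open>c\<close> positive, so that it also bounds the degree of the letters.\<close>
  define c where "c = Suc c\<^sub>1"
  have mode_S: "mode b z s \<in> ?L c" if "functional z" "s \<in> S" for z s
  proof -
    have "VM.W.span (U s) \<subseteq> ?L c\<^sub>1" by (rule VM.W.span_minimal[OF _ L_sub]) (use that c\<^sub>1 in auto)
    then show ?thesis using U(2)[OF that(1)] L_mono[of c\<^sub>1 c] by (auto simp: c_def)
  qed
  have mode_L: "mode b y u \<in> ?L (k + c)" if "u \<in> ?L k" for u k
  proof (rule VM.W.level_shift[where e = e and r = r and S = S and B = "Collect functional" and b = "mode b", OF e_lin e_bracket])
    show "mode b z s \<in> ?L c" if "z \<in> Collect functional" "s \<in> S" for z s using mode_S that by simp
    show "lin sV sV (mode b z)" if "z \<in> Collect functional" for z using mode_lin that by simp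
    show "\<exists>z'\<in>Collect functional. \<forall>u. mode b z (e i u) = e i (mode b z u) - mode b z' u"
      if "z \<in> Collect functional" for z i
      using that mode_iota[of z b "p i"] functional_right[of z "\<iota> (p i)"]
      by (intro bexI[of _ "\<lambda>f. z (f * \<iota> (p i))"]) (auto simp: e_def)
    show "y \<in> Collect functional" "u \<in> ?L k" using y that by simp_all
  qed
  have D_L: "D i u \<in> ?L (k + c)" if i: "i < Suc r" and u: "u \<in> ?L k" for i u k
  proof (cases "i < r")
    case True
    then show ?thesis using L_e[of i u k] u L_mono[of "Suc k" "k + c"] by (auto simp: D_def c_def)
  next
    case False
    then show ?thesis using mode_L[OF u] by (simp add: D_def)
  qed
  obtain d where d: "v \<in> ?L d" using L_exhaustive by blast
  have power_L: "(D i ^^ k) u \<in> ?L (n + k * c)" if "i < Suc r" "u \<in> ?L n" for i u n k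
  proof (induction k)
    case (Suc k)
    then show ?case using D_L[OF that(1), of "(D i ^^ k) u" "n + k * c"] by (simp add: algebra_simps)
  qed (use that in simp)
  have mon_L: "eigen.mon D v m J \<in> ?L (c * (\<Sum>i<m. J i) + d)" if "m \<le> Suc r" for m J
    using that
  proof (induction m)
    case (Suc m)
    then show ?case using power_L[of m "eigen.mon D v m J" "c * (\<Sum>i<m. J i) + d" "J m"] by (simp add: algebra_simps)
  qed (use d in simp)
  have v1: "v \<in> eigen.filt 1" using v(1) by (simp add: phi_space_filt)
  have D_raises: "eigen.raises (D i) (\<theta> i)" if "i < Suc r" for i
    using raises_iota \<psi> by (auto simp: D_def \<theta>_def e_def)
  have \<theta>_indep: "c i = 0" if zero: "\<And>\<alpha>. \<alpha> \<in> modes \<Longrightarrow> (\<Sum>i<Suc r. c i * \<theta> i \<alpha>) = 0" and "i < Suc r" for c i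
  proof (rule indep[OF _ that(2)])
    fix \<alpha> assume "\<alpha> \<in> modes"
    from zero[OF this] show "(\<Sum>i<r. c i * (\<lambda>(a, x). - x (\<phi> a * \<iota> (p i))) \<alpha>) + c r * \<psi> \<alpha> = 0"
      by (simp add: \<theta>_def)
  qed
  have "(n + 1) ^ Suc r \<le> card S * (c * Suc r * n + d + 1) ^ r" for n
  proof -
    let ?A = "{..<Suc r} \<rightarrow>\<^sub>E {..n}"
    obtain T where T: "finite T" "card T \<le> card S * (c * Suc r * n + d + 1) ^ r" "?L (c * Suc r * n + d) \<subseteq> VM.W.span T"
      using VM.W.level_dimension[where e = e and r = r and S = S and k = "c * Suc r * n + d", OF e_lin e_bracket S(1)] by blast
    have "card ?A \<le> card T"
    proof (rule eigen.card_le_of_mon_in_span[where D = D and \<theta> = \<theta> and v = v and m = "Suc r", OF v1])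
      show "v \<noteq> 0" by (rule v(2))
      show "eigen.raises (D i) (\<theta> i)" if "i < Suc r" for i using that by (rule D_raises)
      show "c i = 0" if "\<And>\<alpha>. \<alpha> \<in> modes \<Longrightarrow> (\<Sum>i<Suc r. c i * \<theta> i \<alpha>) = 0" "i < Suc r" for c i
        using \<theta>_indep[of c i] that by blast
      show "finite ?A" by (simp add: finite_PiE)
      show "?A \<subseteq> extensional {..<Suc r}" by (auto simp: PiE_def)
      fix J assume J: "J \<in> ?A"
      have "(\<Sum>i<Suc r. J i) \<le> (\<Sum>i<Suc r. n)" by (rule sum_mono) (use J in \<open>auto simp: PiE_iff\<close>)
      then have "(\<Sum>i<Suc r. J i) \<le> Suc r * n" by simp
      from mult_le_mono2[OF this, of c] have "c * (\<Sum>i<Suc r. J i) \<le> c * Suc r * n" by (simp only: mult.assoc)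
      then have "?L (c * (\<Sum>i<Suc r. J i) + d) \<subseteq> ?L (c * Suc r * n + d)" by (intro L_mono) simp
      then show "eigen.mon D v (Suc r) J \<in> VM.W.span T" using mon_L[of "Suc r" J] T(3) by blast
    qed (rule T(1))
    also have "card ?A = (n + 1) ^ Suc r" by (subst card_PiE) simp_all
    finally show ?thesis using T(2) by linarith
  qed
  then show False by (rule polynomial_growth_bound)
qed

text \<open>Some nontrivial relation \<open>\<Sum> c\<^sub>i \<theta>\<^sub>i + c\<^sub>r \<psi> = 0\<close> holds, with \<open>\<theta>\<^sub>i (a, x) = - x(\<phi>(a) e\<^sub>i)\<close>. If \<open>c\<^sub>r\<close> were zero, a
  nonzero element of \<open>\<dd>\<close> would be annihilated from the left by a nonzero value of \<open>\<phi>\<close>; so \<open>\<psi>\<close> is a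
  combination of the \<open>\<theta>\<^sub>i\<close>, that is, \<open>- x(\<phi>(a) q)\<close> for some \<open>q\<close> in \<open>\<dd>\<close>.\<close>

lemma mode_shift_into_phi:
  assumes fd: "\<exists>B. finite_dimensional_vector_space sD B" and fin: "finite_h_module actV" and y: "functional y"
  shows "\<exists>q. \<forall>v\<in>V\<phi>. mode b y v - actV (\<iota> q) v \<in> V\<phi>"
proof -
  obtain \<psi> where \<psi>: "eigen.raises (mode b y) \<psi>" and \<psi>0: "(\<forall>e\<in>I. \<phi> e = 0) \<Longrightarrow> \<forall>\<alpha>\<in>modes. \<psi> \<alpha> = 0"
    using raises_mode[OF y] by blast
  have suffices: ?thesis if q: "\<And>a x. a \<in> I \<Longrightarrow> functional x \<Longrightarrow> \<psi> (a, x) = - x (\<phi> a * \<iota> q)" for q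
  proof (intro exI ballI)
    fix v assume v: "v \<in> V\<phi>"
    have "\<tau> \<alpha> (mode b y v - actV (\<iota> q) v) = 0" if \<alpha>: "\<alpha> \<in> modes" for \<alpha>
    proof -
      obtain a x where ax: "\<alpha> = (a, x)" "a \<in> I" "functional x" using \<alpha> by (cases \<alpha>) auto
      show ?thesis
        unfolding linD(4)[OF eigen.lin_\<tau>[OF \<alpha>]] raises_on_phi[OF \<psi> v \<alpha>] raises_on_phi[OF raises_iota v \<alpha>]
        by (simp add: ax(1) q[OF ax(2,3)])
    qed
    then show "mode b y v - actV (\<iota> q) v \<in> V\<phi>" using phi_space_iff by blast
  qed
  consider (zero) "\<forall>e\<in>I. \<phi> e = 0" | (trivial) "V\<phi> \<subseteq> {0}"
    | (main) a v where "a \<in> I" "\<phi> a \<noteq> 0" "v \<in> V\<phi>" "v \<noteq> 0" by blast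
  then show ?thesis
  proof cases
    case zero
    then have "\<psi> (a, x) = 0" if "a \<in> I" "functional x" for a x using \<psi>0 that by blast
    with zero show ?thesis by (intro suffices[of 0]) (simp add: linD(3)[of sH "(*)"])
  next
    case trivial
    then show ?thesis using VM.W.subspace_0[OF subspace_phi] linD(3)[OF mode_lin[OF y]]
      by (intro exI[of _ 0]) (auto simp: VM.act_zero)
  next
    case (main a\<^sub>0 v)
    obtain B where B: "finite_dimensional_vector_space sD B" using fd by blast
    obtain p r where p_indep: "\<And>c i. (\<Sum>i<r. sH (c i) (\<iota> (p i))) = 0 \<Longrightarrow> i < r \<Longrightarrow> c i = 0"
      and p_span: "\<And>q. \<exists>c. \<iota> q = (\<Sum>i<r::nat. sH (c i) (\<iota> (p i)))" by (rule iota_basis[OF B], rule that, assumption+)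
    let ?\<theta> = "\<lambda>i (a, x). - x (\<phi> a * \<iota> (p i))"
    have combine: "(\<Sum>i<r. c i * x (h * \<iota> (p i))) = x (h * \<iota> (\<Sum>i<r. sD (c i) (p i)))"
      if x: "functional x" for c x h
      by (simp add: iota_sum iota_scale sum_distrib_left scalar_out lin_sum[OF x] linD[OF x])
    have "\<exists>c i. (\<forall>\<alpha>\<in>modes. (\<Sum>i<r. c i * ?\<theta> i \<alpha>) + c r * \<psi> \<alpha> = 0) \<and> i < Suc r \<and> c i \<noteq> 0"
      (is ?relation)
    proof (rule ccontr)
      assume *: "\<not> ?relation"
      show False
      proof (rule no_independent_raising_mode[OF fin main(3,4) y \<psi> p_span])
        fix c i assume zero: "\<And>\<alpha>. \<alpha> \<in> modes \<Longrightarrow> (\<Sum>i<r. c i * ?\<theta> i \<alpha>) + c r * \<psi> \<alpha> = 0" and i: "i < Suc r"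
        show "c i = 0"
        proof (rule ccontr)
          assume "c i \<noteq> 0"
          with i have ?relation by (intro exI[of _ c] exI[of _ i] conjI ballI zero)
          with * show False by (rule notE)
        qed
      qed
    qed
    then obtain c i where c: "\<And>\<alpha>. \<alpha> \<in> modes \<Longrightarrow> (\<Sum>i<r. c i * ?\<theta> i \<alpha>) + c r * \<psi> \<alpha> = 0"
      and i: "i < Suc r" "c i \<noteq> 0" by blast
    have rel: "c r * \<psi> (a, x) = x (\<phi> a * \<iota> (\<Sum>i<r. sD (c i) (p i)))" if "a \<in> I" "functional x" for a x
      using c[of "(a, x)"] that combine[OF that(2), of c "\<phi> a"] by (simp add: sum_negf)
    have "c r \<noteq> 0"
    proof
      assume cr: "c r = 0"
      let ?q = "\<Sum>i<r. sD (c i) (p i)"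
      have "\<phi> a\<^sub>0 * \<iota> ?q = 0" by (rule functionals_separate) (use rel[OF main(1)] cr in simp)
      then have "\<iota> ?q = 0" using right_mult_iota_injective main(2) by blast
      then have "(\<Sum>i<r. sH (c i) (\<iota> (p i))) = 0" by (simp add: iota_sum iota_scale)
      then have "i < r \<Longrightarrow> c i = 0" by (rule p_indep)
      with i cr show False by (cases "i = r") auto
    qed
    show ?thesis
    proof (rule suffices[of "\<Sum>i<r. sD (- c i / c r) (p i)"])
      fix a x assume ax: "a \<in> I" "functional x"
      have "x (\<phi> a * \<iota> (\<Sum>i<r. sD (- c i / c r) (p i))) = (\<Sum>i<r. - c i / c r * x (\<phi> a * \<iota> (p i)))"
        by (rule combine[OF ax(2), symmetric])
      also have "\<dots> = - (inverse (c r) * (\<Sum>i<r. c i * x (\<phi> a * \<iota> (p i))))"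
        by (simp add: sum_distrib_left sum_negf[symmetric] divide_inverse mult.assoc mult.left_commute)
      also have "\<dots> = - \<psi> (a, x)" using rel[OF ax] combine[OF ax(2), of c "\<phi> a"] \<open>c r \<noteq> 0\<close> by (simp add: field_simps)
      finally show "\<psi> (a, x) = - x (\<phi> a * \<iota> (\<Sum>i<r. sD (- c i / c r) (p i)))" by simp
    qed
  qed
qed

end

section \<open>The annihilation algebra\<close>

context pseudo_module
begin

lemma functional_H_dual: assumes "x \<in> H_dual sH" shows "functional x"
proof -
  interpret x: Vector_Spaces.linear sH "(*)" x using assms by (simp add: H_dual_def)
  show ?thesis by (simp add: lin_def x.add x.scale)
qed

lemma fourier_act_eq_mode:
  assumes x: "functional x"
  shows "fourier_act sH \<iota> actV star x a v = mode a (\<lambda>h. x (S h)) v"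
  unfolding fourier_act_def
proof (rule the_equality)
  have eval: "mode a (\<lambda>h. x (S h)) v = (\<Sum>(h, u)\<in>Poly_Mapping.keys z. sV (of_int (Poly_Mapping.lookup z (h, u)) * x (S h)) u)"
    if z: "star a v = VM.nf z +o VM.N2" for z
  proof -
    note xS = functional_antipode[OF x]
    have "mode a (\<lambda>h. x (S h)) v = feval sV (\<lambda>(h, u). sV (x (S h)) u) z"
      unfolding mode_def z VM.coef_coset[OF xS]
      by (simp add: VM.W.feval_frag_extend case_prod_beta' VM.W.feval_simps VM.K_one[OF xS])
    then show ?thesis by (simp add: feval_def case_prod_beta')
  qed
  obtain t where t: "star a v = t +o VM.N2" using star_rules(1)[of a v] by (auto simp: cosets_def)
  obtain z where "t - VM.nf z \<in> VM.N2" using VM.normal_form_exists by blast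
  then have z: "star a v = VM.nf z +o VM.N2" unfolding t by (rule coset_eq_iff[OF VM.pt2_sub, THEN iffD2])
  then show "\<exists>z. star a v = VM.nf z +o VM.N2 \<and>
      mode a (\<lambda>h. x (S h)) v = (\<Sum>(h, u)\<in>Poly_Mapping.keys z. sV (of_int (Poly_Mapping.lookup z (h, u)) * x (S h)) u)"
    by (intro exI[of _ z] conjI eval)
  show "w = mode a (\<lambda>h. x (S h)) v" if "\<exists>z. star a v = VM.nf z +o VM.N2 \<and>
      w = (\<Sum>(h, u)\<in>Poly_Mapping.keys z. sV (of_int (Poly_Mapping.lookup z (h, u)) * x (S h)) u)" for w
    using that eval by (elim exE conjE) (simp only:)
qed

text \<open>The entries of the basis form of \<open>a * v\<close> are modes of \<open>a\<close> applied to \<open>v\<close>.\<close>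

lemma star_in_sub_left:
  assumes mode: "\<And>x. functional x \<Longrightarrow> mode a x v \<in> U"
  shows "star a v \<in> pt2_sub_left sH \<iota> actV U"
proof -
  obtain t where t: "star a v = t +o VM.N2" using star_rules(1)[of a v] by (auto simp: cosets_def)
  obtain T where T: "t - (\<Sum>b\<in>T. frag_of (b, 1, feval sV (\<lambda>(f, g, m). VM.K (coord b) f g m) t)) \<in> VM.N2"
    using VM.basis_form by blast
  have "feval sV (\<lambda>(f, g, m). VM.K (coord b) f g m) t = mode a (coord b) v" for b
    by (simp add: mode_def t VM.coef_coset[OF functional_coord])
  then have "t - (\<Sum>b\<in>T. frag_of (b, 1, mode a (coord b) v)) \<in> VM.N2" using T by simp
  then have "star a v = (\<Sum>b\<in>T. frag_of (b, 1, mode a (coord b) v)) +o VM.N2"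
    by (simp add: t coset_eq_iff[OF VM.pt2_sub])
  moreover have "(\<Sum>b\<in>T. frag_of (b, 1, mode a (coord b) v)) \<in> group_closure {frag_of (f, 1, u) | f u. u \<in> U}"
    by (rule subgroup_sum[OF additive_subgroup_closure], rule closure_base)
      (use mode[OF functional_coord] in blast)
  ultimately show ?thesis unfolding pt2_sub_left_def by (rule image_eqI)
qed

text \<open>A chosen representative of a coset in the annihilation algebra need not be the given one, but the
  two differ by relators, and these involve only linear functionals.\<close>

lemma annih_representative:
  assumes \<beta>: "\<beta> \<in> annih sH \<iota> actL" and xa: "(x, a) \<in> Poly_Mapping.keys (coset_rep \<beta>)"
  shows "functional x"
proof -
  let ?F = "Collect functional \<times> UNIV :: (('h \<Rightarrow> 'k) \<times> 'l) set"
  obtain z where z: "\<beta> = z +o annih_null sH \<iota> actL" "Poly_Mapping.keys z \<subseteq> H_dual sH \<times> UNIV"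
    using \<beta> by (auto simp: annih_def)
  have "additive_subgroup (annih_null sH \<iota> actL)" by (simp add: annih_null_def additive_subgroup_closure)
  from coset_rep_cong[OF this] have "coset_rep \<beta> - z \<in> annih_null sH \<iota> actL" by (simp add: z)
  moreover have "Poly_Mapping.keys y \<subseteq> ?F" if "y \<in> annih_null sH \<iota> actL" for y
    using that unfolding annih_null_def
  proof induction
    case (base s)
    have single: "Poly_Mapping.keys (frag_of (x, a)) \<subseteq> ?F" if "functional x" for x and a :: 'l
      using that by simp
    have diff: "Poly_Mapping.keys (s - t) \<subseteq> ?F" if "Poly_Mapping.keys s \<subseteq> ?F" "Poly_Mapping.keys t \<subseteq> ?F" for s t
      using that keys_diff[of s t] by blast
    consider "s = 0"
      | x y a where "s = frag_of (\<lambda>f. x f + y f, a) - frag_of (x, a) - frag_of (y, a)" "functional x" "functional y"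
      | x a b where "s = frag_of (x, a + b) - frag_of (x, a) - frag_of (x, b)" "functional x"
      | x h a where "s = frag_of (dual_right sH \<iota> x h, a) - frag_of (x, actL h a)" "functional x"
      using base functional_H_dual by blast
    then show ?case
    proof cases
      case 2
      show ?thesis unfolding 2(1) by (intro diff single 2 functional_plus)
    next
      case 3
      show ?thesis unfolding 3(1) by (intro diff single 3)
    next
      case 4
      show ?thesis unfolding 4(1) dual_right_def by (intro diff single 4 functional_right)
    qed simp
  next
    case (diff s t)
    then show ?case using keys_diff[of s t] by blast
  qed
  ultimately have "Poly_Mapping.keys (coset_rep \<beta> - z) \<subseteq> ?F" by blast
  moreover have "Poly_Mapping.keys z \<subseteq> ?F" using z(2) functional_H_dual by auto
  moreover have "Poly_Mapping.keys (coset_rep \<beta>) \<subseteq> Poly_Mapping.keys (coset_rep \<beta> - z) \<union> Poly_Mapping.keys z"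
    using keys_add[of "coset_rep \<beta> - z" z] by simp
  ultimately show ?thesis using xa by auto
qed

lemma annih_act_eq_modes:
  assumes \<beta>: "\<beta> \<in> annih sH \<iota> actL"
  shows "annih_act sH \<iota> actV star \<beta> v =
    (\<Sum>(x, a)\<in>Poly_Mapping.keys (coset_rep \<beta>).
      sV (of_int (Poly_Mapping.lookup (coset_rep \<beta>) (x, a))) (mode a (\<lambda>h. x (S h)) v))"
  unfolding annih_act_def
  by (rule sum.cong[OF refl]) (auto simp: fourier_act_eq_mode[OF annih_representative[OF \<beta>]])

end

section \<open>The action on the eigenspace\<close>

context ideal_eigenspace
begin

context
  assumes fd: "\<exists>B. finite_dimensional_vector_space sD B" and fin: "finite_h_module actV"
begin

lemma mode_in_d_span:
  assumes x: "functional x" and v: "v \<in> V\<phi>"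
  shows "mode a x v \<in> d_span sH \<iota> actV V\<phi>"
proof -
  obtain q where "mode a x v - actV (\<iota> q) v \<in> V\<phi>" using mode_shift_into_phi[OF fd fin x] v by blast
  then have "actV (\<iota> q) v + (mode a x v - actV (\<iota> q) v) \<in> VM.W.span ({actV (\<iota> p) u | p u. u \<in> V\<phi>} \<union> V\<phi>)"
    using v by (intro VM.W.span_add VM.W.span_base) auto
  then show ?thesis by (simp add: d_span_def)
qed

lemma star_in_d_span: "v \<in> V\<phi> \<Longrightarrow> star a v \<in> pt2_sub_left sH \<iota> actV (d_span sH \<iota> actV V\<phi>)"
  by (rule star_in_sub_left) (rule mode_in_d_span)

lemma annih_act_on_phi:
  assumes \<beta>: "\<beta> \<in> annih sH \<iota> actL"
  shows "\<exists>p A. endomorphism_on sV V\<phi> A \<and> (\<forall>v\<in>V\<phi>. annih_act sH \<iota> actV star \<beta> v = actV (\<iota> p) v + A v)"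
proof -
  note sub = VM.W.subspace_add[OF subspace_phi] VM.W.subspace_scale[OF subspace_phi] VM.W.subspace_0[OF subspace_phi]
  let ?B = "\<lambda>v. annih_act sH \<iota> actV star \<beta> v"
  have combine: "\<exists>q. \<forall>v\<in>V\<phi>. (\<Sum>k\<in>C. sV (c k) (f k v)) - actV (\<iota> q) v \<in> V\<phi>"
    if "finite C" "\<And>k. k \<in> C \<Longrightarrow> \<exists>q. \<forall>v\<in>V\<phi>. f k v - actV (\<iota> q) v \<in> V\<phi>" for C c and f :: "('h \<Rightarrow> 'k) \<times> 'l \<Rightarrow> 'v \<Rightarrow> 'v"
    using that
  proof (induction C)
    case empty
    then show ?case using sub(3) by (intro exI[of _ 0]) (simp add: iota_zero VM.act_zero)
  next
    case (insert k C)
    obtain q where q: "\<forall>v\<in>V\<phi>. f k v - actV (\<iota> q) v \<in> V\<phi>" using insert.prems by blast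
    obtain q' where q': "\<forall>v\<in>V\<phi>. (\<Sum>k\<in>C. sV (c k) (f k v)) - actV (\<iota> q') v \<in> V\<phi>" using insert by blast
    have "(\<Sum>k\<in>insert k C. sV (c k) (f k v)) - actV (\<iota> (sD (c k) q + q')) v \<in> V\<phi>" if v: "v \<in> V\<phi>" for v
    proof -
      have "sV (c k) (f k v - actV (\<iota> q) v) + ((\<Sum>k\<in>C. sV (c k) (f k v)) - actV (\<iota> q') v) \<in> V\<phi>"
        using q q' v by (intro sub) auto
      then show ?thesis using insert.hyps
        by (simp add: iota_add iota_scale V.act_add_left VM.act_scalar VM.W.scale_right_diff_distrib algebra_simps)
    qed
    then show ?case by blast
  qed
  define f where "f = (\<lambda>(x, a) v. mode a (\<lambda>h. x (S h)) v)"
  define c :: "('h \<Rightarrow> 'k) \<times> 'l \<Rightarrow> 'k" where "c k = of_int (Poly_Mapping.lookup (coset_rep \<beta>) k)" for k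
  let ?C = "Poly_Mapping.keys (coset_rep \<beta>)"
  have B: "?B v = (\<Sum>k\<in>?C. sV (c k) (f k v))" for v
    by (simp add: annih_act_eq_modes[OF \<beta>] f_def c_def case_prod_beta')
  have "\<exists>q. \<forall>v\<in>V\<phi>. f k v - actV (\<iota> q) v \<in> V\<phi>" if "k \<in> ?C" for k
    using mode_shift_into_phi[OF fd fin functional_antipode[OF annih_representative[OF \<beta>]]] that
    by (cases k) (auto simp: f_def)
  from combine[of ?C f c, OF finite_keys this]
  obtain q where q: "\<forall>v\<in>V\<phi>. ?B v - actV (\<iota> q) v \<in> V\<phi>" unfolding B by blast
  have f_lin: "lin sV sV (f k)" if "k \<in> ?C" for k
    using mode_lin[OF functional_antipode[OF annih_representative[OF \<beta>]]] that by (cases k) (auto simp: f_def)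
  have B_lin: "?B (u + v) = ?B u + ?B v" "?B (sV d u) = sV d (?B u)" for u v d
    unfolding B by (simp_all add: linD[OF f_lin] VM.W.scale_right_distrib sum.distrib VM.W.scale_sum_right mult.commute)
  have "endomorphism_on sV V\<phi> (\<lambda>v. ?B v - actV (\<iota> q) v)"
    unfolding endomorphism_on_def using q
    by (simp add: B_lin V.act_add_right VM.act_scalar VM.W.scale_right_diff_distrib)
  then show ?thesis by (intro exI[of _ q] exI[of _ "\<lambda>v. ?B v - actV (\<iota> q) v"]) simp
qed

text \<open>By induction on \<open>h\<close>, all modes map \<open>h v\<close> with \<open>v\<close> in \<open>V\<^sub>\<phi>\<close> into the \<open>H\<close>-span of \<open>V\<^sub>\<phi>\<close>: this set contains
  \<open>\<dd> V\<^sub>\<phi> + V\<^sub>\<phi>\<close>, and commuting a mode with \<open>\<dd>\<close> yields a mode.\<close>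

lemma h_span_phi_pseudo_submodule: "pseudo_submodule sH \<iota> actV star (h_span actV V\<phi>)"
proof -
  let ?U = "h_span actV V\<phi>"
  let ?G = "group_closure {frag_of (f, g, u) | f g u. u \<in> ?U}"
  have U: "additive_subgroup ?U" by (simp add: h_span_def additive_subgroup_closure)
  have base: "actV h u \<in> ?U" if "u \<in> V\<phi>" for h u
    unfolding h_span_def by (rule closure_base) (use that in blast)
  have act: "actV h u \<in> ?U" if "u \<in> ?U" for h u
  proof (rule closure_image_subset[OF U, of "actV h"])
    show "u \<in> group_closure {actV h u | h u. u \<in> V\<phi>}" using that by (simp add: h_span_def)
    fix s assume "s \<in> {actV h u | h u. u \<in> V\<phi>}"
    then obtain g u where "s = actV g u" "u \<in> V\<phi>" by blast
    then show "actV h s \<in> ?U" using base[of u "h * g"] by (simp add: V.act_mult)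
  qed (rule VM.act_diff)
  have d_span_U: "d_span sH \<iota> actV V\<phi> \<subseteq> ?U"
    unfolding d_span_def
  proof (rule VM.W.span_minimal)
    show "{actV (\<iota> p) u | p u. u \<in> V\<phi>} \<union> V\<phi> \<subseteq> ?U"
      using base[of _ 1] base by (auto simp: V.act_one)
    show "VM.W.subspace ?U"
      using subgroup_zero[OF U] subgroup_add[OF U] act by (auto simp: VM.W.subspace_def k_scale_def)
  qed
  have mode_base: "mode a x (actV h v) \<in> ?U" if "functional x" "v \<in> V\<phi>" for a x h v
    using that(1)
  proof (induction h arbitrary: x rule: H_induct_left)
    case one
    then show ?case using mode_in_d_span[OF one that(2), of a] d_span_U by (auto simp: V.act_one)
  next
    case (scale c h)
    then have "actV (sH c 1) (mode a x (actV h v)) \<in> ?U" by (intro act)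
    then show ?case unfolding VM.act_scalar(1)[of c h v] mode_scale[OF scale(2)] by (simp only: k_scale_def)
  next
    case (add g h)
    then show ?case using subgroup_add[OF U] by (simp add: V.act_add_left mode_add)
  next
    case (mult p h)
    then show ?case
      using act subgroup_diff[OF U] functional_right[OF mult(2)] by (simp add: V.act_mult mode_iota)
  qed
  have mode_U: "mode a x u \<in> ?U" if x: "functional x" and u: "u \<in> ?U" for a x u
  proof (rule closure_image_subset[OF U, of "mode a x"])
    show "u \<in> group_closure {actV h u | h u. u \<in> V\<phi>}" using u by (simp add: h_span_def)
    show "mode a x s \<in> ?U" if "s \<in> {actV h u | h u. u \<in> V\<phi>}" for s
      using that mode_base[OF x] by blast
  qed (rule linD(4)[OF mode_lin[OF x]])
  have "star a u \<in> pt2_sub sH \<iota> actV ?U" if "u \<in> ?U" for a u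
  proof -
    have "star a u \<in> pt2_sub_left sH \<iota> actV ?U"
      by (rule star_in_sub_left) (rule mode_U[OF _ that])
    moreover have "group_closure {frag_of (f, 1, u) | f u. u \<in> ?U} \<subseteq> ?G"
      by (rule closure_mono) blast
    ultimately show ?thesis unfolding pt2_sub_left_def pt2_sub_def by blast
  qed
  moreover have "h_submodule actV ?U"
    using subgroup_zero[OF U] subgroup_add[OF U] act by (simp add: h_submodule_def)
  ultimately show ?thesis by (simp add: pseudo_submodule_def)
qed

end

end

theorem proposition14p2:
  fixes sD :: "'k::{alg_closed_field, field_char_0} \<Rightarrow> 'd::ab_group_add \<Rightarrow> 'd"
    and brD :: "'d \<Rightarrow> 'd \<Rightarrow> 'd"
    and sH :: "'k \<Rightarrow> 'h::ring_1 \<Rightarrow> 'h"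
    and \<iota> :: "'d \<Rightarrow> 'h"
    and actL :: "'h \<Rightarrow> 'l::ab_group_add \<Rightarrow> 'l"
    and br :: "'l \<Rightarrow> 'l \<Rightarrow> ('h \<times> 'h \<times> 'l) fsum set"
    and actV :: "'h \<Rightarrow> 'v::ab_group_add \<Rightarrow> 'v"
    and star :: "'l \<Rightarrow> 'v \<Rightarrow> ('h \<times> 'h \<times> 'v) fsum set"
    and I :: "'l set" and \<phi> :: "'l \<Rightarrow> 'h" and V\<phi> :: "'v set"
  assumes "\<exists>B. finite_dimensional_vector_space sD B"
    and "lie_algebra sD brD"
    and "enveloping_algebra sD brD sH \<iota>"
    and "lie_pseudoalgebra sH \<iota> actL br"
    and "lie_pseudoalgebra_module sH \<iota> actL br actV star"
    and "pseudo_submodule sH \<iota> actL br I"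
    and "h_hom_to_H actL I \<phi>"
    and "V\<phi> = phi_space sH \<iota> actV star I \<phi>"
    and "V\<phi> \<noteq> {0}"
    and "finite_h_module actV"
  shows "(\<forall>a. \<forall>v\<in>V\<phi>. star a v \<in> pt2_sub_left sH \<iota> actV (d_span sH \<iota> actV V\<phi>)) \<and>
    (\<forall>\<beta>\<in>annih sH \<iota> actL. \<exists>p A. endomorphism_on (k_scale sH actV) V\<phi> A \<and>
       (\<forall>v\<in>V\<phi>. annih_act sH \<iota> actV star \<beta> v = actV (\<iota> p) v + A v)) \<and>
    pseudo_submodule sH \<iota> actV star (h_span actV V\<phi>)"
proof -
  interpret enveloping_algebra sD brD sH \<iota> by fact
  interpret lie_pseudoalgebra_module sH \<iota> actL br actV star by fact
  interpret ideal_eigenspace sD brD sH \<iota> actL br actV star I \<phi>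
    by unfold_locales fact
  show ?thesis
    unfolding assms(8)
    using star_in_d_span[OF assms(1,10)] annih_act_on_phi[OF assms(1,10)] h_span_phi_pseudo_submodule[OF assms(1,10)]
    by blast
qed

end
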